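(* Let $R$ be a ring with unity, let $\mathcal{X}$ be a semibrick of left $R$-modules such that every $X\in\mathcal{X}$ has projective dimension at most one, and let $U,V$ be $R$-modules. Let $f:U_{\mathcal{X}}(\infty)\to V_{\mathcal{X}}(\infty)$ be a homomorphism such that $f(U)\subseteq V_{\mathcal{X}}(r)$ for some $r\in\mathbb{N}$, $r\ge1$. Then $f(U_{\mathcal{X}}(i))\subseteq V_{\mathcal{X}}(i+r-1)$ for all integers $i\ge1$. In particular, if $U$ and $V$ lie in $\mathrm{Filt}(\mathcal{X})$ and $U$ is $\mathcal{X}$-semisimple, then $f(U_{\mathcal{X}}(i))\subseteq V_{\mathcal{X}}(i)$ for all integers $i\ge1$ (for every homomorphism $f:U_{\mathcal{X}}(\infty)\to V_{\mathcal{X}}(\infty)$).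
   Context: A brick is a finitely presented left $R$-module whose endomorphism ring is a division ring. A semibrick is a class $\mathcal{X}$ of pairwise non-isomorphic bricks with $\mathrm{Hom}(X,X')=0$ for distinct $X,X'\in\mathcal{X}$. $\mathcal{X}$-universal sequences: let $Y$ be a module. For each $X\in\mathcal{X}$, $\mathrm{Ext}^1(X,Y)$ is a left $\mathrm{End}(X)$-module (acting by pull-back; compositions written from left to right). Choose a basis $(0\to Y\to M_{X,i}\to X\to 0)_{i\in I_X}$ over the division ring $\mathrm{End}(X)$. The $\mathcal{X}$-universal short exact sequence $0\to Y\to M\to\bigoplus_{X\in\mathcal{X}}X^{(I_X)}\to 0$ starting from $Y$ is the push-out of $0\to\bigoplus_{X}Y^{(I_X)}\to\bigoplus_{X,i}M_{X,i}\to\bigoplus_{X}X^{(I_X)}\to 0$ along the summation map $\bigoplus_X Y^{(I_X)}\to Y$. Define $Y_{\mathcal{X}}(1)=Y$ and let $Y_{\mathcal{X}}(i)\to Y_{\mathcal{X}}(i+1)$ be the monomorphism of an $\mathcal{X}$-universal sequence starting from $Y_{\mathcal{X}}(i)$; $Y_{\mathcal{X}}(\infty)$ is the direct limit, and all $Y_{\mathcal{X}}(i)$ are viewed as submodules of it. $\mathrm{Filt}(\mathcal{X})$ is the class of modules $M$ admitting an ascending chain of submodules $(M_\lambda,\lambda\le\mu)$ ($\mu$ an ordinal) with $M_0=0$, $M_\mu=M$, $M_\nu=\bigcup_{\lambda<\nu}M_\lambda$ for limit ordinals $\nu\le\mu$, and each $M_{\lambda+1}/M_\lambda$ isomorphic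 to a module in $\mathcal{X}$. A module is $\mathcal{X}$-semisimple if it is isomorphic to a direct sum of objects from $\mathcal{X}$ (repetitions allowed). *)

theory Defs
  imports "HOL-Algebra.AbelCoset" "HOL-Algebra.Module"
begin

section \<open>Left modules over a ring with unity\<close>

text \<open>
  The locale \<^locale>\<open>module\<close> of the library requires a commutative ring. Left modules over
  arbitrary rings use the same record type; as there, its fields \<open>mult\<close> and \<open>one\<close> play no role.
\<close>

locale left_module = R?: ring R + M?: abelian_group M
  for R :: "('r, 'q) ring_scheme" (structure) and M :: "('r, 'm) module" (structure) +
  assumes smult_closed [simp, intro]:
      "\<lbrakk>a \<in> carrier R; x \<in> carrier M\<rbrakk> \<Longrightarrow> a \<odot>\<^bsub>M\<^esub> x \<in> carrier M"
    and smult_l_distr: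
      "\<lbrakk>a \<in> carrier R; b \<in> carrier R; x \<in> carrier M\<rbrakk> \<Longrightarrow>
        (a \<oplus>\<^bsub>R\<^esub> b) \<odot>\<^bsub>M\<^esub> x = a \<odot>\<^bsub>M\<^esub> x \<oplus>\<^bsub>M\<^esub> b \<odot>\<^bsub>M\<^esub> x"
    and smult_r_distr:
      "\<lbrakk>a \<in> carrier R; x \<in> carrier M; y \<in> carrier M\<rbrakk> \<Longrightarrow>
        a \<odot>\<^bsub>M\<^esub> (x \<oplus>\<^bsub>M\<^esub> y) = a \<odot>\<^bsub>M\<^esub> x \<oplus>\<^bsub>M\<^esub> a \<odot>\<^bsub>M\<^esub> y"
    and smult_assoc1:
      "\<lbrakk>a \<in> carrier R; b \<in> carrier R; x \<in> carrier M\<rbrakk> \<Longrightarrow>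
        (a \<otimes>\<^bsub>R\<^esub> b) \<odot>\<^bsub>M\<^esub> x = a \<odot>\<^bsub>M\<^esub> (b \<odot>\<^bsub>M\<^esub> x)"
    and smult_one [simp]: "x \<in> carrier M \<Longrightarrow> \<one>\<^bsub>R\<^esub> \<odot>\<^bsub>M\<^esub> x = x"

definition lmod_hom ::
  "('r, 'q) ring_scheme \<Rightarrow> ('r, 'a) module \<Rightarrow> ('r, 'b) module \<Rightarrow> ('a \<Rightarrow> 'b) set" where
  "lmod_hom R M N = {f \<in> carrier M \<rightarrow> carrier N.
     (\<forall>x\<in>carrier M. \<forall>y\<in>carrier M. f (x \<oplus>\<^bsub>M\<^esub> y) = f x \<oplus>\<^bsub>N\<^esub> f y) \<and>
     (\<forall>a\<in>carrier R. \<forall>x\<in>carrier M. f (a \<odot>\<^bsub>M\<^esub> x) = a \<odot>\<^bsub>N\<^esub> f x)}"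

definition lmod_iso ::
  "('r, 'q) ring_scheme \<Rightarrow> ('r, 'a) module \<Rightarrow> ('r, 'b) module \<Rightarrow> ('a \<Rightarrow> 'b) set" where
  "lmod_iso R M N = {f \<in> lmod_hom R M N. bij_betw f (carrier M) (carrier N)}"

definition lmod_isomorphic ::
  "('r, 'q) ring_scheme \<Rightarrow> ('r, 'a) module \<Rightarrow> ('r, 'b) module \<Rightarrow> bool" where
  "lmod_isomorphic R M N \<longleftrightarrow> lmod_iso R M N \<noteq> {}"

definition regular_lmod :: "('r, 'q) ring_scheme \<Rightarrow> ('r, 'r) module" where
  "regular_lmod R = \<lparr>carrier = carrier R, mult = mult R, one = one R,
     zero = zero R, add = add R, smult = mult R\<rparr>"

definition lmod_prod :: "('r, 'a) module \<Rightarrow> ('r, 'b) module \<Rightarrow> ('r, 'a \<times> 'b) module" where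
  "lmod_prod M N = \<lparr>carrier = carrier M \<times> carrier N,
     mult = undefined, one = undefined,
     zero = (\<zero>\<^bsub>M\<^esub>, \<zero>\<^bsub>N\<^esub>),
     add = (\<lambda>(x, y) (x', y'). (x \<oplus>\<^bsub>M\<^esub> x', y \<oplus>\<^bsub>N\<^esub> y')),
     smult = (\<lambda>a (x, y). (a \<odot>\<^bsub>M\<^esub> x, a \<odot>\<^bsub>N\<^esub> y))\<rparr>"

definition lmod_direct_sum :: "'i set \<Rightarrow> ('i \<Rightarrow> ('r, 'a) module) \<Rightarrow> ('r, 'i \<Rightarrow> 'a) module" where
  "lmod_direct_sum I M = \<lparr>carrier = {w \<in> (\<Pi>\<^sub>E i\<in>I. carrier (M i)). finite {i \<in> I. w i \<noteq> \<zero>\<^bsub>M i\<^esub>}},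
     mult = undefined, one = undefined,
     zero = (\<lambda>i\<in>I. \<zero>\<^bsub>M i\<^esub>),
     add = (\<lambda>v w. \<lambda>i\<in>I. v i \<oplus>\<^bsub>M i\<^esub> w i),
     smult = (\<lambda>a w. \<lambda>i\<in>I. a \<odot>\<^bsub>M i\<^esub> w i)\<rparr>"

definition lmod_quotient :: "('r, 'a) module \<Rightarrow> 'a set \<Rightarrow> ('r, 'a set) module" where
  "lmod_quotient M N = \<lparr>carrier = a_rcosets\<^bsub>M\<^esub> N,
     mult = undefined, one = undefined,
     zero = N,
     add = set_add M,
     smult = (\<lambda>a C. \<Union>c\<in>C. N +>\<^bsub>M\<^esub> (a \<odot>\<^bsub>M\<^esub> c))\<rparr>"

definition free_lmod :: "('r, 'q) ring_scheme \<Rightarrow> 'i set \<Rightarrow> ('r, 'i \<Rightarrow> 'r) module" where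
  "free_lmod R I = lmod_direct_sum I (\<lambda>_. regular_lmod R)"

definition finitely_presented :: "('r, 'q) ring_scheme \<Rightarrow> ('r, 'a) module \<Rightarrow> bool" where
  "finitely_presented R M \<longleftrightarrow> (\<exists>(m::nat) (n::nat) g h.
     g \<in> lmod_hom R (free_lmod R {..<m}) (free_lmod R {..<n}) \<and>
     h \<in> lmod_hom R (free_lmod R {..<n}) M \<and>
     h ` carrier (free_lmod R {..<n}) = carrier M \<and>
     g ` carrier (free_lmod R {..<m}) = a_kernel (free_lmod R {..<n}) M h)"


section \<open>Short exact sequences and projective dimension\<close>

text \<open>A value of this type carries the data \<open>Y \<rightarrow> E \<rightarrow> X\<close>; the modules \<open>Y\<close> and \<open>X\<close> are given separately.\<close>

record ('r, 'y, 'e, 'x) short_seq =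
  ext_inj :: "'y \<Rightarrow> 'e"
  ext_mid :: "('r, 'e) module"
  ext_proj :: "'e \<Rightarrow> 'x"

definition short_exact ::
  "('r, 'q) ring_scheme \<Rightarrow> ('r, 'y) module \<Rightarrow> ('r, 'x) module \<Rightarrow> ('r, 'y, 'e, 'x) short_seq \<Rightarrow> bool" where
  "short_exact R Y X s \<longleftrightarrow>
     left_module R Y \<and> left_module R (ext_mid s) \<and> left_module R X \<and>
     ext_inj s \<in> lmod_hom R Y (ext_mid s) \<and>
     ext_proj s \<in> lmod_hom R (ext_mid s) X \<and>
     inj_on (ext_inj s) (carrier Y) \<and>
     ext_proj s ` carrier (ext_mid s) = carrier X \<and>
     ext_inj s ` carrier Y = a_kernel (ext_mid s) X (ext_proj s)"

text \<open>
  A projective module is a direct summand of a free module (up to isomorphism). Index sets from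
  the carrier type of \<open>P\<close> suffice: a projective \<open>P\<close> is a direct summand of the free module
  on its own carrier.
\<close>

definition lmod_projective :: "('r, 'q) ring_scheme \<Rightarrow> ('r, 'p) module \<Rightarrow> bool" where
  "lmod_projective R P \<longleftrightarrow> left_module R P \<and>
     (\<exists>(I::'p set) N K. submodule N R (free_lmod R I) \<and> submodule K R (free_lmod R I) \<and>
        N \<inter> K = {\<zero>\<^bsub>free_lmod R I\<^esub>} \<and>
        N <+>\<^bsub>free_lmod R I\<^esub> K = carrier (free_lmod R I) \<and>
        lmod_isomorphic R P ((free_lmod R I)\<lparr>carrier := N\<rparr>))"

text \<open>
  Existence of a projective resolution \<open>0 \<rightarrow> P1 \<rightarrow> P0 \<rightarrow> X \<rightarrow> 0\<close>. Fixing the carrier type of the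
  resolution is no restriction: if the projective dimension is at most one, then one can take for
  \<open>P0\<close> the free module on the carrier of \<open>X\<close> and for \<open>P1\<close> a submodule of it (Schanuel).
\<close>

definition proj_dim_le_one :: "('r, 'q) ring_scheme \<Rightarrow> ('r, 'x) module \<Rightarrow> bool" where
  "proj_dim_le_one R X \<longleftrightarrow>
     (\<exists>(P1 :: ('r, 'x \<Rightarrow> 'r) module) (s :: ('r, 'x \<Rightarrow> 'r, 'x \<Rightarrow> 'r, 'x) short_seq).
        lmod_projective R P1 \<and> lmod_projective R (ext_mid s) \<and> short_exact R P1 X s)"


section \<open>Semibricks\<close>

definition division_ring :: "('d, 'q) ring_scheme \<Rightarrow> bool" where
  "division_ring D \<longleftrightarrow> ring D \<and> \<one>\<^bsub>D\<^esub> \<noteq> \<zero>\<^bsub>D\<^esub> \<and> Units D = carrier D - {\<zero>\<^bsub>D\<^esub>}"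

text \<open>
  Compositions are written from left to right: \<open>g \<otimes> h\<close> is \<open>g\<close> followed by \<open>h\<close>.
  Endomorphisms are made extensional so that equality is equality on the carrier.
\<close>

definition lmod_End :: "('r, 'q) ring_scheme \<Rightarrow> ('r, 'x) module \<Rightarrow> ('x \<Rightarrow> 'x) ring" where
  "lmod_End R X = \<lparr>carrier = lmod_hom R X X \<inter> extensional (carrier X),
     mult = (\<lambda>g h. compose (carrier X) h g),
     one = (\<lambda>x\<in>carrier X. x),
     zero = (\<lambda>x\<in>carrier X. \<zero>\<^bsub>X\<^esub>),
     add = (\<lambda>g h. \<lambda>x\<in>carrier X. g x \<oplus>\<^bsub>X\<^esub> h x)\<rparr>"

definition brick :: "('r, 'q) ring_scheme \<Rightarrow> ('r, 'x) module \<Rightarrow> bool" where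
  "brick R X \<longleftrightarrow> left_module R X \<and> finitely_presented R X \<and> division_ring (lmod_End R X)"

definition semibrick :: "('r, 'q) ring_scheme \<Rightarrow> ('r, 'x) module set \<Rightarrow> bool" where
  "semibrick R \<X> \<longleftrightarrow> (\<forall>X\<in>\<X>. brick R X) \<and>
     (\<forall>X\<in>\<X>. \<forall>X'\<in>\<X>. X \<noteq> X' \<longrightarrow>
        \<not> lmod_isomorphic R X X' \<and>
        (\<forall>h\<in>lmod_hom R X X'. \<forall>x\<in>carrier X. h x = \<zero>\<^bsub>X'\<^esub>))"


section \<open>The module of extensions\<close>

definition ext_equiv ::
  "('r, 'q) ring_scheme \<Rightarrow> ('r, 'y) module \<Rightarrow>
     ('r, 'y, 'e, 'x) short_seq \<Rightarrow> ('r, 'y, 'f, 'x) short_seq \<Rightarrow> bool" where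
  "ext_equiv R Y s t \<longleftrightarrow> (\<exists>\<phi>\<in>lmod_iso R (ext_mid s) (ext_mid t).
     (\<forall>y\<in>carrier Y. \<phi> (ext_inj s y) = ext_inj t y) \<and>
     (\<forall>a\<in>carrier (ext_mid s). ext_proj t (\<phi> a) = ext_proj s a))"

text \<open>
  Push-out along \<open>g : Y \<rightarrow> Y'\<close>: its middle term is the quotient of \<open>Y' \<oplus> E\<close> by
  all \<open>(g y, - ext_inj s y)\<close>.
\<close>

definition pushout_seq ::
  "('r, 'y) module \<Rightarrow> ('r, 'z) module \<Rightarrow> ('y \<Rightarrow> 'z) \<Rightarrow> ('r, 'y, 'e, 'x) short_seq \<Rightarrow>
     ('r, 'z, ('z \<times> 'e) set, 'x) short_seq" where
  "pushout_seq Y Y' g s =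
     (let E = ext_mid s;
          P = lmod_prod Y' E;
          W = (\<lambda>y. (g y, \<ominus>\<^bsub>E\<^esub> ext_inj s y)) ` carrier Y
      in \<lparr>ext_inj = (\<lambda>z. W +>\<^bsub>P\<^esub> (z, \<zero>\<^bsub>E\<^esub>)),
          ext_mid = lmod_quotient P W,
          ext_proj = (\<lambda>C. the_elem ((\<lambda>(z, a). ext_proj s a) ` C))\<rparr>)"

definition pullback_seq ::
  "('r, 'w) module \<Rightarrow> ('w \<Rightarrow> 'x) \<Rightarrow> ('r, 'y, 'e, 'x) short_seq \<Rightarrow>
     ('r, 'y, 'e \<times> 'w, 'w) short_seq" where
  "pullback_seq X' h s =
     (let E = ext_mid s
      in \<lparr>ext_inj = (\<lambda>y. (ext_inj s y, \<zero>\<^bsub>X'\<^esub>)),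
          ext_mid = (lmod_prod E X')
            \<lparr>carrier := {(a, x). a \<in> carrier E \<and> x \<in> carrier X' \<and> ext_proj s a = h x}\<rparr>,
          ext_proj = snd\<rparr>)"

definition prod_seq ::
  "('r, 'y, 'e, 'x) short_seq \<Rightarrow> ('r, 'y, 'f, 'x) short_seq \<Rightarrow>
     ('r, 'y \<times> 'y, 'e \<times> 'f, 'x \<times> 'x) short_seq" where
  "prod_seq s t =
     \<lparr>ext_inj = map_prod (ext_inj s) (ext_inj t),
      ext_mid = lmod_prod (ext_mid s) (ext_mid t),
      ext_proj = map_prod (ext_proj s) (ext_proj t)\<rparr>"

definition split_seq ::
  "('r, 'y) module \<Rightarrow> ('r, 'x) module \<Rightarrow> ('r, 'y, 'y \<times> 'x, 'x) short_seq" where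
  "split_seq Y X =
     \<lparr>ext_inj = (\<lambda>y. (y, \<zero>\<^bsub>X\<^esub>)), ext_mid = lmod_prod Y X, ext_proj = snd\<rparr>"

definition direct_sum_seq ::
  "'i set \<Rightarrow> ('i \<Rightarrow> ('r, 'y, 'e, 'x) short_seq) \<Rightarrow> ('r, 'i \<Rightarrow> 'y, 'i \<Rightarrow> 'e, 'i \<Rightarrow> 'x) short_seq" where
  "direct_sum_seq I s =
     \<lparr>ext_inj = (\<lambda>w. \<lambda>i\<in>I. ext_inj (s i) (w i)),
      ext_mid = lmod_direct_sum I (\<lambda>i. ext_mid (s i)),
      ext_proj = (\<lambda>w. \<lambda>i\<in>I. ext_proj (s i) (w i))\<rparr>"

definition baer_sum ::
  "('r, 'y) module \<Rightarrow> ('r, 'x) module \<Rightarrow> ('r, 'y, 'e, 'x) short_seq \<Rightarrow> ('r, 'y, 'f, 'x) short_seq \<Rightarrow>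
     ('r, 'y, ('y \<times> ('e \<times> 'f) \<times> 'x) set, 'x) short_seq" where
  "baer_sum Y X s t =
     pushout_seq (lmod_prod Y Y) Y (\<lambda>(y, y'). y \<oplus>\<^bsub>Y\<^esub> y')
       (pullback_seq X (\<lambda>x. (x, x)) (prod_seq s t))"

text \<open>
  As a set, the middle term of an extension of \<open>X\<close> by \<open>Y\<close> is in bijection with \<open>Y \<times> X\<close>. Hence
  every extension is equivalent to one whose middle term has carrier type \<open>'y \<times> 'x\<close>,
  and the extensions of this type represent all of \<open>Ext\<^sup>1(X, Y)\<close>. The class of an extension \<open>s\<close>
  with arbitrary carrier type consists of the extensions of this type equivalent to \<open>s\<close>.
\<close>

definition ext_class ::
  "('r, 'q) ring_scheme \<Rightarrow> ('r, 'y) module \<Rightarrow> ('r, 'x) module \<Rightarrow> ('r, 'y, 'e, 'x) short_seq \<Rightarrow>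
     ('r, 'y, 'y \<times> 'x, 'x) short_seq set" where
  "ext_class R Y X s = {t. short_exact R Y X t \<and> ext_equiv R Y s t}"

text \<open>\<open>Ext\<^sup>1(X, Y)\<close> as a left module over \<open>lmod_End R X\<close>, which acts by pull-back.\<close>

definition Ext1 ::
  "('r, 'q) ring_scheme \<Rightarrow> ('r, 'x) module \<Rightarrow> ('r, 'y) module \<Rightarrow>
     ('x \<Rightarrow> 'x, ('r, 'y, 'y \<times> 'x, 'x) short_seq set) module" where
  "Ext1 R X Y = \<lparr>
     carrier = ext_class R Y X ` {s :: ('r, 'y, 'y \<times> 'x, 'x) short_seq. short_exact R Y X s},
     mult = undefined, one = undefined,
     zero = ext_class R Y X (split_seq Y X),
     add = (\<lambda>A B. ext_class R Y X (baer_sum Y X (SOME s. s \<in> A) (SOME t. t \<in> B))),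
     smult = (\<lambda>h A. ext_class R Y X (pullback_seq X h (SOME s. s \<in> A)))\<rparr>"

definition lmod_basis :: "('d, 'q) ring_scheme \<Rightarrow> ('d, 'v) module \<Rightarrow> 'v set \<Rightarrow> bool" where
  "lmod_basis D V B \<longleftrightarrow> B \<subseteq> carrier V \<and>
     (\<forall>v\<in>carrier V. \<exists>F c. finite F \<and> F \<subseteq> B \<and> c \<in> F \<rightarrow> carrier D \<and>
        v = finsum V (\<lambda>b. c b \<odot>\<^bsub>V\<^esub> b) F) \<and>
     (\<forall>F c. finite F \<and> F \<subseteq> B \<and> c \<in> F \<rightarrow> carrier D \<and>
        finsum V (\<lambda>b. c b \<odot>\<^bsub>V\<^esub> b) F = \<zero>\<^bsub>V\<^esub> \<longrightarrow> (\<forall>b\<in>F. c b = \<zero>\<^bsub>D\<^esub>))"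


section \<open>Universal sequences\<close>

text \<open>
  \<open>B X\<close> is a basis of \<open>Ext\<^sup>1(X, Y)\<close>, which serves as the index set \<open>I\<^sub>X\<close>, and \<open>e X b\<close> is a short exact
  sequence representing the basis element \<open>b\<close>. The index set of the direct sums is \<open>Sigma \<X> B\<close>,
  that is, all pairs \<open>(X, b)\<close> with \<open>X \<in> \<X>\<close> and \<open>b \<in> B X\<close>.
\<close>

definition universal_pushout ::
  "('r, 'x) module set \<Rightarrow> ('r, 'y) module \<Rightarrow>
     (('r, 'x) module \<Rightarrow> 'b set) \<Rightarrow> (('r, 'x) module \<Rightarrow> 'b \<Rightarrow> ('r, 'y, 'e, 'x) short_seq) \<Rightarrow>
     ('r, 'y, ('y \<times> (('r, 'x) module \<times> 'b \<Rightarrow> 'e)) set, ('r, 'x) module \<times> 'b \<Rightarrow> 'x) short_seq" where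
  "universal_pushout \<X> Y B e =
     pushout_seq (lmod_direct_sum (Sigma \<X> B) (\<lambda>_. Y)) Y
       (\<lambda>w. finsum Y w {i \<in> Sigma \<X> B. w i \<noteq> \<zero>\<^bsub>Y\<^esub>})
       (direct_sum_seq (Sigma \<X> B) (\<lambda>(X, b). e X b))"

definition universal_sequence ::
  "('r, 'q) ring_scheme \<Rightarrow> ('r, 'x) module set \<Rightarrow> ('r, 'y) module \<Rightarrow>
     ('r, 'y, 'm, ('r, 'x) module \<times> ('r, 'y, 'y \<times> 'x, 'x) short_seq set \<Rightarrow> 'x) short_seq \<Rightarrow> bool" where
  "universal_sequence R \<X> Y s \<longleftrightarrow> (\<exists>B e.
     (\<forall>X\<in>\<X>. lmod_basis (lmod_End R X) (Ext1 R X Y) (B X)) \<and>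
     (\<forall>X\<in>\<X>. \<forall>b\<in>B X. e X b \<in> b) \<and>
     short_exact R Y (lmod_direct_sum (Sigma \<X> B) fst) s \<and>
     ext_equiv R Y s (universal_pushout \<X> Y B e))"

text \<open>
  \<open>Z\<close> is a direct limit \<open>Y\<^sub>\<X>(\<infinity>)\<close> and \<open>S i\<close>, for \<open>i \<ge> 1\<close>, is \<open>Y\<^sub>\<X>(i)\<close> viewed as a submodule of \<open>Z\<close>;
  the monomorphisms of the universal sequences become inclusions and the limit becomes the union.
  The value \<open>S 0\<close> is irrelevant.
\<close>

definition universal_tower ::
  "('r, 'q) ring_scheme \<Rightarrow> ('r, 'x) module set \<Rightarrow> ('r, 'y) module \<Rightarrow>
     (nat \<Rightarrow> 'y set) \<Rightarrow> ('r, 'y) module \<Rightarrow> bool" where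
  "universal_tower R \<X> Y S Z \<longleftrightarrow>
     left_module R Z \<and>
     (\<forall>i\<ge>1. submodule (S i) R Z) \<and>
     Z\<lparr>carrier := S 1\<rparr> = Y \<and>
     (\<forall>i\<ge>1. \<exists>p. universal_sequence R \<X> (Z\<lparr>carrier := S i\<rparr>)
        \<lparr>ext_inj = (\<lambda>y. y), ext_mid = Z\<lparr>carrier := S (Suc i)\<rparr>, ext_proj = p\<rparr>) \<and>
     carrier Z = (\<Union>i\<in>{1..}. S i)"


section \<open>Filtered and semisimple modules\<close>

text \<open>
  The ordinals \<open>\<lambda> \<le> \<mu>\<close> are represented by the elements of a well-order \<open>r\<close> with a greatest element.
\<close>

definition wo_succ :: "'o rel \<Rightarrow> 'o \<Rightarrow> 'o \<Rightarrow> bool" where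
  "wo_succ r a b \<longleftrightarrow> a \<in> underS r b \<and> (\<forall>c. a \<in> underS r c \<longrightarrow> (b, c) \<in> r)"

definition lmod_filtration ::
  "('r, 'q) ring_scheme \<Rightarrow> ('r, 'x) module set \<Rightarrow> ('r, 'm) module \<Rightarrow> 'o rel \<Rightarrow> ('o \<Rightarrow> 'm set) \<Rightarrow> bool" where
  "lmod_filtration R \<X> M r C \<longleftrightarrow>
     Well_order r \<and>
     (\<forall>a\<in>Field r. submodule (C a) R M) \<and>
     (\<forall>a b. (a, b) \<in> r \<longrightarrow> C a \<subseteq> C b) \<and>
     (\<forall>a\<in>Field r. underS r a = {} \<longrightarrow> C a = {\<zero>\<^bsub>M\<^esub>}) \<and>
     (\<exists>m\<in>Field r. (\<forall>a\<in>Field r. (a, m) \<in> r) \<and> C m = carrier M) \<and>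
     (\<forall>a\<in>Field r. underS r a \<noteq> {} \<and> (\<nexists>b. wo_succ r b a) \<longrightarrow> C a = (\<Union>b\<in>underS r a. C b)) \<and>
     (\<forall>a b. wo_succ r a b \<longrightarrow>
        (\<exists>X\<in>\<X>. lmod_isomorphic R (lmod_quotient (M\<lparr>carrier := C b\<rparr>) (C a)) X))"

text \<open>
  Bricks are nonzero, so for a semibrick \<open>\<X>\<close> the chain in a filtration is strictly increasing. Hence it is
  no restriction to take the well-order on the type of subsets of \<open>M\<close>. For the same reason the index set
  of an \<open>\<X>\<close>-semisimple decomposition of \<open>M\<close> can be taken from the carrier type of \<open>M\<close>.
\<close>

definition Filt ::
  "('r, 'q) ring_scheme \<Rightarrow> ('r, 'x) module set \<Rightarrow> ('r, 'm) module \<Rightarrow> bool" where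
  "Filt R \<X> M \<longleftrightarrow> left_module R M \<and> (\<exists>(r :: 'm set rel) C. lmod_filtration R \<X> M r C)"

definition semisimple_over ::
  "('r, 'q) ring_scheme \<Rightarrow> ('r, 'x) module set \<Rightarrow> ('r, 'm) module \<Rightarrow> bool" where
  "semisimple_over R \<X> M \<longleftrightarrow> left_module R M \<and>
     (\<exists>(I :: 'm set) g. g \<in> I \<rightarrow> \<X> \<and> lmod_isomorphic R M (lmod_direct_sum I g))"

end

theory Submission
  imports Defs
begin

text \<open>
  Let \<open>0 \<rightarrow> Y \<rightarrow> M \<rightarrow> \<Oplus>X \<rightarrow> 0\<close> be a universal sequence. As the chosen classes span \<open>Ext\<^sup>1(X, Y)\<close>, the map
  \<open>Ext\<^sup>1(X, Y) \<rightarrow> Ext\<^sup>1(X, M)\<close> is zero; as they are linearly independent and \<open>\<X>\<close> is a semibrick, every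
  homomorphism \<open>X \<rightarrow> M\<close> has its image in \<open>Y\<close>. Since bricks are finitely generated, every homomorphism
  \<open>X \<rightarrow> V(\<infinity>)\<close> has its image in \<open>V(1)\<close>. This settles the semisimple case. If \<open>f\<close> maps \<open>U(i)\<close> into \<open>V(j)\<close>,
  then on the preimage \<open>E\<close> in \<open>U(i+1)\<close> of a summand \<open>X\<close> of \<open>U(i+1)/U(i)\<close> the restriction of \<open>f\<close> to
  \<open>U(i)\<close> extends to a map \<open>E \<rightarrow> V(j+1)\<close>; its difference from \<open>f\<close> factors through \<open>X\<close> and so has values
  in \<open>V(1)\<close>. Hence \<open>f\<close> maps \<open>U(i+1)\<close> into \<open>V(j+1)\<close>.

  Extension classes are computed with cocycles of set-theoretic sections: under Baer sum cocycles
  add up, and under pull-back and push-out they are composed with the given map.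
\<close>

section \<open>Left modules\<close>

lemma (in left_module) smult_l_null [simp]:
  assumes "x \<in> carrier M"
  shows "\<zero>\<^bsub>R\<^esub> \<odot>\<^bsub>M\<^esub> x = \<zero>\<^bsub>M\<^esub>"
  using smult_l_distr[of "\<zero>\<^bsub>R\<^esub>" "\<zero>\<^bsub>R\<^esub>" x] assms by (simp add: M.add.r_cancel_one')

lemma (in left_module) smult_r_null [simp]:
  assumes "a \<in> carrier R"
  shows "a \<odot>\<^bsub>M\<^esub> \<zero>\<^bsub>M\<^esub> = \<zero>\<^bsub>M\<^esub>"
  using smult_r_distr[of a "\<zero>\<^bsub>M\<^esub>" "\<zero>\<^bsub>M\<^esub>"] assms by (simp add: M.add.r_cancel_one')

lemma (in left_module) minus_zero [simp]: "\<ominus>\<^bsub>M\<^esub> \<zero>\<^bsub>M\<^esub> = \<zero>\<^bsub>M\<^esub>"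
  by (rule M.minus_equality) simp_all

lemma (in left_module) smult_r_minus:
  assumes "a \<in> carrier R" "x \<in> carrier M"
  shows "a \<odot>\<^bsub>M\<^esub> (\<ominus>\<^bsub>M\<^esub> x) = \<ominus>\<^bsub>M\<^esub> (a \<odot>\<^bsub>M\<^esub> x)"
proof -
  have "a \<odot>\<^bsub>M\<^esub> (\<ominus>\<^bsub>M\<^esub> x) \<oplus>\<^bsub>M\<^esub> a \<odot>\<^bsub>M\<^esub> x = \<zero>\<^bsub>M\<^esub>"
    using assms by (simp add: smult_r_distr[symmetric] M.l_neg)
  then show ?thesis using assms by (simp add: M.minus_equality)
qed

lemma (in left_module) smult_l_minus_one:
  assumes "x \<in> carrier M"
  shows "(\<ominus>\<^bsub>R\<^esub> \<one>\<^bsub>R\<^esub>) \<odot>\<^bsub>M\<^esub> x = \<ominus>\<^bsub>M\<^esub> x"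
proof -
  have "(\<ominus>\<^bsub>R\<^esub> \<one>\<^bsub>R\<^esub>) \<odot>\<^bsub>M\<^esub> x \<oplus>\<^bsub>M\<^esub> \<one>\<^bsub>R\<^esub> \<odot>\<^bsub>M\<^esub> x = \<zero>\<^bsub>M\<^esub>"
    using assms by (simp add: smult_l_distr[symmetric] R.l_neg del: smult_one)
  then show ?thesis using assms by (simp add: M.minus_equality)
qed

lemma lmod_hom_iff:
  assumes "left_module R M" "left_module R N"
  shows "f \<in> lmod_hom R M N \<longleftrightarrow> f \<in> carrier M \<rightarrow> carrier N \<and>
    (\<forall>r\<in>carrier R. \<forall>x\<in>carrier M. \<forall>y\<in>carrier M.
      f (r \<odot>\<^bsub>M\<^esub> x \<oplus>\<^bsub>M\<^esub> y) = r \<odot>\<^bsub>N\<^esub> f x \<oplus>\<^bsub>N\<^esub> f y)"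
    (is "?L \<longleftrightarrow> ?F \<and> ?A")
proof -
  interpret M: left_module R M by fact
  interpret N: left_module R N by fact
  show ?thesis
  proof
    assume ?L then show "?F \<and> ?A" by (auto simp: lmod_hom_def)
  next
    assume h: "?F \<and> ?A"
    then have F: "f x \<in> carrier N" if "x \<in> carrier M" for x using that by auto
    have add: "f (x \<oplus>\<^bsub>M\<^esub> y) = f x \<oplus>\<^bsub>N\<^esub> f y" if "x \<in> carrier M" "y \<in> carrier M" for x y
      using h[THEN conjunct2, rule_format, of "\<one>\<^bsub>R\<^esub>" x y] that F by simp
    have "f \<zero>\<^bsub>M\<^esub> = \<zero>\<^bsub>N\<^esub>"
      using add[of "\<zero>\<^bsub>M\<^esub>" "\<zero>\<^bsub>M\<^esub>"] F by (simp add: N.M.add.r_cancel_one')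
    then have "f (r \<odot>\<^bsub>M\<^esub> x) = r \<odot>\<^bsub>N\<^esub> f x" if "r \<in> carrier R" "x \<in> carrier M" for r x
      using h[THEN conjunct2, rule_format, of r x "\<zero>\<^bsub>M\<^esub>"] that F by simp
    with h add show ?L by (auto simp: lmod_hom_def)
  qed
qed

lemma lmod_hom_closed: "f \<in> lmod_hom R M N \<Longrightarrow> x \<in> carrier M \<Longrightarrow> f x \<in> carrier N"
  and lmod_hom_add: "f \<in> lmod_hom R M N \<Longrightarrow> x \<in> carrier M \<Longrightarrow> y \<in> carrier M \<Longrightarrow>
    f (x \<oplus>\<^bsub>M\<^esub> y) = f x \<oplus>\<^bsub>N\<^esub> f y"
  and lmod_hom_smult: "f \<in> lmod_hom R M N \<Longrightarrow> r \<in> carrier R \<Longrightarrow> x \<in> carrier M \<Longrightarrow>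
    f (r \<odot>\<^bsub>M\<^esub> x) = r \<odot>\<^bsub>N\<^esub> f x"
  by (auto simp: lmod_hom_def)

lemma lmod_hom_comp:
  "f \<in> lmod_hom R M N \<Longrightarrow> g \<in> lmod_hom R N P \<Longrightarrow> (\<lambda>x. g (f x)) \<in> lmod_hom R M P"
  by (auto simp: lmod_hom_def Pi_def)

lemma lmod_hom_zero:
  assumes "left_module R M" "left_module R N" "f \<in> lmod_hom R M N"
  shows "f \<zero>\<^bsub>M\<^esub> = \<zero>\<^bsub>N\<^esub>"
proof -
  interpret M: left_module R M by fact
  interpret N: left_module R N by fact
  show ?thesis
    using lmod_hom_add[OF assms(3), of "\<zero>\<^bsub>M\<^esub>" "\<zero>\<^bsub>M\<^esub>"] lmod_hom_closed[OF assms(3), of "\<zero>\<^bsub>M\<^esub>"]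
    by (simp add: N.M.add.r_cancel_one')
qed

lemma lmod_hom_minus:
  assumes "left_module R M" "left_module R N" "f \<in> lmod_hom R M N" "x \<in> carrier M"
  shows "f (\<ominus>\<^bsub>M\<^esub> x) = \<ominus>\<^bsub>N\<^esub> f x"
proof -
  interpret M: left_module R M by fact
  interpret N: left_module R N by fact
  have "f (\<ominus>\<^bsub>M\<^esub> x) \<oplus>\<^bsub>N\<^esub> f x = \<zero>\<^bsub>N\<^esub>"
    using lmod_hom_add[OF assms(3), of "\<ominus>\<^bsub>M\<^esub> x" x] assms(4) lmod_hom_zero[OF assms(1-3)]
    by (simp add: M.M.l_neg)
  then show ?thesis using lmod_hom_closed[OF assms(3)] assms(4) by (simp add: N.M.minus_equality)
qed

lemma left_module_surj:
  assumes "left_module R M" "\<pi> \<in> lmod_hom R M Q" "\<pi> ` carrier M = carrier Q"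
    "\<pi> \<zero>\<^bsub>M\<^esub> = \<zero>\<^bsub>Q\<^esub>"
  shows "left_module R Q"
proof -
  interpret M: left_module R M by fact
  have ex: "\<exists>x\<in>carrier M. u = \<pi> x" if "u \<in> carrier Q" for u using assms(3) that by auto
  have cl: "\<pi> x \<in> carrier Q" if "x \<in> carrier M" for x using assms(3) that by auto
  note add = lmod_hom_add[OF assms(2), symmetric]
  note smult = lmod_hom_smult[OF assms(2), symmetric]
  have z: "\<zero>\<^bsub>Q\<^esub> = \<pi> \<zero>\<^bsub>M\<^esub>" using assms(4) by simp
  have "abelian_group Q"
  proof (rule abelian_groupI)
    fix u v w assume "u \<in> carrier Q" "v \<in> carrier Q" "w \<in> carrier Q"
    then obtain x y t where "u = \<pi> x" "v = \<pi> y" "w = \<pi> t" "x \<in> carrier M" "y \<in> carrier M"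
      "t \<in> carrier M" using ex by metis
    then show "u \<oplus>\<^bsub>Q\<^esub> v \<oplus>\<^bsub>Q\<^esub> w = u \<oplus>\<^bsub>Q\<^esub> (v \<oplus>\<^bsub>Q\<^esub> w)" by (simp add: add M.a_assoc)
  next
    fix u v assume "u \<in> carrier Q" "v \<in> carrier Q"
    then obtain x y where "u = \<pi> x" "v = \<pi> y" "x \<in> carrier M" "y \<in> carrier M" using ex by metis
    then show "u \<oplus>\<^bsub>Q\<^esub> v \<in> carrier Q" "u \<oplus>\<^bsub>Q\<^esub> v = v \<oplus>\<^bsub>Q\<^esub> u" by (simp_all add: add cl M.a_comm)
  next
    show "\<zero>\<^bsub>Q\<^esub> \<in> carrier Q" by (simp add: z cl)
  next
    fix u assume "u \<in> carrier Q"
    then obtain x where x: "u = \<pi> x" "x \<in> carrier M" using ex by metis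
    then show "\<zero>\<^bsub>Q\<^esub> \<oplus>\<^bsub>Q\<^esub> u = u" by (simp add: z add)
    have "\<pi> (\<ominus>\<^bsub>M\<^esub> x) \<oplus>\<^bsub>Q\<^esub> u = \<zero>\<^bsub>Q\<^esub>" "\<pi> (\<ominus>\<^bsub>M\<^esub> x) \<in> carrier Q"
      using x by (simp_all add: add z cl M.l_neg)
    then show "\<exists>v\<in>carrier Q. v \<oplus>\<^bsub>Q\<^esub> u = \<zero>\<^bsub>Q\<^esub>" by blast
  qed
  moreover have "left_module_axioms R Q"
  proof
    fix a u v assume ab: "a \<in> carrier R" and "u \<in> carrier Q" "v \<in> carrier Q"
    then obtain x y where xy: "u = \<pi> x" "v = \<pi> y" "x \<in> carrier M" "y \<in> carrier M" using ex by metis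
    show "a \<odot>\<^bsub>Q\<^esub> (u \<oplus>\<^bsub>Q\<^esub> v) = a \<odot>\<^bsub>Q\<^esub> u \<oplus>\<^bsub>Q\<^esub> a \<odot>\<^bsub>Q\<^esub> v"
      using xy ab by (simp add: add smult M.smult_r_distr)
  next
    fix a b u assume ab: "a \<in> carrier R" "b \<in> carrier R" and "u \<in> carrier Q"
    then obtain x where x: "u = \<pi> x" "x \<in> carrier M" using ex by metis
    show "(a \<oplus>\<^bsub>R\<^esub> b) \<odot>\<^bsub>Q\<^esub> u = a \<odot>\<^bsub>Q\<^esub> u \<oplus>\<^bsub>Q\<^esub> b \<odot>\<^bsub>Q\<^esub> u"
      "a \<otimes>\<^bsub>R\<^esub> b \<odot>\<^bsub>Q\<^esub> u = a \<odot>\<^bsub>Q\<^esub> (b \<odot>\<^bsub>Q\<^esub> u)"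
      using x ab by (simp_all add: add smult M.smult_l_distr M.smult_assoc1)
  next
    fix a u assume "a \<in> carrier R" "u \<in> carrier Q"
    then show "a \<odot>\<^bsub>Q\<^esub> u \<in> carrier Q" using ex[of u] by (auto simp: smult cl)
  next
    fix u assume "u \<in> carrier Q"
    then show "\<one>\<^bsub>R\<^esub> \<odot>\<^bsub>Q\<^esub> u = u"
      using ex[of u] by (auto simp: smult)
  qed
  ultimately show ?thesis by (rule left_module.intro[OF M.ring_axioms])
qed

lemma (in left_module) submoduleI:
  assumes "H \<subseteq> carrier M" "\<zero>\<^bsub>M\<^esub> \<in> H"
    and "\<And>a x y. a \<in> carrier R \<Longrightarrow> x \<in> H \<Longrightarrow> y \<in> H \<Longrightarrow> a \<odot>\<^bsub>M\<^esub> x \<oplus>\<^bsub>M\<^esub> y \<in> H"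
  shows "submodule H R M"
proof -
  have s: "a \<odot>\<^bsub>M\<^esub> x \<in> H" if "a \<in> carrier R" "x \<in> H" for a x
    using assms(3)[OF that assms(2)] that assms(1) by (simp add: subset_iff)
  have a: "x \<oplus>\<^bsub>M\<^esub> y \<in> H" if "x \<in> H" "y \<in> H" for x y
    using assms(3)[of "\<one>\<^bsub>R\<^esub>" x y] that assms(1) by (simp add: subset_iff)
  have "\<ominus>\<^bsub>M\<^esub> x \<in> H" if "x \<in> H" for x
    using s[of "\<ominus>\<^bsub>R\<^esub> \<one>\<^bsub>R\<^esub>" x] smult_l_minus_one[of x] that assms(1) by (simp add: subset_iff)
  with a s assms show ?thesis
    by (intro submodule.intro subgroup.intro submodule_axioms.intro) (simp_all add: a_inv_def)
qed

lemma submoduleD: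
  assumes "submodule N R M"
  shows "N \<subseteq> carrier M" "\<zero>\<^bsub>M\<^esub> \<in> N" "\<And>x y. x \<in> N \<Longrightarrow> y \<in> N \<Longrightarrow> x \<oplus>\<^bsub>M\<^esub> y \<in> N"
    "\<And>a x. a \<in> carrier R \<Longrightarrow> x \<in> N \<Longrightarrow> a \<odot>\<^bsub>M\<^esub> x \<in> N" "\<And>x. x \<in> N \<Longrightarrow> \<ominus>\<^bsub>M\<^esub> x \<in> N"
  using assms subgroup.m_inv_closed[OF submodule.axioms(1)[OF assms]]
  by (auto simp: submodule_def subgroup_def submodule_axioms_def a_inv_def)

lemma left_module_submodule:
  assumes "left_module R M" "submodule N R M"
  shows "left_module R (M\<lparr>carrier := N\<rparr>)"
proof -
  interpret M: left_module R M by fact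
  note N = submoduleD[OF assms(2)]
  have c: "x \<in> carrier M" if "x \<in> N" for x using N(1) that by auto
  have "abelian_group (M\<lparr>carrier := N\<rparr>)"
  proof (rule abelian_groupI)
    fix u assume "u \<in> carrier (M\<lparr>carrier := N\<rparr>)"
    then show "\<exists>v\<in>carrier (M\<lparr>carrier := N\<rparr>). v \<oplus>\<^bsub>M\<lparr>carrier := N\<rparr>\<^esub> u = \<zero>\<^bsub>M\<lparr>carrier := N\<rparr>\<^esub>"
      by (intro bexI[of _ "\<ominus>\<^bsub>M\<^esub> u"]) (auto simp: N c M.l_neg)
  qed (auto simp: N c M.a_assoc intro: M.a_comm)
  then show ?thesis
    by (intro left_module.intro[OF M.ring_axioms] left_module_axioms.intro)
       (auto simp: N c M.smult_l_distr M.smult_r_distr M.smult_assoc1)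
qed

lemma left_module_prod:
  assumes "left_module R M" "left_module R N"
  shows "left_module R (lmod_prod M N)"
proof -
  interpret M: left_module R M by fact
  interpret N: left_module R N by fact
  have "abelian_group (lmod_prod M N)"
  proof (rule abelian_groupI)
    fix u assume "u \<in> carrier (lmod_prod M N)"
    then show "\<exists>v\<in>carrier (lmod_prod M N). v \<oplus>\<^bsub>lmod_prod M N\<^esub> u = \<zero>\<^bsub>lmod_prod M N\<^esub>"
      by (intro bexI[of _ "(\<ominus>\<^bsub>M\<^esub> fst u, \<ominus>\<^bsub>N\<^esub> snd u)"])
         (auto simp: lmod_prod_def M.l_neg N.l_neg)
  qed (auto simp: lmod_prod_def M.a_assoc N.a_assoc intro: M.a_comm N.a_comm)
  then show ?thesis
    by (intro left_module.intro[OF M.ring_axioms] left_module_axioms.intro)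
       (auto simp: lmod_prod_def M.smult_l_distr M.smult_r_distr M.smult_assoc1
         N.smult_l_distr N.smult_r_distr N.smult_assoc1)
qed

lemma left_module_direct_sum:
  assumes "ring R" "\<And>i. i \<in> I \<Longrightarrow> left_module R (M i)"
  shows "left_module R (lmod_direct_sum I M)" (is "left_module R ?S")
proof -
  have ab: "abelian_group (M i)" if "i \<in> I" for i using assms(2)[OF that] by (simp add: left_module_def)
  have car: "w \<in> carrier ?S \<longleftrightarrow> w \<in> extensional I \<and> (\<forall>i\<in>I. w i \<in> carrier (M i)) \<and>
      finite {i \<in> I. w i \<noteq> \<zero>\<^bsub>M i\<^esub>}" for w
    by (auto simp: lmod_direct_sum_def PiE_def)
  have z [simp]: "\<zero>\<^bsub>?S\<^esub> = (\<lambda>i\<in>I. \<zero>\<^bsub>M i\<^esub>)" by (simp add: lmod_direct_sum_def)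
  have add [simp]: "v \<oplus>\<^bsub>?S\<^esub> w = (\<lambda>i\<in>I. v i \<oplus>\<^bsub>M i\<^esub> w i)" for v w by (simp add: lmod_direct_sum_def)
  have smult [simp]: "a \<odot>\<^bsub>?S\<^esub> w = (\<lambda>i\<in>I. a \<odot>\<^bsub>M i\<^esub> w i)" for a w by (simp add: lmod_direct_sum_def)
  have add_cl: "v \<oplus>\<^bsub>?S\<^esub> w \<in> carrier ?S" if "v \<in> carrier ?S" "w \<in> carrier ?S" for v w
  proof -
    have "finite ({i \<in> I. v i \<noteq> \<zero>\<^bsub>M i\<^esub>} \<union> {i \<in> I. w i \<noteq> \<zero>\<^bsub>M i\<^esub>})" using that car by blast
    then have "finite {i \<in> I. (v \<oplus>\<^bsub>?S\<^esub> w) i \<noteq> \<zero>\<^bsub>M i\<^esub>}"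
      by (rule finite_subset[rotated]) (auto simp: abelian_groupE[OF ab])
    then show ?thesis using that by (auto simp: car abelian_groupE[OF ab])
  qed
  have smult_cl: "a \<odot>\<^bsub>?S\<^esub> w \<in> carrier ?S" if "a \<in> carrier R" "w \<in> carrier ?S" for a w
  proof -
    have "finite {i \<in> I. w i \<noteq> \<zero>\<^bsub>M i\<^esub>}" using that car by blast
    then have "finite {i \<in> I. (a \<odot>\<^bsub>?S\<^esub> w) i \<noteq> \<zero>\<^bsub>M i\<^esub>}"
      by (rule finite_subset[rotated]) (auto simp: left_module.smult_r_null[OF assms(2)] that)
    then show ?thesis using that by (auto simp: car left_module.smult_closed[OF assms(2)])
  qed
  have neg: "(\<lambda>i\<in>I. \<ominus>\<^bsub>M i\<^esub> w i) \<in> carrier ?S" if "w \<in> carrier ?S" for w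
  proof -
    have "finite {i \<in> I. w i \<noteq> \<zero>\<^bsub>M i\<^esub>}" using that car by blast
    then have "finite {i \<in> I. (\<lambda>i\<in>I. \<ominus>\<^bsub>M i\<^esub> w i) i \<noteq> \<zero>\<^bsub>M i\<^esub>}"
      by (rule finite_subset[rotated]) (auto simp: left_module.minus_zero[OF assms(2)])
    then show ?thesis using that by (auto simp: car abelian_group.a_inv_closed[OF ab])
  qed
  have "abelian_group ?S"
  proof (rule abelian_groupI)
    show "\<exists>v\<in>carrier ?S. v \<oplus>\<^bsub>?S\<^esub> u = \<zero>\<^bsub>?S\<^esub>" if "u \<in> carrier ?S" for u
      using neg[OF that] that
      by (intro bexI[of _ "\<lambda>i\<in>I. \<ominus>\<^bsub>M i\<^esub> u i"]) (auto simp: car fun_eq_iff abelian_group.l_neg[OF ab])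
    show "\<zero>\<^bsub>?S\<^esub> \<in> carrier ?S" by (auto simp: car abelian_groupE[OF ab] cong: conj_cong)
    show "\<zero>\<^bsub>?S\<^esub> \<oplus>\<^bsub>?S\<^esub> u = u" if "u \<in> carrier ?S" for u
      using that by (auto simp: car fun_eq_iff abelian_groupE(5)[OF ab] extensional_def)
    show "u \<oplus>\<^bsub>?S\<^esub> v = v \<oplus>\<^bsub>?S\<^esub> u" if "u \<in> carrier ?S" "v \<in> carrier ?S" for u v
      using that by (auto simp: car fun_eq_iff abelian_groupE(4)[OF ab])
    show "u \<oplus>\<^bsub>?S\<^esub> v \<oplus>\<^bsub>?S\<^esub> w = u \<oplus>\<^bsub>?S\<^esub> (v \<oplus>\<^bsub>?S\<^esub> w)"
      if "u \<in> carrier ?S" "v \<in> carrier ?S" "w \<in> carrier ?S" for u v w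
      using that by (auto simp: car fun_eq_iff abelian_groupE(3)[OF ab])
  qed (rule add_cl)
  moreover have "left_module_axioms R ?S"
  proof (rule left_module_axioms.intro)
    show "\<one>\<^bsub>R\<^esub> \<odot>\<^bsub>?S\<^esub> u = u" if "u \<in> carrier ?S" for u
      using that by (auto simp: car fun_eq_iff left_module.smult_one[OF assms(2)] extensional_def)
  qed (use smult_cl in \<open>auto simp: car fun_eq_iff left_module.smult_l_distr[OF assms(2)]
      left_module.smult_r_distr[OF assms(2)] left_module.smult_assoc1[OF assms(2)]\<close>)
  ultimately show ?thesis by (rule left_module.intro[OF assms(1)])
qed

lemma lmod_quotient_hom:
  assumes "left_module R M" "submodule N R M"
  defines "\<pi> \<equiv> \<lambda>x. N +>\<^bsub>M\<^esub> x"
  shows "left_module R (lmod_quotient M N)"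
    and "\<pi> \<in> lmod_hom R M (lmod_quotient M N)"
    and "\<pi> ` carrier M = carrier (lmod_quotient M N)"
    and "\<And>x y. x \<in> carrier M \<Longrightarrow> y \<in> carrier M \<Longrightarrow> \<pi> x = \<pi> y \<longleftrightarrow> (\<exists>n\<in>N. x = n \<oplus>\<^bsub>M\<^esub> y)"
proof -
  interpret M: left_module R M by fact
  interpret N: abelian_subgroup N M
    by (rule abelian_subgroupI3) (use assms(2) in \<open>simp_all add: M.abelian_group_axioms
      additive_subgroup_def submodule_def\<close>)
  note Nd = submoduleD[OF assms(2)]
  have mem: "z \<in> \<pi> x \<longleftrightarrow> (\<exists>n\<in>N. z = n \<oplus>\<^bsub>M\<^esub> x)" for x z
    by (auto simp: \<pi>_def a_r_coset_def')
  show eq: "\<pi> x = \<pi> y \<longleftrightarrow> (\<exists>n\<in>N. x = n \<oplus>\<^bsub>M\<^esub> y)" if "x \<in> carrier M" "y \<in> carrier M" for x y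
    using N.a_rcos_self[OF that(1)] M.a_repr_independence[of x N y] that mem[of x y]
      submodule.axioms(1)[OF assms(2)] unfolding \<pi>_def by metis
  have smult: "(\<Union>c\<in>\<pi> x. N +>\<^bsub>M\<^esub> (a \<odot>\<^bsub>M\<^esub> c)) = \<pi> (a \<odot>\<^bsub>M\<^esub> x)"
    if "a \<in> carrier R" "x \<in> carrier M" for a x
  proof -
    have "N +>\<^bsub>M\<^esub> (a \<odot>\<^bsub>M\<^esub> c) = \<pi> (a \<odot>\<^bsub>M\<^esub> x)" if "c \<in> \<pi> x" for c
    proof -
      from that obtain n where n: "n \<in> N" "c = n \<oplus>\<^bsub>M\<^esub> x" by (auto simp: mem)
      with Nd(1) have "n \<in> carrier M" by auto
      with n \<open>a \<in> carrier R\<close> \<open>x \<in> carrier M\<close> eq[of "a \<odot>\<^bsub>M\<^esub> c" "a \<odot>\<^bsub>M\<^esub> x"] Nd(4)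
      show ?thesis by (auto simp: \<pi>_def M.smult_r_distr)
    qed
    moreover have "x \<in> \<pi> x" using N.a_rcos_self that by (simp add: \<pi>_def)
    ultimately show ?thesis by auto
  qed
  show hom: "\<pi> \<in> lmod_hom R M (lmod_quotient M N)"
    using N.a_rcos_sum smult
    by (auto simp: lmod_hom_def lmod_quotient_def \<pi>_def intro: M.a_rcosetsI[OF Nd(1)])
  show sur: "\<pi> ` carrier M = carrier (lmod_quotient M N)"
    by (auto simp: lmod_quotient_def \<pi>_def A_RCOSETS_def')
  show "left_module R (lmod_quotient M N)"
    by (rule left_module_surj[OF assms(1) hom sur])
       (simp add: \<pi>_def lmod_quotient_def M.a_coset_add_zero[OF Nd(1)])
qed

section \<open>Cocycles of extensions\<close>

text \<open>
  \<open>\<kappa>\<close> measures the failure of the map \<open>\<sigma>\<close> to be linear. The single expression \<open>r x + y\<close> treats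
  addition and scalar multiplication together.
\<close>

definition lin_defect ::
  "('r, 'q) ring_scheme \<Rightarrow> ('r, 'x) module \<Rightarrow> ('r, 'm) module \<Rightarrow> ('x \<Rightarrow> 'm) \<Rightarrow> ('r \<Rightarrow> 'x \<Rightarrow> 'x \<Rightarrow> 'm) \<Rightarrow> bool" where
  "lin_defect R X M \<sigma> \<kappa> \<longleftrightarrow> \<sigma> \<in> carrier X \<rightarrow> carrier M \<and>
     (\<forall>r\<in>carrier R. \<forall>x\<in>carrier X. \<forall>y\<in>carrier X. \<kappa> r x y \<in> carrier M \<and>
        r \<odot>\<^bsub>M\<^esub> \<sigma> x \<oplus>\<^bsub>M\<^esub> \<sigma> y = \<kappa> r x y \<oplus>\<^bsub>M\<^esub> \<sigma> (r \<odot>\<^bsub>X\<^esub> x \<oplus>\<^bsub>X\<^esub> y))"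

lemma lin_defectI:
  assumes "\<And>x. x \<in> carrier X \<Longrightarrow> \<sigma> x \<in> carrier M"
    and "\<And>r x y. r \<in> carrier R \<Longrightarrow> x \<in> carrier X \<Longrightarrow> y \<in> carrier X \<Longrightarrow> \<kappa> r x y \<in> carrier M"
    and "\<And>r x y. r \<in> carrier R \<Longrightarrow> x \<in> carrier X \<Longrightarrow> y \<in> carrier X \<Longrightarrow>
      r \<odot>\<^bsub>M\<^esub> \<sigma> x \<oplus>\<^bsub>M\<^esub> \<sigma> y = \<kappa> r x y \<oplus>\<^bsub>M\<^esub> \<sigma> (r \<odot>\<^bsub>X\<^esub> x \<oplus>\<^bsub>X\<^esub> y)"
  shows "lin_defect R X M \<sigma> \<kappa>"
  using assms by (auto simp: lin_defect_def)

lemma lin_defectD: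
  assumes "lin_defect R X M \<sigma> \<kappa>"
  shows "\<And>x. x \<in> carrier X \<Longrightarrow> \<sigma> x \<in> carrier M"
    and "\<And>r x y. r \<in> carrier R \<Longrightarrow> x \<in> carrier X \<Longrightarrow> y \<in> carrier X \<Longrightarrow> \<kappa> r x y \<in> carrier M"
    and "\<And>r x y. r \<in> carrier R \<Longrightarrow> x \<in> carrier X \<Longrightarrow> y \<in> carrier X \<Longrightarrow>
      r \<odot>\<^bsub>M\<^esub> \<sigma> x \<oplus>\<^bsub>M\<^esub> \<sigma> y = \<kappa> r x y \<oplus>\<^bsub>M\<^esub> \<sigma> (r \<odot>\<^bsub>X\<^esub> x \<oplus>\<^bsub>X\<^esub> y)"
  using assms by (auto simp: lin_defect_def)

lemma lin_defect_cong:
  assumes "left_module R X" "lin_defect R X M \<sigma> \<kappa>"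
    and "\<And>x. x \<in> carrier X \<Longrightarrow> \<sigma>' x = \<sigma> x"
    and "\<And>r x y. r \<in> carrier R \<Longrightarrow> x \<in> carrier X \<Longrightarrow> y \<in> carrier X \<Longrightarrow> \<kappa>' r x y = \<kappa> r x y"
  shows "lin_defect R X M \<sigma>' \<kappa>'"
proof -
  interpret X: left_module R X by fact
  from assms(2-4) show ?thesis by (simp add: lin_defect_def Pi_def)
qed

lemma lin_defect_zero_iff:
  assumes "left_module R X" "left_module R M"
  shows "lin_defect R X M \<sigma> (\<lambda>r x y. \<zero>\<^bsub>M\<^esub>) \<longleftrightarrow> \<sigma> \<in> lmod_hom R X M"
proof -
  interpret X: left_module R X by fact
  interpret M: left_module R M by fact
  have "\<sigma> \<in> carrier X \<rightarrow> carrier M \<Longrightarrow> ?thesis"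
    unfolding lmod_hom_iff[OF assms] lin_defect_def by (simp add: Pi_iff) metis
  then show ?thesis by (auto simp: lin_defect_def lmod_hom_def)
qed

lemma lin_defect_add:
  assumes "left_module R X" "left_module R M" "lin_defect R X M \<sigma> \<kappa>" "lin_defect R X M \<tau> \<rho>"
  shows "lin_defect R X M (\<lambda>x. \<sigma> x \<oplus>\<^bsub>M\<^esub> \<tau> x) (\<lambda>r x y. \<kappa> r x y \<oplus>\<^bsub>M\<^esub> \<rho> r x y)"
proof -
  interpret X: left_module R X by fact
  interpret M: left_module R M by fact
  note s = lin_defectD[OF assms(3)] note t = lin_defectD[OF assms(4)]
  show ?thesis
  proof (rule lin_defectI)
    fix r x y assume h: "r \<in> carrier R" "x \<in> carrier X" "y \<in> carrier X"
    have "r \<odot>\<^bsub>M\<^esub> (\<sigma> x \<oplus>\<^bsub>M\<^esub> \<tau> x) \<oplus>\<^bsub>M\<^esub> (\<sigma> y \<oplus>\<^bsub>M\<^esub> \<tau> y) =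
        (r \<odot>\<^bsub>M\<^esub> \<sigma> x \<oplus>\<^bsub>M\<^esub> \<sigma> y) \<oplus>\<^bsub>M\<^esub> (r \<odot>\<^bsub>M\<^esub> \<tau> x \<oplus>\<^bsub>M\<^esub> \<tau> y)"
      using h s(1) t(1) by (simp add: M.smult_r_distr M.M.a_ac)
    also have "\<dots> = (\<kappa> r x y \<oplus>\<^bsub>M\<^esub> \<rho> r x y) \<oplus>\<^bsub>M\<^esub> (\<sigma> (r \<odot>\<^bsub>X\<^esub> x \<oplus>\<^bsub>X\<^esub> y) \<oplus>\<^bsub>M\<^esub> \<tau> (r \<odot>\<^bsub>X\<^esub> x \<oplus>\<^bsub>X\<^esub> y))"
      using h s t by (simp add: M.M.a_ac)
    finally show "r \<odot>\<^bsub>M\<^esub> (\<sigma> x \<oplus>\<^bsub>M\<^esub> \<tau> x) \<oplus>\<^bsub>M\<^esub> (\<sigma> y \<oplus>\<^bsub>M\<^esub> \<tau> y) = \<dots>" .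
  qed (use s t in auto)
qed

lemma lin_defect_comp:
  assumes "left_module R X" "left_module R M" "lin_defect R X M \<sigma> \<kappa>" "g \<in> lmod_hom R M N"
  shows "lin_defect R X N (\<lambda>x. g (\<sigma> x)) (\<lambda>r x y. g (\<kappa> r x y))"
proof -
  interpret X: left_module R X by fact
  interpret M: left_module R M by fact
  note s = lin_defectD[OF assms(3)]
  note g = lmod_hom_closed[OF assms(4)]
    lmod_hom_add[OF assms(4), symmetric] lmod_hom_smult[OF assms(4), symmetric]
  show ?thesis using s by (intro lin_defectI) (simp_all add: g)
qed

lemma lin_defect_minus:
  assumes "left_module R X" "left_module R M" "lin_defect R X M \<sigma> \<kappa>" "lin_defect R X M \<tau> \<rho>"
  shows "lin_defect R X M (\<lambda>x. \<sigma> x \<ominus>\<^bsub>M\<^esub> \<tau> x) (\<lambda>r x y. \<kappa> r x y \<ominus>\<^bsub>M\<^esub> \<rho> r x y)"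
proof -
  interpret M: left_module R M by fact
  have "a_inv M \<in> lmod_hom R M M"
    by (auto simp: lmod_hom_def M.M.minus_add M.smult_r_minus)
  from lin_defect_add[OF assms(1-3) lin_defect_comp[OF assms(1,2,4) this]] show ?thesis
    by (simp add: a_minus_def)
qed

lemma lin_defect_precomp:
  assumes "left_module R X'" "h \<in> lmod_hom R X' X" "lin_defect R X M \<sigma> \<kappa>"
  shows "lin_defect R X' M (\<lambda>x. \<sigma> (h x)) (\<lambda>r x y. \<kappa> r (h x) (h y))"
proof -
  interpret X: left_module R X' by fact
  note s = lin_defectD[OF assms(3)]
  show ?thesis using s lmod_hom_closed[OF assms(2)]
    by (intro lin_defectI) (simp_all add: lmod_hom_add[OF assms(2)] lmod_hom_smult[OF assms(2)])
qed

lemma lin_defect_exists: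
  assumes "left_module R X" "left_module R M" "\<And>x. x \<in> carrier X \<Longrightarrow> \<sigma> x \<in> carrier M"
  shows "lin_defect R X M \<sigma> (\<lambda>r x y. (r \<odot>\<^bsub>M\<^esub> \<sigma> x \<oplus>\<^bsub>M\<^esub> \<sigma> y) \<ominus>\<^bsub>M\<^esub> \<sigma> (r \<odot>\<^bsub>X\<^esub> x \<oplus>\<^bsub>X\<^esub> y))"
proof -
  interpret X: left_module R X by fact
  interpret M: left_module R M by fact
  show ?thesis using assms(3) by (intro lin_defectI) (simp_all add: a_minus_def M.M.a_assoc M.M.l_neg)
qed

lemma lin_defect_reflect:
  assumes "left_module R X" "left_module R Y" "i \<in> lmod_hom R Y M" "inj_on i (carrier Y)"
    and "\<And>x. x \<in> carrier X \<Longrightarrow> n x \<in> carrier Y"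
    and "\<And>r x y. r \<in> carrier R \<Longrightarrow> x \<in> carrier X \<Longrightarrow> y \<in> carrier X \<Longrightarrow> \<kappa> r x y \<in> carrier Y"
    and "lin_defect R X M (\<lambda>x. i (n x)) (\<lambda>r x y. i (\<kappa> r x y))"
  shows "lin_defect R X Y n \<kappa>"
proof -
  interpret X: left_module R X by fact
  interpret Y: left_module R Y by fact
  show ?thesis
  proof (rule lin_defectI)
    fix r x y assume h: "r \<in> carrier R" "x \<in> carrier X" "y \<in> carrier X"
    have "i (r \<odot>\<^bsub>Y\<^esub> n x \<oplus>\<^bsub>Y\<^esub> n y) = i (\<kappa> r x y \<oplus>\<^bsub>Y\<^esub> n (r \<odot>\<^bsub>X\<^esub> x \<oplus>\<^bsub>X\<^esub> y))"
      using lin_defectD(3)[OF assms(7) h] h assms(5,6)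
      by (simp add: lmod_hom_add[OF assms(3)] lmod_hom_smult[OF assms(3)])
    then show "r \<odot>\<^bsub>Y\<^esub> n x \<oplus>\<^bsub>Y\<^esub> n y = \<kappa> r x y \<oplus>\<^bsub>Y\<^esub> n (r \<odot>\<^bsub>X\<^esub> x \<oplus>\<^bsub>X\<^esub> y)"
      by (rule inj_onD[OF assms(4)]) (use h assms(5,6) in auto)
  qed (use assms in auto)
qed

lemma short_exactD:
  assumes "short_exact R Y X s"
  shows "left_module R Y" "left_module R (ext_mid s)" "left_module R X"
    and "ext_inj s \<in> lmod_hom R Y (ext_mid s)" "ext_proj s \<in> lmod_hom R (ext_mid s) X"
    and "inj_on (ext_inj s) (carrier Y)"
    and "\<And>x. x \<in> carrier X \<Longrightarrow> \<exists>a\<in>carrier (ext_mid s). ext_proj s a = x"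
    and "\<And>y. y \<in> carrier Y \<Longrightarrow> ext_proj s (ext_inj s y) = \<zero>\<^bsub>X\<^esub>"
    and "\<And>a. a \<in> carrier (ext_mid s) \<Longrightarrow> ext_proj s a = \<zero>\<^bsub>X\<^esub> \<Longrightarrow> \<exists>y\<in>carrier Y. a = ext_inj s y"
proof -
  have s: "left_module R Y \<and> left_module R (ext_mid s) \<and> left_module R X \<and>
     ext_inj s \<in> lmod_hom R Y (ext_mid s) \<and> ext_proj s \<in> lmod_hom R (ext_mid s) X \<and>
     inj_on (ext_inj s) (carrier Y)"
    and p: "ext_proj s ` carrier (ext_mid s) = carrier X"
    and k: "ext_inj s ` carrier Y = {a \<in> carrier (ext_mid s). ext_proj s a = \<zero>\<^bsub>X\<^esub>}"
    using assms by (auto simp: short_exact_def a_kernel_def')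
  from s show "left_module R Y" "left_module R (ext_mid s)" "left_module R X"
    "ext_inj s \<in> lmod_hom R Y (ext_mid s)" "ext_proj s \<in> lmod_hom R (ext_mid s) X"
    "inj_on (ext_inj s) (carrier Y)" by auto
  show "\<And>x. x \<in> carrier X \<Longrightarrow> \<exists>a\<in>carrier (ext_mid s). ext_proj s a = x" using p by (metis imageE)
  show "\<And>y. y \<in> carrier Y \<Longrightarrow> ext_proj s (ext_inj s y) = \<zero>\<^bsub>X\<^esub>" using k by auto
  show "\<And>a. a \<in> carrier (ext_mid s) \<Longrightarrow> ext_proj s a = \<zero>\<^bsub>X\<^esub> \<Longrightarrow> \<exists>y\<in>carrier Y. a = ext_inj s y"
    using k by auto
qed

lemma short_exactI:
  assumes "left_module R Y" "left_module R (ext_mid s)" "left_module R X"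
    and "ext_inj s \<in> lmod_hom R Y (ext_mid s)" "ext_proj s \<in> lmod_hom R (ext_mid s) X"
    and "inj_on (ext_inj s) (carrier Y)"
    and "\<And>x. x \<in> carrier X \<Longrightarrow> \<exists>a\<in>carrier (ext_mid s). ext_proj s a = x"
    and "\<And>y. y \<in> carrier Y \<Longrightarrow> ext_proj s (ext_inj s y) = \<zero>\<^bsub>X\<^esub>"
    and "\<And>a. a \<in> carrier (ext_mid s) \<Longrightarrow> ext_proj s a = \<zero>\<^bsub>X\<^esub> \<Longrightarrow> \<exists>y\<in>carrier Y. a = ext_inj s y"
  shows "short_exact R Y X s"
  unfolding short_exact_def a_kernel_def'
  using assms lmod_hom_closed[OF assms(4)] lmod_hom_closed[OF assms(5)] by (auto simp: image_iff)

text \<open>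
  A cocycle of an extension comes from a set-theoretic section \<open>\<sigma>\<close>. Cocycles of the same extension
  differ by the defect of a map \<open>X \<rightarrow> Y\<close>.
\<close>

definition ext_cocycle ::
  "('r, 'q) ring_scheme \<Rightarrow> ('r, 'y) module \<Rightarrow> ('r, 'x) module \<Rightarrow> ('r, 'y, 'e, 'x) short_seq \<Rightarrow>
     ('r \<Rightarrow> 'x \<Rightarrow> 'x \<Rightarrow> 'y) \<Rightarrow> bool" where
  "ext_cocycle R Y X s \<kappa> \<longleftrightarrow>
     (\<forall>r\<in>carrier R. \<forall>x\<in>carrier X. \<forall>y\<in>carrier X. \<kappa> r x y \<in> carrier Y) \<and>
     (\<exists>\<sigma>. (\<forall>x\<in>carrier X. ext_proj s (\<sigma> x) = x) \<and>
       lin_defect R X (ext_mid s) \<sigma> (\<lambda>r x y. ext_inj s (\<kappa> r x y)))"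

lemma ext_cocycleI:
  assumes "\<And>r x y. r \<in> carrier R \<Longrightarrow> x \<in> carrier X \<Longrightarrow> y \<in> carrier X \<Longrightarrow> \<kappa> r x y \<in> carrier Y"
    and "\<And>x. x \<in> carrier X \<Longrightarrow> ext_proj s (\<sigma> x) = x"
    and "lin_defect R X (ext_mid s) \<sigma> (\<lambda>r x y. ext_inj s (\<kappa> r x y))"
  shows "ext_cocycle R Y X s \<kappa>"
  unfolding ext_cocycle_def using assms by (intro conjI exI[of _ \<sigma>]) simp_all

lemma ext_cocycleE:
  assumes "ext_cocycle R Y X s \<kappa>"
  obtains \<sigma> where "\<And>r x y. r \<in> carrier R \<Longrightarrow> x \<in> carrier X \<Longrightarrow> y \<in> carrier X \<Longrightarrow> \<kappa> r x y \<in> carrier Y"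
    and "\<And>x. x \<in> carrier X \<Longrightarrow> ext_proj s (\<sigma> x) = x"
    and "lin_defect R X (ext_mid s) \<sigma> (\<lambda>r x y. ext_inj s (\<kappa> r x y))"
  using assms that unfolding ext_cocycle_def by metis

lemma ext_cocycle_closed:
  assumes "ext_cocycle R Y X s \<kappa>" "r \<in> carrier R" "x \<in> carrier X" "y \<in> carrier X"
  shows "\<kappa> r x y \<in> carrier Y"
  using assms by (auto simp: ext_cocycle_def)

lemma ext_cocycle_cong:
  assumes "left_module R X" "ext_cocycle R Y X s \<kappa>"
    and "\<And>r x y. r \<in> carrier R \<Longrightarrow> x \<in> carrier X \<Longrightarrow> y \<in> carrier X \<Longrightarrow> \<kappa>' r x y = \<kappa> r x y"
  shows "ext_cocycle R Y X s \<kappa>'"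
  using assms(2)
proof (rule ext_cocycleE)
  fix \<sigma>
  assume \<kappa>: "\<And>r x y. r \<in> carrier R \<Longrightarrow> x \<in> carrier X \<Longrightarrow> y \<in> carrier X \<Longrightarrow> \<kappa> r x y \<in> carrier Y"
    and p: "\<And>x. x \<in> carrier X \<Longrightarrow> ext_proj s (\<sigma> x) = x"
    and d: "lin_defect R X (ext_mid s) \<sigma> (\<lambda>r x y. ext_inj s (\<kappa> r x y))"
  show ?thesis
    by (rule ext_cocycleI[OF _ p lin_defect_cong[OF assms(1) d]]) (simp_all add: assms(3) \<kappa>)
qed

lemma ext_cocycle_exists:
  assumes "short_exact R Y X s"
  shows "\<exists>\<kappa>. ext_cocycle R Y X s \<kappa>"
proof -
  note s = short_exactD[OF assms]
  interpret X: left_module R X by (rule s)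
  interpret E: left_module R "ext_mid s" by (rule s)
  from s(7) obtain \<sigma> where \<sigma>: "\<And>x. x \<in> carrier X \<Longrightarrow> \<sigma> x \<in> carrier (ext_mid s)"
    "\<And>x. x \<in> carrier X \<Longrightarrow> ext_proj s (\<sigma> x) = x" by metis
  define \<delta> where "\<delta> r x y = (r \<odot>\<^bsub>ext_mid s\<^esub> \<sigma> x \<oplus>\<^bsub>ext_mid s\<^esub> \<sigma> y)
    \<ominus>\<^bsub>ext_mid s\<^esub> \<sigma> (r \<odot>\<^bsub>X\<^esub> x \<oplus>\<^bsub>X\<^esub> y)" for r x y
  have d: "lin_defect R X (ext_mid s) \<sigma> \<delta>"
    unfolding \<delta>_def by (rule lin_defect_exists[OF s(3,2) \<sigma>(1)])
  have ex: "\<exists>z\<in>carrier Y. \<delta> r x y = ext_inj s z"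
    if "r \<in> carrier R" "x \<in> carrier X" "y \<in> carrier X" for r x y
  proof (rule s(9))
    show "\<delta> r x y \<in> carrier (ext_mid s)" using lin_defectD(2)[OF d that] .
    show "ext_proj s (\<delta> r x y) = \<zero>\<^bsub>X\<^esub>" using that \<sigma>
      by (simp add: \<delta>_def a_minus_def lmod_hom_add[OF s(5)] lmod_hom_smult[OF s(5)]
          lmod_hom_minus[OF s(2,3,5)] X.M.r_neg)
  qed
  define \<kappa> where "\<kappa> r x y = inv_into (carrier Y) (ext_inj s) (\<delta> r x y)" for r x y
  have "\<kappa> r x y \<in> carrier Y" "ext_inj s (\<kappa> r x y) = \<delta> r x y"
    if "r \<in> carrier R" "x \<in> carrier X" "y \<in> carrier X" for r x y
    using ex[OF that] unfolding \<kappa>_def by (auto intro!: inv_into_into f_inv_into_f)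
  then have "ext_cocycle R Y X s \<kappa>"
    using \<sigma>(2) by (intro ext_cocycleI[of _ _ _ _ _ \<sigma>] lin_defect_cong[OF s(3) d]) auto
  then show ?thesis by (rule exI[of _ \<kappa>])
qed

lemma ext_equiv_cocycle:
  assumes "short_exact R Y X s" "ext_equiv R Y s t" "ext_cocycle R Y X s \<kappa>"
  shows "ext_cocycle R Y X t \<kappa>"
proof -
  note s = short_exactD[OF assms(1)]
  interpret X: left_module R X by (rule s)
  from assms(2) obtain \<phi> where \<phi>: "\<phi> \<in> lmod_hom R (ext_mid s) (ext_mid t)"
    "\<And>y. y \<in> carrier Y \<Longrightarrow> \<phi> (ext_inj s y) = ext_inj t y"
    "\<And>a. a \<in> carrier (ext_mid s) \<Longrightarrow> ext_proj t (\<phi> a) = ext_proj s a"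
    by (auto simp: ext_equiv_def lmod_iso_def)
  from assms(3) obtain \<sigma> where \<sigma>:
    "\<And>r x y. r \<in> carrier R \<Longrightarrow> x \<in> carrier X \<Longrightarrow> y \<in> carrier X \<Longrightarrow> \<kappa> r x y \<in> carrier Y"
    "\<And>x. x \<in> carrier X \<Longrightarrow> ext_proj s (\<sigma> x) = x"
    "lin_defect R X (ext_mid s) \<sigma> (\<lambda>r x y. ext_inj s (\<kappa> r x y))"
    by (rule ext_cocycleE) blast
  show ?thesis
  proof (rule ext_cocycleI)
    show "ext_proj t (\<phi> (\<sigma> x)) = x" if "x \<in> carrier X" for x
      using \<sigma>(2)[OF that] \<phi>(3) lin_defectD(1)[OF \<sigma>(3) that] by simp
    show "lin_defect R X (ext_mid t) (\<lambda>x. \<phi> (\<sigma> x)) (\<lambda>r x y. ext_inj t (\<kappa> r x y))"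
      by (rule lin_defect_cong[OF s(3) lin_defect_comp[OF s(3,2) \<sigma>(3) \<phi>(1)]])
        (simp_all add: \<phi>(2) \<sigma>(1))
  qed (rule \<sigma>(1))
qed

lemma cocycle_ext_equiv:
  assumes "short_exact R Y X s" "short_exact R Y X t" "ext_cocycle R Y X s \<kappa>" "ext_cocycle R Y X t \<kappa>"
  shows "ext_equiv R Y s t"
proof -
  let ?E = "ext_mid s" and ?F = "ext_mid t"
  note s = short_exactD[OF assms(1)] note t = short_exactD[OF assms(2)]
  interpret X: left_module R X by (rule s)
  interpret Y: left_module R Y by (rule s)
  interpret E: left_module R ?E by (rule s)
  interpret F: left_module R ?F by (rule t)
  from assms(3) obtain \<sigma> where \<kappa>:
    "\<And>r x y. r \<in> carrier R \<Longrightarrow> x \<in> carrier X \<Longrightarrow> y \<in> carrier X \<Longrightarrow> \<kappa> r x y \<in> carrier Y"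
    and ps: "\<And>x. x \<in> carrier X \<Longrightarrow> ext_proj s (\<sigma> x) = x"
    and ds: "lin_defect R X ?E \<sigma> (\<lambda>r x y. ext_inj s (\<kappa> r x y))"
    by (rule ext_cocycleE) blast
  from assms(4) obtain \<tau> where
    pt: "\<And>x. x \<in> carrier X \<Longrightarrow> ext_proj t (\<tau> x) = x"
    and dt: "lin_defect R X ?F \<tau> (\<lambda>r x y. ext_inj t (\<kappa> r x y))"
    by (rule ext_cocycleE) blast
  note ds = lin_defectD[OF ds] note dt = lin_defectD[OF dt]
  note cs = lmod_hom_closed[OF s(4)] note ct = lmod_hom_closed[OF t(4)]
  have "\<exists>y\<in>carrier Y. a = ext_inj s y \<oplus>\<^bsub>?E\<^esub> \<sigma> (ext_proj s a)" if a: "a \<in> carrier ?E" for a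
  proof -
    let ?b = "\<sigma> (ext_proj s a)"
    have pa: "ext_proj s a \<in> carrier X" by (rule lmod_hom_closed[OF s(5) a])
    have b: "?b \<in> carrier ?E" by (rule ds(1)[OF pa])
    have "ext_proj s (a \<ominus>\<^bsub>?E\<^esub> ?b) = \<zero>\<^bsub>X\<^esub>"
      using pa ps a b by (simp add: a_minus_def lmod_hom_add[OF s(5)] lmod_hom_minus[OF s(2,3,5)] X.M.r_neg)
    then obtain y where "y \<in> carrier Y" "a \<ominus>\<^bsub>?E\<^esub> ?b = ext_inj s y"
      using s(9)[of "a \<ominus>\<^bsub>?E\<^esub> ?b"] a b by auto
    moreover have "a = (a \<ominus>\<^bsub>?E\<^esub> ?b) \<oplus>\<^bsub>?E\<^esub> ?b"
      using a b by (simp add: a_minus_def E.M.a_assoc E.M.l_neg)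
    ultimately show ?thesis by metis
  qed
  then obtain c where c: "\<And>a. a \<in> carrier ?E \<Longrightarrow> c a \<in> carrier Y"
    "\<And>a. a \<in> carrier ?E \<Longrightarrow> a = ext_inj s (c a) \<oplus>\<^bsub>?E\<^esub> \<sigma> (ext_proj s a)" by metis
  have ps': "ext_proj s (ext_inj s y \<oplus>\<^bsub>?E\<^esub> \<sigma> x) = x" if "y \<in> carrier Y" "x \<in> carrier X" for x y
    using that cs ds(1) ps by (simp add: lmod_hom_add[OF s(5)] s(8))
  have pt': "ext_proj t (ext_inj t y \<oplus>\<^bsub>?F\<^esub> \<tau> x) = x" if "y \<in> carrier Y" "x \<in> carrier X" for x y
    using that ct dt(1) pt by (simp add: lmod_hom_add[OF t(5)] t(8))
  define \<phi> where "\<phi> a = ext_inj t (c a) \<oplus>\<^bsub>?F\<^esub> \<tau> (ext_proj s a)" for a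
  have \<phi>: "\<phi> (ext_inj s y \<oplus>\<^bsub>?E\<^esub> \<sigma> x) = ext_inj t y \<oplus>\<^bsub>?F\<^esub> \<tau> x" if "y \<in> carrier Y" "x \<in> carrier X" for x y
  proof -
    let ?a = "ext_inj s y \<oplus>\<^bsub>?E\<^esub> \<sigma> x"
    have a: "?a \<in> carrier ?E" using that cs ds(1) by simp
    have "ext_inj s y \<oplus>\<^bsub>?E\<^esub> \<sigma> x = ext_inj s (c ?a) \<oplus>\<^bsub>?E\<^esub> \<sigma> x"
      using c(2)[OF a] ps'[OF that] by simp
    then have "ext_inj s y = ext_inj s (c ?a)"
      using that cs ds(1) c(1)[OF a] by simp
    then have "c ?a = y" using inj_onD[OF s(6)] c(1)[OF a] that by metis
    then show ?thesis unfolding \<phi>_def using ps'[OF that] by simp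
  qed
  have rep: "\<exists>y\<in>carrier Y. \<exists>x\<in>carrier X. a = ext_inj s y \<oplus>\<^bsub>?E\<^esub> \<sigma> x" if "a \<in> carrier ?E" for a
    using c[OF that] lmod_hom_closed[OF s(5) that] by blast
  have cl: "\<phi> a \<in> carrier ?F" "ext_proj t (\<phi> a) = ext_proj s a" if "a \<in> carrier ?E" for a
    using rep[OF that] ct dt(1) ps' pt' by (auto simp: \<phi>)
  have hom: "\<phi> \<in> lmod_hom R ?E ?F"
    unfolding lmod_hom_iff[OF s(2) t(2)]
  proof (intro conjI ballI)
    fix r a b assume r: "r \<in> carrier R" and "a \<in> carrier ?E" "b \<in> carrier ?E"
    then obtain y x y' x' where yx: "y \<in> carrier Y" "x \<in> carrier X" "y' \<in> carrier Y" "x' \<in> carrier X"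
      and a: "a = ext_inj s y \<oplus>\<^bsub>?E\<^esub> \<sigma> x" and b: "b = ext_inj s y' \<oplus>\<^bsub>?E\<^esub> \<sigma> x'" using rep by metis
    let ?x = "r \<odot>\<^bsub>X\<^esub> x \<oplus>\<^bsub>X\<^esub> x'" and ?y = "r \<odot>\<^bsub>Y\<^esub> y \<oplus>\<^bsub>Y\<^esub> y' \<oplus>\<^bsub>Y\<^esub> \<kappa> r x x'"
    have "r \<odot>\<^bsub>?E\<^esub> a \<oplus>\<^bsub>?E\<^esub> b = ext_inj s (r \<odot>\<^bsub>Y\<^esub> y \<oplus>\<^bsub>Y\<^esub> y') \<oplus>\<^bsub>?E\<^esub> (r \<odot>\<^bsub>?E\<^esub> \<sigma> x \<oplus>\<^bsub>?E\<^esub> \<sigma> x')"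
      using r yx a b cs ds(1)
      by (simp add: E.smult_r_distr E.M.a_ac lmod_hom_add[OF s(4)] lmod_hom_smult[OF s(4)])
    also have "\<dots> = ext_inj s ?y \<oplus>\<^bsub>?E\<^esub> \<sigma> ?x"
      using r yx cs ds \<kappa> by (simp add: E.M.a_assoc lmod_hom_add[OF s(4)])
    finally have "\<phi> (r \<odot>\<^bsub>?E\<^esub> a \<oplus>\<^bsub>?E\<^esub> b) = ext_inj t ?y \<oplus>\<^bsub>?F\<^esub> \<tau> ?x"
      using r yx \<kappa> by (simp add: \<phi>)
    also have "\<dots> = ext_inj t (r \<odot>\<^bsub>Y\<^esub> y \<oplus>\<^bsub>Y\<^esub> y') \<oplus>\<^bsub>?F\<^esub> (r \<odot>\<^bsub>?F\<^esub> \<tau> x \<oplus>\<^bsub>?F\<^esub> \<tau> x')"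
      using r yx ct dt \<kappa> by (simp add: F.M.a_assoc lmod_hom_add[OF t(4)])
    also have "\<dots> = r \<odot>\<^bsub>?F\<^esub> \<phi> a \<oplus>\<^bsub>?F\<^esub> \<phi> b"
      using r yx a b ct dt(1)
      by (simp add: \<phi> F.smult_r_distr F.M.a_ac lmod_hom_add[OF t(4)] lmod_hom_smult[OF t(4)])
    finally show "\<phi> (r \<odot>\<^bsub>?E\<^esub> a \<oplus>\<^bsub>?E\<^esub> b) = r \<odot>\<^bsub>?F\<^esub> \<phi> a \<oplus>\<^bsub>?F\<^esub> \<phi> b" .
  qed (use cl in auto)
  have "inj_on \<phi> (carrier ?E)"
  proof (rule inj_onI)
    fix a b assume ab: "a \<in> carrier ?E" "b \<in> carrier ?E" "\<phi> a = \<phi> b"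
    then obtain y x y' x' where yx: "y \<in> carrier Y" "x \<in> carrier X" "y' \<in> carrier Y" "x' \<in> carrier X"
      and a: "a = ext_inj s y \<oplus>\<^bsub>?E\<^esub> \<sigma> x" and b: "b = ext_inj s y' \<oplus>\<^bsub>?E\<^esub> \<sigma> x'" using rep by metis
    have e: "ext_inj t y \<oplus>\<^bsub>?F\<^esub> \<tau> x = ext_inj t y' \<oplus>\<^bsub>?F\<^esub> \<tau> x'" using ab(3) a b yx by (simp add: \<phi>)
    have x: "x = x'" using pt'[OF yx(1,2)] pt'[OF yx(3,4)] e by simp
    have "ext_inj t y = ext_inj t y'" using e yx ct dt(1) unfolding x by simp
    then have "y = y'" using inj_onD[OF t(6)] yx by metis
    with x a b show "a = b" by simp
  qed
  moreover have "b \<in> \<phi> ` carrier ?E" if b: "b \<in> carrier ?F" for b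
  proof -
    define x where "x = ext_proj t b"
    have x: "x \<in> carrier X" unfolding x_def by (rule lmod_hom_closed[OF t(5) b])
    have "ext_proj t (b \<ominus>\<^bsub>?F\<^esub> \<tau> x) = \<zero>\<^bsub>X\<^esub>"
      using x pt[OF x] b dt(1)[OF x]
      by (simp add: a_minus_def lmod_hom_add[OF t(5)] lmod_hom_minus[OF t(2,3,5)] X.M.r_neg x_def[symmetric])
    then obtain y where y: "y \<in> carrier Y" "b \<ominus>\<^bsub>?F\<^esub> \<tau> x = ext_inj t y"
      using t(9)[of "b \<ominus>\<^bsub>?F\<^esub> \<tau> x"] b dt(1)[OF x] by auto
    have "b = (b \<ominus>\<^bsub>?F\<^esub> \<tau> x) \<oplus>\<^bsub>?F\<^esub> \<tau> x"
      using b dt(1)[OF x] by (simp add: a_minus_def F.M.a_assoc F.M.l_neg)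
    then have "b = \<phi> (ext_inj s y \<oplus>\<^bsub>?E\<^esub> \<sigma> x)" using y x by (simp add: \<phi>)
    then show ?thesis using y x cs ds(1) by auto
  qed
  ultimately have "bij_betw \<phi> (carrier ?E) (carrier ?F)"
    using cl by (auto simp: bij_betw_def)
  moreover have "\<phi> (ext_inj s y) = ext_inj t y" if y: "y \<in> carrier Y" for y
  proof -
    let ?k = "\<kappa> \<one>\<^bsub>R\<^esub> \<zero>\<^bsub>X\<^esub> \<zero>\<^bsub>X\<^esub>"
    have k: "?k \<in> carrier Y" by (simp add: \<kappa>)
    have "\<sigma> \<zero>\<^bsub>X\<^esub> = ext_inj s ?k"
      using ds(3)[of "\<one>\<^bsub>R\<^esub>" "\<zero>\<^bsub>X\<^esub>" "\<zero>\<^bsub>X\<^esub>"] ds(1) cs k by simp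
    then have "ext_inj s y = ext_inj s (y \<ominus>\<^bsub>Y\<^esub> ?k) \<oplus>\<^bsub>?E\<^esub> \<sigma> \<zero>\<^bsub>X\<^esub>"
      using y k by (simp add: lmod_hom_add[OF s(4), symmetric] a_minus_def Y.M.a_assoc Y.M.l_neg)
    then have "\<phi> (ext_inj s y) = ext_inj t (y \<ominus>\<^bsub>Y\<^esub> ?k) \<oplus>\<^bsub>?F\<^esub> \<tau> \<zero>\<^bsub>X\<^esub>"
      using y k by (simp add: \<phi>)
    moreover have "\<tau> \<zero>\<^bsub>X\<^esub> = ext_inj t ?k"
      using dt(3)[of "\<one>\<^bsub>R\<^esub>" "\<zero>\<^bsub>X\<^esub>" "\<zero>\<^bsub>X\<^esub>"] dt(1) ct k by simp
    ultimately show ?thesis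
      using y k by (simp add: lmod_hom_add[OF t(4), symmetric] a_minus_def Y.M.a_assoc Y.M.l_neg)
  qed
  ultimately show ?thesis using hom cl(2) by (auto simp: ext_equiv_def lmod_iso_def)
qed

section \<open>Split extensions, pull-backs, push-outs and Baer sums\<close>

lemma lmod_prod_simps [simp]:
  "carrier (lmod_prod M N) = carrier M \<times> carrier N"
  "\<zero>\<^bsub>lmod_prod M N\<^esub> = (\<zero>\<^bsub>M\<^esub>, \<zero>\<^bsub>N\<^esub>)"
  "u \<oplus>\<^bsub>lmod_prod M N\<^esub> v = (fst u \<oplus>\<^bsub>M\<^esub> fst v, snd u \<oplus>\<^bsub>N\<^esub> snd v)"
  "a \<odot>\<^bsub>lmod_prod M N\<^esub> u = (a \<odot>\<^bsub>M\<^esub> fst u, a \<odot>\<^bsub>N\<^esub> snd u)"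
  by (simp_all add: lmod_prod_def case_prod_beta)

lemma short_exact_split:
  assumes "left_module R Y" "left_module R X"
  shows "short_exact R Y X (split_seq Y X)"
proof -
  interpret X: left_module R X by fact
  interpret Y: left_module R Y by fact
  show ?thesis
    using left_module_prod[OF assms] assms
    by (intro short_exactI) (auto simp: split_seq_def lmod_hom_def inj_on_def)
qed

text \<open>Coboundaries are cocycles of the zero class: use the section \<open>x \<mapsto> (n x, x)\<close>.\<close>

lemma ext_cocycle_split:
  assumes "left_module R Y" "left_module R X" "lin_defect R X Y n \<kappa>"
  shows "ext_cocycle R Y X (split_seq Y X) \<kappa>"
proof -
  interpret X: left_module R X by fact
  interpret Y: left_module R Y by fact
  note n = lin_defectD[OF assms(3)]
  show ?thesis
    by (rule ext_cocycleI[where \<sigma> = "\<lambda>x. (n x, x)"]) (auto simp: n split_seq_def intro!: lin_defectI)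
qed

text \<open>Transport of structure along the bijection \<open>i y + \<sigma> x \<mapsto> (y, x)\<close>.\<close>

lemma ext_equiv_standard:
  fixes s :: "('r, 'y, 'e, 'x) short_seq"
  assumes "short_exact R Y X s"
  shows "\<exists>t :: ('r, 'y, 'y \<times> 'x, 'x) short_seq. short_exact R Y X t \<and> ext_equiv R Y s t"
proof -
  let ?E = "ext_mid s"
  note s = short_exactD[OF assms]
  interpret X: left_module R X by (rule s)
  interpret E: left_module R ?E by (rule s)
  from s(7) obtain \<sigma> where \<sigma>: "\<And>x. x \<in> carrier X \<Longrightarrow> \<sigma> x \<in> carrier ?E"
    "\<And>x. x \<in> carrier X \<Longrightarrow> ext_proj s (\<sigma> x) = x" by metis
  note cl = lmod_hom_closed[OF s(5)]
  have "\<exists>y\<in>carrier Y. a \<ominus>\<^bsub>?E\<^esub> \<sigma> (ext_proj s a) = ext_inj s y" if a: "a \<in> carrier ?E" for a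
    using a \<sigma> cl[OF a] by (intro s(9)) (simp_all add: a_minus_def lmod_hom_add[OF s(5)]
        lmod_hom_minus[OF s(2,3,5)] X.M.r_neg)
  then obtain c where c: "\<And>a. a \<in> carrier ?E \<Longrightarrow> a \<ominus>\<^bsub>?E\<^esub> \<sigma> (ext_proj s a) = ext_inj s (c a)" by metis
  define \<psi> where "\<psi> a = (c a, ext_proj s a)" for a
  have inj: "inj_on \<psi> (carrier ?E)"
  proof (rule inj_onI)
    fix a b assume h: "a \<in> carrier ?E" "b \<in> carrier ?E" "\<psi> a = \<psi> b"
    then have eq: "ext_proj s a = ext_proj s b" "c a = c b" by (simp_all add: \<psi>_def)
    then have "a \<ominus>\<^bsub>?E\<^esub> \<sigma> (ext_proj s a) = b \<ominus>\<^bsub>?E\<^esub> \<sigma> (ext_proj s b)"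
      using c[OF h(1)] c[OF h(2)] by simp
    with eq show "a = b" using h(1,2) \<sigma>(1) cl by (simp add: a_minus_def)
  qed
  define \<chi> where "\<chi> = inv_into (carrier ?E) \<psi>"
  have \<chi>: "\<chi> (\<psi> a) = a" if "a \<in> carrier ?E" for a
    unfolding \<chi>_def using inv_into_f_f[OF inj that] .
  define T :: "('r, 'y \<times> 'x) module" where "T = \<lparr>carrier = \<psi> ` carrier ?E, mult = undefined, one = undefined, zero = \<psi> \<zero>\<^bsub>?E\<^esub>,
    add = (\<lambda>u v. \<psi> (\<chi> u \<oplus>\<^bsub>?E\<^esub> \<chi> v)), smult = (\<lambda>a u. \<psi> (a \<odot>\<^bsub>?E\<^esub> \<chi> u))\<rparr>"
  define t where "t = \<lparr>ext_inj = (\<lambda>y. \<psi> (ext_inj s y)), ext_mid = T, ext_proj = (\<lambda>u. ext_proj s (\<chi> u))\<rparr>"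
  have \<psi>: "\<psi> \<in> lmod_hom R ?E T" by (auto simp: lmod_hom_def T_def \<chi>)
  have T: "left_module R T" by (rule left_module_surj[OF s(2) \<psi>]) (simp_all add: T_def)
  have "short_exact R Y X t"
  proof (rule short_exactI)
    show "ext_inj t \<in> lmod_hom R Y (ext_mid t)"
      using lmod_hom_comp[OF s(4) \<psi>] by (simp add: t_def)
    show "ext_proj t \<in> lmod_hom R (ext_mid t) X"
      using s(5) by (auto simp: t_def T_def lmod_hom_def \<chi>)
    show "inj_on (ext_inj t) (carrier Y)"
      using comp_inj_on[OF s(6), of \<psi>] inj_on_subset[OF inj] lmod_hom_closed[OF s(4)]
      by (auto simp: t_def comp_def image_subset_iff)
    show "\<exists>a\<in>carrier (ext_mid t). ext_proj t a = x" if "x \<in> carrier X" for x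
      using s(7)[OF that] by (auto simp: t_def T_def \<chi>)
    show "ext_proj t (ext_inj t y) = \<zero>\<^bsub>X\<^esub>" if "y \<in> carrier Y" for y
      using s(8)[OF that] lmod_hom_closed[OF s(4) that] by (simp add: t_def \<chi>)
    show "\<exists>y\<in>carrier Y. a = ext_inj t y" if "a \<in> carrier (ext_mid t)" "ext_proj t a = \<zero>\<^bsub>X\<^esub>" for a
    proof -
      from that obtain e where e: "e \<in> carrier ?E" "a = \<psi> e" by (auto simp: t_def T_def)
      with that(2) have "ext_proj s e = \<zero>\<^bsub>X\<^esub>" by (simp add: t_def \<chi>)
      from s(9)[OF e(1) this] e(2) show ?thesis by (auto simp: t_def)
    qed
  qed (use s T in \<open>simp_all add: t_def\<close>)
  moreover have "ext_equiv R Y s t"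
    unfolding ext_equiv_def lmod_iso_def using \<psi> inj
    by (intro bexI[of _ \<psi>]) (auto simp: t_def T_def \<chi> bij_betw_def)
  ultimately show ?thesis by blast
qed

lemma short_exact_prod:
  assumes "short_exact R Y X s" "short_exact R Y' X' t"
  shows "short_exact R (lmod_prod Y Y') (lmod_prod X X')
    \<lparr>ext_inj = map_prod (ext_inj s) (ext_inj t), ext_mid = lmod_prod (ext_mid s) (ext_mid t),
     ext_proj = map_prod (ext_proj s) (ext_proj t)\<rparr>" (is "short_exact R _ _ ?p")
proof -
  note s = short_exactD[OF assms(1)] note t = short_exactD[OF assms(2)]
  show ?thesis
  proof (rule short_exactI)
    show "inj_on (ext_inj ?p) (carrier (lmod_prod Y Y'))"
      using map_prod_inj_on[OF s(6) t(6)] by simp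
    show "\<exists>a\<in>carrier (ext_mid ?p). ext_proj ?p a = x" if "x \<in> carrier (lmod_prod X X')" for x
      using that s(7)[of "fst x"] t(7)[of "snd x"] by (cases x) force
    show "\<exists>y\<in>carrier (lmod_prod Y Y'). a = ext_inj ?p y"
      if "a \<in> carrier (ext_mid ?p)" "ext_proj ?p a = \<zero>\<^bsub>lmod_prod X X'\<^esub>" for a
      using that s(9)[of "fst a"] t(9)[of "snd a"] by (cases a) force
  qed (use s(1-5,8) t(1-5,8) left_module_prod in \<open>auto simp: lmod_hom_def\<close>)
qed

lemma short_exact_prod_seq:
  assumes "short_exact R Y X s" "short_exact R Y X t"
  shows "short_exact R (lmod_prod Y Y) (lmod_prod X X) (prod_seq s t)"
  unfolding prod_seq_def by (rule short_exact_prod[OF assms])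

lemma ext_cocycle_prod_seq:
  assumes "ext_cocycle R Y X s \<kappa>" "ext_cocycle R Y X t \<rho>"
  shows "ext_cocycle R (lmod_prod Y Y) (lmod_prod X X) (prod_seq s t)
    (\<lambda>r x y. (\<kappa> r (fst x) (fst y), \<rho> r (snd x) (snd y)))"
proof -
  from assms(1) obtain \<sigma> where \<sigma>: "\<And>x. x \<in> carrier X \<Longrightarrow> ext_proj s (\<sigma> x) = x"
    "lin_defect R X (ext_mid s) \<sigma> (\<lambda>r x y. ext_inj s (\<kappa> r x y))" by (rule ext_cocycleE) blast
  from assms(2) obtain \<tau> where \<tau>: "\<And>x. x \<in> carrier X \<Longrightarrow> ext_proj t (\<tau> x) = x"
    "lin_defect R X (ext_mid t) \<tau> (\<lambda>r x y. ext_inj t (\<rho> r x y))" by (rule ext_cocycleE) blast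
  show ?thesis
  proof (rule ext_cocycleI[where \<sigma> = "map_prod \<sigma> \<tau>"])
    show "lin_defect R (lmod_prod X X) (ext_mid (prod_seq s t)) (map_prod \<sigma> \<tau>)
      (\<lambda>r x y. ext_inj (prod_seq s t) (\<kappa> r (fst x) (fst y), \<rho> r (snd x) (snd y)))"
      using lin_defectD[OF \<sigma>(2)] lin_defectD[OF \<tau>(2)]
      by (intro lin_defectI) (auto simp: prod_seq_def)
  qed (use ext_cocycle_closed[OF assms(1)] ext_cocycle_closed[OF assms(2)] \<sigma>(1) \<tau>(1)
      in \<open>auto simp: prod_seq_def\<close>)
qed

lemma short_exact_pullback:
  assumes "short_exact R Y X s" "left_module R X'" "h \<in> lmod_hom R X' X"
  shows "short_exact R Y X' (pullback_seq X' h s)"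
proof -
  note s = short_exactD[OF assms(1)]
  interpret X: left_module R X by (rule s)
  interpret X': left_module R X' by fact
  interpret E: left_module R "ext_mid s" by (rule s)
  let ?P = "lmod_prod (ext_mid s) X'"
  let ?C = "{(a, x). a \<in> carrier (ext_mid s) \<and> x \<in> carrier X' \<and> ext_proj s a = h x}"
  note P = left_module_prod[OF s(2) assms(2)]
  note z = lmod_hom_zero[OF assms(2) s(3) assms(3)] lmod_hom_zero[OF s(2,3,5)]
  have "submodule ?C R ?P"
    by (rule left_module.submoduleI[OF P])
      (auto simp: z lmod_hom_add[OF assms(3)] lmod_hom_add[OF s(5)]
        lmod_hom_smult[OF assms(3)] lmod_hom_smult[OF s(5)])
  from left_module_submodule[OF P this]
  have mid: "left_module R (ext_mid (pullback_seq X' h s))" by (simp add: pullback_seq_def Let_def)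
  note i = lmod_hom_closed[OF s(4)] lmod_hom_add[OF s(4)] lmod_hom_smult[OF s(4)]
  show ?thesis
  proof (rule short_exactI)
    show "\<exists>a\<in>carrier (ext_mid (pullback_seq X' h s)). ext_proj (pullback_seq X' h s) a = x"
      if "x \<in> carrier X'" for x
      using s(7)[OF lmod_hom_closed[OF assms(3) that]] that
      by (force simp: pullback_seq_def Let_def)
    show "\<exists>y\<in>carrier Y. a = ext_inj (pullback_seq X' h s) y"
      if "a \<in> carrier (ext_mid (pullback_seq X' h s))" "ext_proj (pullback_seq X' h s) a = \<zero>\<^bsub>X'\<^esub>" for a
      using that s(9)[of "fst a"] z by (cases a) (force simp: pullback_seq_def Let_def)
    show "ext_inj (pullback_seq X' h s) \<in> lmod_hom R Y (ext_mid (pullback_seq X' h s))"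
      using i s(8) z by (auto simp: pullback_seq_def Let_def lmod_hom_def)
    show "inj_on (ext_inj (pullback_seq X' h s)) (carrier Y)"
      using s(6) by (auto simp: pullback_seq_def Let_def inj_on_def)
  qed (use s(1) assms(2) mid in \<open>auto simp: pullback_seq_def Let_def lmod_hom_def\<close>)
qed

lemma ext_cocycle_pullback:
  assumes "short_exact R Y X s" "left_module R X'" "h \<in> lmod_hom R X' X" "ext_cocycle R Y X s \<kappa>"
  shows "ext_cocycle R Y X' (pullback_seq X' h s) (\<lambda>r x y. \<kappa> r (h x) (h y))"
proof -
  note s = short_exactD[OF assms(1)] note h = lmod_hom_closed[OF assms(3)]
  interpret X': left_module R X' by fact
  from assms(4) obtain \<sigma> where \<sigma>: "\<And>x. x \<in> carrier X \<Longrightarrow> ext_proj s (\<sigma> x) = x"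
    "lin_defect R X (ext_mid s) \<sigma> (\<lambda>r x y. ext_inj s (\<kappa> r x y))" by (rule ext_cocycleE) blast
  note d = lin_defectD[OF lin_defect_precomp[OF assms(2,3) \<sigma>(2)]]
  note \<kappa> = ext_cocycle_closed[OF assms(4)]
  show ?thesis
  proof (rule ext_cocycleI[where \<sigma> = "\<lambda>x. (\<sigma> (h x), x)"])
    show "lin_defect R X' (ext_mid (pullback_seq X' h s)) (\<lambda>x. (\<sigma> (h x), x))
      (\<lambda>r x y. ext_inj (pullback_seq X' h s) (\<kappa> r (h x) (h y)))"
      using d \<kappa> h \<sigma>(1) s(8) lmod_hom_closed[OF s(4)] lmod_hom_zero[OF assms(2) s(3) assms(3)]
      by (intro lin_defectI) (auto simp: pullback_seq_def Let_def)
  qed (use \<kappa> h in \<open>auto simp: pullback_seq_def Let_def\<close>)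
qed

lemma pushout_seq_projection:
  assumes Y: "left_module R Y" and Y': "left_module R Y'" and E: "left_module R (ext_mid s)"
    and g: "g \<in> lmod_hom R Y Y'" and i: "ext_inj s \<in> lmod_hom R Y (ext_mid s)"
    and p: "ext_proj s \<in> lmod_hom R (ext_mid s) X" and X: "left_module R X"
    and pi: "\<And>y. y \<in> carrier Y \<Longrightarrow> ext_proj s (ext_inj s y) = \<zero>\<^bsub>X\<^esub>"
  obtains q where
    "left_module R (ext_mid (pushout_seq Y Y' g s))"
    "q \<in> lmod_hom R (lmod_prod Y' (ext_mid s)) (ext_mid (pushout_seq Y Y' g s))"
    "q ` (carrier Y' \<times> carrier (ext_mid s)) = carrier (ext_mid (pushout_seq Y Y' g s))"
    "\<And>z a z' a'. z \<in> carrier Y' \<Longrightarrow> z' \<in> carrier Y' \<Longrightarrow> a \<in> carrier (ext_mid s) \<Longrightarrow>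
      a' \<in> carrier (ext_mid s) \<Longrightarrow> q (z, a) = q (z', a') \<longleftrightarrow>
      (\<exists>y\<in>carrier Y. z = g y \<oplus>\<^bsub>Y'\<^esub> z' \<and> a' = ext_inj s y \<oplus>\<^bsub>ext_mid s\<^esub> a)"
    "\<And>z. ext_inj (pushout_seq Y Y' g s) z = q (z, \<zero>\<^bsub>ext_mid s\<^esub>)"
    "\<And>z a. z \<in> carrier Y' \<Longrightarrow> a \<in> carrier (ext_mid s) \<Longrightarrow>
      ext_proj (pushout_seq Y Y' g s) (q (z, a)) = ext_proj s a"
proof -
  interpret Y: left_module R Y by fact
  interpret Y': left_module R Y' by fact
  interpret E: left_module R "ext_mid s" by fact
  interpret X: left_module R X by fact
  define P where "P = lmod_prod Y' (ext_mid s)"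
  define W where "W = (\<lambda>y. (g y, \<ominus>\<^bsub>ext_mid s\<^esub> ext_inj s y)) ` carrier Y"
  define q where "q = (\<lambda>u. W +>\<^bsub>P\<^esub> u)"
  have P: "left_module R P" unfolding P_def by (rule left_module_prod[OF Y' E])
  note icl = lmod_hom_closed[OF i]
  note gcl = lmod_hom_closed[OF g]
  have W: "submodule W R P"
  proof (rule left_module.submoduleI[OF P])
    show "W \<subseteq> carrier P" using icl gcl by (auto simp: W_def P_def)
    show "\<zero>\<^bsub>P\<^esub> \<in> W" using lmod_hom_zero[OF Y Y' g] lmod_hom_zero[OF Y E i]
      by (auto simp: W_def P_def intro!: image_eqI[of _ _ "\<zero>\<^bsub>Y\<^esub>"])
    show "r \<odot>\<^bsub>P\<^esub> u \<oplus>\<^bsub>P\<^esub> v \<in> W" if r: "r \<in> carrier R" and "u \<in> W" "v \<in> W" for r u v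
    proof -
      from that obtain y y' where y: "y \<in> carrier Y" "y' \<in> carrier Y"
        "u = (g y, \<ominus>\<^bsub>ext_mid s\<^esub> ext_inj s y)" "v = (g y', \<ominus>\<^bsub>ext_mid s\<^esub> ext_inj s y')"
        by (auto simp: W_def)
      then show ?thesis using r icl
        by (auto simp: W_def P_def lmod_hom_add[OF i] lmod_hom_smult[OF i] lmod_hom_add[OF g]
            lmod_hom_smult[OF g] E.smult_r_minus E.M.minus_add intro!: image_eqI[of _ _ "r \<odot>\<^bsub>Y\<^esub> y \<oplus>\<^bsub>Y\<^esub> y'"])
    qed
  qed
  have mid: "ext_mid (pushout_seq Y Y' g s) = lmod_quotient P W"
    by (simp add: pushout_seq_def Let_def P_def W_def)
  note Q = lmod_quotient_hom[OF P W, folded q_def mid]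
  have eqE: "a = \<ominus>\<^bsub>ext_mid s\<^esub> b \<oplus>\<^bsub>ext_mid s\<^esub> a' \<longleftrightarrow> a' = b \<oplus>\<^bsub>ext_mid s\<^esub> a"
    if "a \<in> carrier (ext_mid s)" "b \<in> carrier (ext_mid s)" "a' \<in> carrier (ext_mid s)" for a b a'
    using that by (metis E.M.a_inv_closed E.M.r_neg1 E.M.r_neg2)
  have eq: "q (z, a) = q (z', a') \<longleftrightarrow>
      (\<exists>y\<in>carrier Y. z = g y \<oplus>\<^bsub>Y'\<^esub> z' \<and> a' = ext_inj s y \<oplus>\<^bsub>ext_mid s\<^esub> a)"
    if "z \<in> carrier Y'" "z' \<in> carrier Y'" "a \<in> carrier (ext_mid s)" "a' \<in> carrier (ext_mid s)" for z a z' a'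
  proof -
    have "q (z, a) = q (z', a') \<longleftrightarrow>
        (\<exists>y\<in>carrier Y. z = g y \<oplus>\<^bsub>Y'\<^esub> z' \<and> a = \<ominus>\<^bsub>ext_mid s\<^esub> ext_inj s y \<oplus>\<^bsub>ext_mid s\<^esub> a')"
      using Q(4)[of "(z, a)" "(z', a')"] that by (auto simp: P_def W_def)
    then show ?thesis using eqE that icl by (auto cong: bex_cong)
  qed
  have inj: "ext_inj (pushout_seq Y Y' g s) z = q (z, \<zero>\<^bsub>ext_mid s\<^esub>)" for z
    by (simp add: pushout_seq_def Let_def q_def P_def W_def)
  have proj: "ext_proj (pushout_seq Y Y' g s) (q (z, a)) = ext_proj s a"
    if za: "z \<in> carrier Y'" "a \<in> carrier (ext_mid s)" for z a
  proof -
    have "(\<lambda>(z, a). ext_proj s a) ` q (z, a) = {ext_proj s a}"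
    proof -
      have "ext_proj s (\<ominus>\<^bsub>ext_mid s\<^esub> ext_inj s y \<oplus>\<^bsub>ext_mid s\<^esub> a) = ext_proj s a" if "y \<in> carrier Y" for y
        using that za icl pi lmod_hom_closed[OF p]
        by (simp add: lmod_hom_add[OF p] lmod_hom_minus[OF E X p])
      then have "(\<lambda>(z, a). ext_proj s a) ` q (z, a) \<subseteq> {ext_proj s a}"
        by (auto simp: q_def a_r_coset_def' W_def P_def)
      moreover have "(g \<zero>\<^bsub>Y\<^esub>, \<ominus>\<^bsub>ext_mid s\<^esub> ext_inj s \<zero>\<^bsub>Y\<^esub>) \<oplus>\<^bsub>P\<^esub> (z, a) \<in> q (z, a)"
        by (auto simp: q_def a_r_coset_def' W_def simp del: lmod_prod_simps)
      ultimately show ?thesis by (metis (no_types, lifting) empty_iff image_is_empty subset_singletonD)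
    qed
    then have "the_elem ((\<lambda>(z, a). ext_proj s a) ` q (z, a)) = ext_proj s a" by simp
    then show ?thesis by (simp add: pushout_seq_def Let_def q_def P_def W_def)
  qed
  show thesis
    by (rule that[of q, OF _ _ _ eq inj proj]) (use Q(1-3) in \<open>simp_all add: P_def\<close>)
qed

lemma short_exact_pushout:
  assumes "short_exact R Y X s" "left_module R Y'" "g \<in> lmod_hom R Y Y'"
  shows "short_exact R Y' X (pushout_seq Y Y' g s)" (is "short_exact R _ _ ?t")
proof -
  note s = short_exactD[OF assms(1)]
  interpret Y: left_module R Y by (rule s)
  interpret Y': left_module R Y' by fact
  interpret E: left_module R "ext_mid s" by (rule s)
  interpret X: left_module R X by (rule s)
  obtain q where f:
    "left_module R (ext_mid ?t)"
    "q \<in> lmod_hom R (lmod_prod Y' (ext_mid s)) (ext_mid ?t)"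
    "q ` (carrier Y' \<times> carrier (ext_mid s)) = carrier (ext_mid ?t)"
    "\<And>z a z' a'. z \<in> carrier Y' \<Longrightarrow> z' \<in> carrier Y' \<Longrightarrow> a \<in> carrier (ext_mid s) \<Longrightarrow>
      a' \<in> carrier (ext_mid s) \<Longrightarrow> q (z, a) = q (z', a') \<longleftrightarrow>
      (\<exists>y\<in>carrier Y. z = g y \<oplus>\<^bsub>Y'\<^esub> z' \<and> a' = ext_inj s y \<oplus>\<^bsub>ext_mid s\<^esub> a)"
    "\<And>z. ext_inj ?t z = q (z, \<zero>\<^bsub>ext_mid s\<^esub>)"
    "\<And>z a. z \<in> carrier Y' \<Longrightarrow> a \<in> carrier (ext_mid s) \<Longrightarrow> ext_proj ?t (q (z, a)) = ext_proj s a"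
    by (rule pushout_seq_projection[OF s(1) assms(2) s(2) assms(3) s(4,5,3)]) (erule s(8), rule that)
  have rep: "\<exists>z\<in>carrier Y'. \<exists>a\<in>carrier (ext_mid s). u = q (z, a)" if "u \<in> carrier (ext_mid ?t)" for u
    using that f(3) by blast
  note qcl = lmod_hom_closed[OF f(2), simplified]
  have qlin: "r \<odot>\<^bsub>ext_mid ?t\<^esub> q (z, a) \<oplus>\<^bsub>ext_mid ?t\<^esub> q (z', a') =
      q (r \<odot>\<^bsub>Y'\<^esub> z \<oplus>\<^bsub>Y'\<^esub> z', r \<odot>\<^bsub>ext_mid s\<^esub> a \<oplus>\<^bsub>ext_mid s\<^esub> a')"
    if "r \<in> carrier R" "z \<in> carrier Y'" "z' \<in> carrier Y'" "a \<in> carrier (ext_mid s)" "a' \<in> carrier (ext_mid s)"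
    for r z a z' a'
    using lmod_hom_smult[OF f(2), of r "(z, a)"]
      lmod_hom_add[OF f(2), of "(r \<odot>\<^bsub>Y'\<^esub> z, r \<odot>\<^bsub>ext_mid s\<^esub> a)" "(z', a')"] that by simp
  show ?thesis
  proof (rule short_exactI)
    show "ext_inj ?t \<in> lmod_hom R Y' (ext_mid ?t)"
      unfolding lmod_hom_iff[OF assms(2) f(1)] using qcl by (auto simp: f(5) qlin)
    show "ext_proj ?t \<in> lmod_hom R (ext_mid ?t) X"
      unfolding lmod_hom_iff[OF f(1) s(3)]
    proof (intro conjI ballI)
      show "ext_proj ?t \<in> carrier (ext_mid ?t) \<rightarrow> carrier X"
        using rep lmod_hom_closed[OF s(5)] by (fastforce simp: f(6))
      fix r u v assume h: "r \<in> carrier R" "u \<in> carrier (ext_mid ?t)" "v \<in> carrier (ext_mid ?t)"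
      then obtain z a z' a' where "z \<in> carrier Y'" "z' \<in> carrier Y'" "a \<in> carrier (ext_mid s)"
        "a' \<in> carrier (ext_mid s)" "u = q (z, a)" "v = q (z', a')" using rep by metis
      then show "ext_proj ?t (r \<odot>\<^bsub>ext_mid ?t\<^esub> u \<oplus>\<^bsub>ext_mid ?t\<^esub> v) =
          r \<odot>\<^bsub>X\<^esub> ext_proj ?t u \<oplus>\<^bsub>X\<^esub> ext_proj ?t v"
        using h by (simp add: qlin f(6) lmod_hom_add[OF s(5)] lmod_hom_smult[OF s(5)])
    qed
    show "inj_on (ext_inj ?t) (carrier Y')"
    proof (rule inj_onI)
      fix z z' assume h: "z \<in> carrier Y'" "z' \<in> carrier Y'" "ext_inj ?t z = ext_inj ?t z'"
      then obtain y where y: "y \<in> carrier Y" "z = g y \<oplus>\<^bsub>Y'\<^esub> z'"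
        "\<zero>\<^bsub>ext_mid s\<^esub> = ext_inj s y \<oplus>\<^bsub>ext_mid s\<^esub> \<zero>\<^bsub>ext_mid s\<^esub>" by (auto simp: f(4,5))
      then have "ext_inj s y = ext_inj s \<zero>\<^bsub>Y\<^esub>"
        using lmod_hom_zero[OF s(1,2,4)] lmod_hom_closed[OF s(4)] by simp
      then have "y = \<zero>\<^bsub>Y\<^esub>" using inj_onD[OF s(6)] y by auto
      then show "z = z'" using y h lmod_hom_zero[OF s(1) assms(2,3)] by simp
    qed
    show "\<exists>a\<in>carrier (ext_mid ?t). ext_proj ?t a = x" if x: "x \<in> carrier X" for x
    proof -
      from s(7)[OF x] obtain a where a: "a \<in> carrier (ext_mid s)" "ext_proj s a = x" by blast
      then have "ext_proj ?t (q (\<zero>\<^bsub>Y'\<^esub>, a)) = x" by (simp add: f(6))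
      with a qcl show ?thesis by blast
    qed
    show "ext_proj ?t (ext_inj ?t z) = \<zero>\<^bsub>X\<^esub>" if "z \<in> carrier Y'" for z
      using that by (simp add: f(5,6) lmod_hom_zero[OF s(2,3,5)])
    show "\<exists>z\<in>carrier Y'. u = ext_inj ?t z" if u: "u \<in> carrier (ext_mid ?t)" "ext_proj ?t u = \<zero>\<^bsub>X\<^esub>" for u
    proof -
      from rep[OF u(1)] obtain z a where za: "z \<in> carrier Y'" "a \<in> carrier (ext_mid s)" "u = q (z, a)"
        by blast
      with u(2) have "ext_proj s a = \<zero>\<^bsub>X\<^esub>" by (simp add: f(6))
      then obtain y where y: "y \<in> carrier Y" "a = ext_inj s y" using s(9) za by blast
      have "q (g y \<oplus>\<^bsub>Y'\<^esub> z, \<zero>\<^bsub>ext_mid s\<^esub>) = q (z, a)"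
        using za y lmod_hom_closed[OF assms(3)] by (subst f(4)) auto
      then show ?thesis using za y lmod_hom_closed[OF assms(3)] by (auto simp: f(5))
    qed
  qed (use s assms f in simp_all)
qed

lemma ext_cocycle_pushout:
  assumes "short_exact R Y X s" "left_module R Y'" "g \<in> lmod_hom R Y Y'" "ext_cocycle R Y X s \<kappa>"
  shows "ext_cocycle R Y' X (pushout_seq Y Y' g s) (\<lambda>r x y. g (\<kappa> r x y))" (is "ext_cocycle R _ _ ?t _")
proof -
  note s = short_exactD[OF assms(1)]
  interpret Y': left_module R Y' by fact
  interpret E: left_module R "ext_mid s" by (rule s)
  interpret X: left_module R X by (rule s)
  obtain q where f:
    "q \<in> lmod_hom R (lmod_prod Y' (ext_mid s)) (ext_mid ?t)"
    "\<And>z a z' a'. z \<in> carrier Y' \<Longrightarrow> z' \<in> carrier Y' \<Longrightarrow> a \<in> carrier (ext_mid s) \<Longrightarrow>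
      a' \<in> carrier (ext_mid s) \<Longrightarrow> q (z, a) = q (z', a') \<longleftrightarrow>
      (\<exists>y\<in>carrier Y. z = g y \<oplus>\<^bsub>Y'\<^esub> z' \<and> a' = ext_inj s y \<oplus>\<^bsub>ext_mid s\<^esub> a)"
    "\<And>z. ext_inj ?t z = q (z, \<zero>\<^bsub>ext_mid s\<^esub>)"
    "\<And>z a. z \<in> carrier Y' \<Longrightarrow> a \<in> carrier (ext_mid s) \<Longrightarrow> ext_proj ?t (q (z, a)) = ext_proj s a"
    by (rule pushout_seq_projection[OF s(1) assms(2) s(2) assms(3) s(4,5,3)]) (erule s(8), rule that)
  note P = left_module_prod[OF assms(2) s(2)]
  from assms(4) obtain \<sigma> where \<sigma>: "\<And>x. x \<in> carrier X \<Longrightarrow> ext_proj s (\<sigma> x) = x"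
    "lin_defect R X (ext_mid s) \<sigma> (\<lambda>r x y. ext_inj s (\<kappa> r x y))" by (rule ext_cocycleE) blast
  note \<kappa> = ext_cocycle_closed[OF assms(4)] note gcl = lmod_hom_closed[OF assms(3)]
  have d: "lin_defect R X (lmod_prod Y' (ext_mid s)) (\<lambda>x. (\<zero>\<^bsub>Y'\<^esub>, \<sigma> x)) (\<lambda>r x y. (\<zero>\<^bsub>Y'\<^esub>, ext_inj s (\<kappa> r x y)))"
    using lin_defectD[OF \<sigma>(2)] by (intro lin_defectI) auto
  show ?thesis
  proof (rule ext_cocycleI)
    show "lin_defect R X (ext_mid ?t) (\<lambda>x. q (\<zero>\<^bsub>Y'\<^esub>, \<sigma> x)) (\<lambda>r x y. ext_inj ?t (g (\<kappa> r x y)))"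
    proof (rule lin_defect_cong[OF s(3) lin_defect_comp[OF s(3) P d f(1)]])
      fix r x y assume h: "r \<in> carrier R" "x \<in> carrier X" "y \<in> carrier X"
      show "ext_inj ?t (g (\<kappa> r x y)) = q (\<zero>\<^bsub>Y'\<^esub>, ext_inj s (\<kappa> r x y))"
        unfolding f(3) using \<kappa>[OF h] gcl lmod_hom_closed[OF s(4)]
        by (subst f(2)) (auto intro!: bexI[of _ "\<kappa> r x y"])
    qed simp
    show "ext_proj ?t (q (\<zero>\<^bsub>Y'\<^esub>, \<sigma> x)) = x" if "x \<in> carrier X" for x
      using that \<sigma>(1) lin_defectD(1)[OF \<sigma>(2)] by (simp add: f(4))
  qed (use \<kappa> gcl in auto)
qed

lemma
  assumes "left_module R Y" "left_module R X"
  shows codiagonal_hom: "(\<lambda>(y, y'). y \<oplus>\<^bsub>Y\<^esub> y') \<in> lmod_hom R (lmod_prod Y Y) Y"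
    and diagonal_hom: "(\<lambda>x. (x, x)) \<in> lmod_hom R X (lmod_prod X X)"
proof -
  interpret Y: left_module R Y by fact
  show "(\<lambda>(y, y'). y \<oplus>\<^bsub>Y\<^esub> y') \<in> lmod_hom R (lmod_prod Y Y) Y"
    by (auto simp: lmod_hom_def Y.smult_r_distr Y.M.a_ac)
  show "(\<lambda>x. (x, x)) \<in> lmod_hom R X (lmod_prod X X)"
    by (auto simp: lmod_hom_def)
qed

lemma short_exact_baer_sum:
  assumes "short_exact R Y X s" "short_exact R Y X t"
  shows "short_exact R Y X (baer_sum Y X s t)"
  unfolding baer_sum_def using short_exactD(1,3)[OF assms(1)]
  by (intro short_exact_pushout[OF short_exact_pullback[OF short_exact_prod_seq[OF assms]]]
      codiagonal_hom diagonal_hom)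

lemma ext_cocycle_baer_sum:
  assumes "short_exact R Y X s" "short_exact R Y X t" "ext_cocycle R Y X s \<kappa>" "ext_cocycle R Y X t \<rho>"
  shows "ext_cocycle R Y X (baer_sum Y X s t) (\<lambda>r x y. \<kappa> r x y \<oplus>\<^bsub>Y\<^esub> \<rho> r x y)"
proof -
  note s = short_exactD[OF assms(1)]
  note st = short_exact_prod_seq[OF assms(1,2)]
  note pb = ext_cocycle_pullback[OF st s(3) diagonal_hom[OF s(1,3)] ext_cocycle_prod_seq[OF assms(3,4)]]
  show ?thesis unfolding baer_sum_def
    using ext_cocycle_pushout[OF short_exact_pullback[OF st s(3) diagonal_hom[OF s(1,3)]] s(1)
      codiagonal_hom[OF s(1,3)] pb] by simp
qed

section \<open>The first extension group and direct sums\<close>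

definition cocycle_class ::
  "('r, 'q) ring_scheme \<Rightarrow> ('r, 'y) module \<Rightarrow> ('r, 'x) module \<Rightarrow> ('r \<Rightarrow> 'x \<Rightarrow> 'x \<Rightarrow> 'y) \<Rightarrow>
     ('r, 'y, 'y \<times> 'x, 'x) short_seq set" where
  "cocycle_class R Y X \<kappa> = {t. short_exact R Y X t \<and> ext_cocycle R Y X t \<kappa>}"

lemma ext_class_eq_cocycle_class:
  assumes "short_exact R Y X s" "ext_cocycle R Y X s \<kappa>"
  shows "ext_class R Y X s = cocycle_class R Y X \<kappa>" "cocycle_class R Y X \<kappa> \<noteq> {}"
proof -
  show eq: "ext_class R Y X s = cocycle_class R Y X \<kappa>"
    unfolding ext_class_def cocycle_class_def
    using ext_equiv_cocycle[OF assms(1) _ assms(2)] cocycle_ext_equiv[OF assms(1) _ assms(2)] by blast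
  show "cocycle_class R Y X \<kappa> \<noteq> {}"
    using ext_equiv_standard[OF assms(1)] unfolding eq[symmetric] ext_class_def by blast
qed

lemma cocycle_class_cong:
  assumes "left_module R X"
    and "\<And>r x y. r \<in> carrier R \<Longrightarrow> x \<in> carrier X \<Longrightarrow> y \<in> carrier X \<Longrightarrow> \<kappa> r x y = \<rho> r x y"
  shows "cocycle_class R Y X \<kappa> = cocycle_class R Y X \<rho>"
  using ext_cocycle_cong[OF assms(1), of Y _ \<kappa> \<rho>] ext_cocycle_cong[OF assms(1), of Y _ \<rho> \<kappa>] assms(2)
  unfolding cocycle_class_def by auto

lemma Ext1_carrier_iff:
  fixes X :: "('r, 'x) module" and Y :: "('r, 'y) module"
  shows "A \<in> carrier (Ext1 R X Y) \<longleftrightarrow> (\<exists>\<kappa>. A = cocycle_class R Y X \<kappa> \<and> A \<noteq> {})"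
proof
  assume "A \<in> carrier (Ext1 R X Y)"
  then obtain s :: "('r, 'y, 'y \<times> 'x, 'x) short_seq" where s: "short_exact R Y X s" "A = ext_class R Y X s"
    by (auto simp: Ext1_def)
  obtain \<kappa> where "ext_cocycle R Y X s \<kappa>" using ext_cocycle_exists[OF s(1)] by metis
  from ext_class_eq_cocycle_class[OF s(1) this] s(2)
  show "\<exists>\<kappa>. A = cocycle_class R Y X \<kappa> \<and> A \<noteq> {}" by (intro exI[of _ \<kappa>]) simp
next
  assume "\<exists>\<kappa>. A = cocycle_class R Y X \<kappa> \<and> A \<noteq> {}"
  then obtain \<kappa> t where k: "A = cocycle_class R Y X \<kappa>" "t \<in> A" by blast
  then have t: "short_exact R Y X t" "ext_cocycle R Y X t \<kappa>" by (auto simp: cocycle_class_def)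
  from ext_class_eq_cocycle_class(1)[OF this] k t(1) show "A \<in> carrier (Ext1 R X Y)"
    by (auto simp: Ext1_def)
qed

lemma Ext1_carrierE:
  assumes "A \<in> carrier (Ext1 R X Y)"
  obtains \<kappa> where "A = cocycle_class R Y X \<kappa>" "cocycle_class R Y X \<kappa> \<noteq> {}"
  using assms unfolding Ext1_carrier_iff by metis

lemma Ext1_carrierI: "cocycle_class R Y X \<kappa> \<noteq> {} \<Longrightarrow> cocycle_class R Y X \<kappa> \<in> carrier (Ext1 R X Y)"
  unfolding Ext1_carrier_iff by (intro exI[of _ \<kappa>] conjI refl)

lemma some_in_cocycle_class:
  assumes "cocycle_class R Y X \<kappa> \<noteq> {}"
  shows "short_exact R Y X (SOME t. t \<in> cocycle_class R Y X \<kappa>)"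
    "ext_cocycle R Y X (SOME t. t \<in> cocycle_class R Y X \<kappa>) \<kappa>"
  using someI_ex[of "\<lambda>t. t \<in> cocycle_class R Y X \<kappa>"] assms unfolding cocycle_class_def by auto

lemma Ext1_add_cocycle_class:
  assumes "cocycle_class R Y X \<kappa> \<noteq> {}" "cocycle_class R Y X \<rho> \<noteq> {}"
  shows "cocycle_class R Y X \<kappa> \<oplus>\<^bsub>Ext1 R X Y\<^esub> cocycle_class R Y X \<rho> =
      cocycle_class R Y X (\<lambda>r x y. \<kappa> r x y \<oplus>\<^bsub>Y\<^esub> \<rho> r x y)"
    and "cocycle_class R Y X (\<lambda>r x y. \<kappa> r x y \<oplus>\<^bsub>Y\<^esub> \<rho> r x y) \<noteq> {}"
proof -
  note s = some_in_cocycle_class[OF assms(1)] note t = some_in_cocycle_class[OF assms(2)]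
  note b = ext_class_eq_cocycle_class[OF short_exact_baer_sum[OF s(1) t(1)]
    ext_cocycle_baer_sum[OF s(1) t(1) s(2) t(2)]]
  from b(2) show "cocycle_class R Y X (\<lambda>r x y. \<kappa> r x y \<oplus>\<^bsub>Y\<^esub> \<rho> r x y) \<noteq> {}" .
  from b(1) show "cocycle_class R Y X \<kappa> \<oplus>\<^bsub>Ext1 R X Y\<^esub> cocycle_class R Y X \<rho> =
      cocycle_class R Y X (\<lambda>r x y. \<kappa> r x y \<oplus>\<^bsub>Y\<^esub> \<rho> r x y)"
    by (simp add: Ext1_def)
qed

lemma Ext1_smult_cocycle_class:
  assumes "cocycle_class R Y X \<kappa> \<noteq> {}" "left_module R X" "h \<in> lmod_hom R X X"
  shows "h \<odot>\<^bsub>Ext1 R X Y\<^esub> cocycle_class R Y X \<kappa> = cocycle_class R Y X (\<lambda>r x y. \<kappa> r (h x) (h y))"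
    and "cocycle_class R Y X (\<lambda>r x y. \<kappa> r (h x) (h y)) \<noteq> {}"
proof -
  note s = some_in_cocycle_class[OF assms(1)]
  note b = ext_class_eq_cocycle_class[OF short_exact_pullback[OF s(1) assms(2,3)]
    ext_cocycle_pullback[OF s(1) assms(2,3) s(2)]]
  from b(2) show "cocycle_class R Y X (\<lambda>r x y. \<kappa> r (h x) (h y)) \<noteq> {}" .
  from b(1) show "h \<odot>\<^bsub>Ext1 R X Y\<^esub> cocycle_class R Y X \<kappa> = cocycle_class R Y X (\<lambda>r x y. \<kappa> r (h x) (h y))"
    by (simp add: Ext1_def)
qed

lemma Ext1_zero_cocycle_class:
  assumes "left_module R Y" "left_module R X" "lin_defect R X Y n \<kappa>"
  shows "\<zero>\<^bsub>Ext1 R X Y\<^esub> = cocycle_class R Y X \<kappa>" "cocycle_class R Y X \<kappa> \<noteq> {}"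
  using ext_class_eq_cocycle_class[OF short_exact_split[OF assms(1,2)] ext_cocycle_split[OF assms]]
  by (simp_all add: Ext1_def)

lemma abelian_monoid_Ext1:
  assumes "left_module R Y" "left_module R X"
  shows "abelian_monoid (Ext1 R X Y)"
proof -
  interpret X: left_module R X by fact
  interpret Y: left_module R Y by fact
  let ?V = "Ext1 R X Y"
  have "lin_defect R X Y (\<lambda>x. \<zero>\<^bsub>Y\<^esub>) (\<lambda>r x y. \<zero>\<^bsub>Y\<^esub>)" by (rule lin_defectI) simp_all
  note z = Ext1_zero_cocycle_class[OF assms this]
  note add = Ext1_add_cocycle_class
  have cl: "\<kappa> r x y \<in> carrier Y" if "cocycle_class R Y X \<kappa> \<noteq> {}" "r \<in> carrier R" "x \<in> carrier X"
    "y \<in> carrier X" for \<kappa> r x y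
    by (rule ext_cocycle_closed[OF some_in_cocycle_class(2)[OF that(1)] that(2-4)])
  show ?thesis
  proof (rule abelian_monoidI)
    fix u v w assume h: "u \<in> carrier ?V" "v \<in> carrier ?V" "w \<in> carrier ?V"
    obtain \<kappa> where k: "u = cocycle_class R Y X \<kappa>" "cocycle_class R Y X \<kappa> \<noteq> {}"
      by (rule Ext1_carrierE[OF h(1)])
    obtain \<rho> where l: "v = cocycle_class R Y X \<rho>" "cocycle_class R Y X \<rho> \<noteq> {}"
      by (rule Ext1_carrierE[OF h(2)])
    obtain \<mu> where m: "w = cocycle_class R Y X \<mu>" "cocycle_class R Y X \<mu> \<noteq> {}"
      by (rule Ext1_carrierE[OF h(3)])
    show "u \<oplus>\<^bsub>?V\<^esub> v \<oplus>\<^bsub>?V\<^esub> w = u \<oplus>\<^bsub>?V\<^esub> (v \<oplus>\<^bsub>?V\<^esub> w)"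
      unfolding k(1) l(1) m(1) add(1)[OF k(2) l(2)] add(1)[OF l(2) m(2)]
        add(1)[OF add(2)[OF k(2) l(2)] m(2)] add(1)[OF k(2) add(2)[OF l(2) m(2)]]
      by (rule cocycle_class_cong[OF assms(2)]) (simp add: cl k(2) l(2) m(2) Y.M.a_assoc)
  next
    fix u v assume h: "u \<in> carrier ?V" "v \<in> carrier ?V"
    obtain \<kappa> where k: "u = cocycle_class R Y X \<kappa>" "cocycle_class R Y X \<kappa> \<noteq> {}"
      by (rule Ext1_carrierE[OF h(1)])
    obtain \<rho> where l: "v = cocycle_class R Y X \<rho>" "cocycle_class R Y X \<rho> \<noteq> {}"
      by (rule Ext1_carrierE[OF h(2)])
    show "u \<oplus>\<^bsub>?V\<^esub> v \<in> carrier ?V"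
      unfolding k(1) l(1) add(1)[OF k(2) l(2)] by (rule Ext1_carrierI[OF add(2)[OF k(2) l(2)]])
    show "u \<oplus>\<^bsub>?V\<^esub> v = v \<oplus>\<^bsub>?V\<^esub> u"
      unfolding k(1) l(1) add(1)[OF k(2) l(2)] add(1)[OF l(2) k(2)]
      by (rule cocycle_class_cong[OF assms(2)]) (simp add: cl k(2) l(2) Y.M.a_comm)
  next
    show "\<zero>\<^bsub>?V\<^esub> \<in> carrier ?V" unfolding z(1) by (rule Ext1_carrierI[OF z(2)])
  next
    fix u assume h: "u \<in> carrier ?V"
    obtain \<kappa> where k: "u = cocycle_class R Y X \<kappa>" "cocycle_class R Y X \<kappa> \<noteq> {}"
      by (rule Ext1_carrierE[OF h])
    show "\<zero>\<^bsub>?V\<^esub> \<oplus>\<^bsub>?V\<^esub> u = u"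
      unfolding k(1) z(1) add(1)[OF z(2) k(2)]
      by (rule cocycle_class_cong[OF assms(2)]) (simp add: cl k(2))
  qed
qed

lemma cocycle_difference:
  assumes "short_exact R Y X t" "ext_cocycle R Y X t \<kappa>" "ext_cocycle R Y X t \<rho>"
  shows "\<exists>n. lin_defect R X Y n (\<lambda>r x y. \<kappa> r x y \<ominus>\<^bsub>Y\<^esub> \<rho> r x y)"
proof -
  let ?E = "ext_mid t"
  note t = short_exactD[OF assms(1)]
  interpret X: left_module R X by (rule t)
  interpret Y: left_module R Y by (rule t)
  interpret E: left_module R ?E by (rule t)
  from assms(2) obtain \<sigma> where \<sigma>: "\<And>x. x \<in> carrier X \<Longrightarrow> ext_proj t (\<sigma> x) = x"
    "lin_defect R X ?E \<sigma> (\<lambda>r x y. ext_inj t (\<kappa> r x y))" by (rule ext_cocycleE) blast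
  from assms(3) obtain \<tau> where \<tau>: "\<And>x. x \<in> carrier X \<Longrightarrow> ext_proj t (\<tau> x) = x"
    "lin_defect R X ?E \<tau> (\<lambda>r x y. ext_inj t (\<rho> r x y))" by (rule ext_cocycleE) blast
  note cl = ext_cocycle_closed[OF assms(2)] ext_cocycle_closed[OF assms(3)]
  note d = lin_defect_minus[OF t(3,2) \<sigma>(2) \<tau>(2)]
  have "\<exists>y\<in>carrier Y. \<sigma> x \<ominus>\<^bsub>?E\<^esub> \<tau> x = ext_inj t y" if "x \<in> carrier X" for x
    using that \<sigma>(1) \<tau>(1) lin_defectD(1)[OF \<sigma>(2)] lin_defectD(1)[OF \<tau>(2)]
    by (intro t(9)) (simp_all add: a_minus_def lmod_hom_add[OF t(5)] lmod_hom_minus[OF t(2,3,5)] X.M.r_neg)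
  then obtain n where n: "\<And>x. x \<in> carrier X \<Longrightarrow> n x \<in> carrier Y"
    "\<And>x. x \<in> carrier X \<Longrightarrow> \<sigma> x \<ominus>\<^bsub>?E\<^esub> \<tau> x = ext_inj t (n x)" by metis
  have "lin_defect R X Y n (\<lambda>r x y. \<kappa> r x y \<ominus>\<^bsub>Y\<^esub> \<rho> r x y)"
  proof (rule lin_defect_reflect[OF t(3,1,4,6) n(1)])
    show "lin_defect R X ?E (\<lambda>x. ext_inj t (n x)) (\<lambda>r x y. ext_inj t (\<kappa> r x y \<ominus>\<^bsub>Y\<^esub> \<rho> r x y))"
    proof (rule lin_defect_cong[OF t(3) d])
      show "ext_inj t (n x) = \<sigma> x \<ominus>\<^bsub>?E\<^esub> \<tau> x" if "x \<in> carrier X" for x using n(2)[OF that] by simp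
    qed (simp add: cl a_minus_def lmod_hom_add[OF t(4)] lmod_hom_minus[OF t(1,2,4)])
  qed (use cl in auto)
  then show ?thesis by (rule exI[of _ n])
qed

lemma lmod_direct_sum_simps:
  "w \<in> carrier (lmod_direct_sum I M) \<longleftrightarrow> w \<in> extensional I \<and> (\<forall>i\<in>I. w i \<in> carrier (M i)) \<and>
    finite {i \<in> I. w i \<noteq> \<zero>\<^bsub>M i\<^esub>}"
  "\<zero>\<^bsub>lmod_direct_sum I M\<^esub> = (\<lambda>i\<in>I. \<zero>\<^bsub>M i\<^esub>)"
  "v \<oplus>\<^bsub>lmod_direct_sum I M\<^esub> w = (\<lambda>i\<in>I. v i \<oplus>\<^bsub>M i\<^esub> w i)"
  "a \<odot>\<^bsub>lmod_direct_sum I M\<^esub> w = (\<lambda>i\<in>I. a \<odot>\<^bsub>M i\<^esub> w i)"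
  by (auto simp: lmod_direct_sum_def PiE_def)

definition lmod_single :: "'i set \<Rightarrow> ('i \<Rightarrow> ('r, 'a) module) \<Rightarrow> 'i \<Rightarrow> 'a \<Rightarrow> 'i \<Rightarrow> 'a" where
  "lmod_single I M k x = (\<lambda>i\<in>I. if i = k then x else \<zero>\<^bsub>M i\<^esub>)"

lemma lmod_single_hom:
  assumes "\<And>i. i \<in> I \<Longrightarrow> left_module R (M i)" "k \<in> I"
  shows "lmod_single I M k \<in> lmod_hom R (M k) (lmod_direct_sum I M)"
proof -
  have ab: "abelian_monoid (M i)" if "i \<in> I" for i
    using assms(1)[OF that] by (simp add: left_module_def abelian_group_def)
  have "finite {i \<in> I. lmod_single I M k x i \<noteq> \<zero>\<^bsub>M i\<^esub>}" for x
    by (rule finite_subset[of _ "{k}"]) (auto simp: lmod_single_def)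
  then show ?thesis using assms(2)
    by (auto simp: lmod_hom_def lmod_direct_sum_simps lmod_single_def abelian_monoid.zero_closed[OF ab]
      abelian_monoid.l_zero[OF ab] left_module.smult_r_null[OF assms(1)])
qed

lemma lmod_component_hom:
  assumes "k \<in> I"
  shows "(\<lambda>w. w k) \<in> lmod_hom R (lmod_direct_sum I M) (M k)"
  using assms by (auto simp: lmod_hom_def lmod_direct_sum_simps)

lemma lmod_direct_sum_induct [consumes 2, case_names zero single add]:
  assumes "w \<in> carrier (lmod_direct_sum I M)" and modules: "\<forall>i\<in>I. left_module R (M i)"
    and zero: "P \<zero>\<^bsub>lmod_direct_sum I M\<^esub>"
    and single: "\<And>k x. k \<in> I \<Longrightarrow> x \<in> carrier (M k) \<Longrightarrow> P (lmod_single I M k x)"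
    and add: "\<And>v w. v \<in> carrier (lmod_direct_sum I M) \<Longrightarrow> w \<in> carrier (lmod_direct_sum I M) \<Longrightarrow>
      P v \<Longrightarrow> P w \<Longrightarrow> P (v \<oplus>\<^bsub>lmod_direct_sum I M\<^esub> w)"
  shows "P w"
proof -
  let ?S = "lmod_direct_sum I M"
  have ab: "abelian_monoid (M i)" if "i \<in> I" for i
    using modules that by (simp add: left_module_def abelian_group_def)
  have "P w" if "finite F" "w \<in> carrier ?S" "{i \<in> I. w i \<noteq> \<zero>\<^bsub>M i\<^esub>} \<subseteq> F" for F w
    using that
  proof (induction F arbitrary: w rule: finite_induct)
    case empty
    then have "w = \<zero>\<^bsub>?S\<^esub>" by (auto simp: lmod_direct_sum_simps fun_eq_iff extensional_def)
    with zero show ?case by simp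
  next
    case (insert k F)
    show ?case
    proof (cases "k \<in> I")
      case False
      with insert.prems(2) have "{i \<in> I. w i \<noteq> \<zero>\<^bsub>M i\<^esub>} \<subseteq> F" by auto
      then show ?thesis by (rule insert.IH[OF insert.prems(1)])
    next
      case True
      define v where "v = (\<lambda>i\<in>I. if i = k then \<zero>\<^bsub>M i\<^esub> else w i)"
      have wk: "w k \<in> carrier (M k)" using insert.prems(1) True by (auto simp: lmod_direct_sum_simps)
      have "{i \<in> I. v i \<noteq> \<zero>\<^bsub>M i\<^esub>} \<subseteq> {i \<in> I. w i \<noteq> \<zero>\<^bsub>M i\<^esub>}" by (auto simp: v_def)
      then have "finite {i \<in> I. v i \<noteq> \<zero>\<^bsub>M i\<^esub>}"
        using insert.prems(1) by (auto simp: lmod_direct_sum_simps intro: finite_subset)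
      moreover have "v \<in> extensional I" "\<forall>i\<in>I. v i \<in> carrier (M i)"
        using insert.prems(1) abelian_monoid.zero_closed[OF ab] by (auto simp: lmod_direct_sum_simps v_def)
      ultimately have v: "v \<in> carrier ?S" by (simp add: lmod_direct_sum_simps)
      have "{i \<in> I. v i \<noteq> \<zero>\<^bsub>M i\<^esub>} \<subseteq> F" using insert.prems(2) by (auto simp: v_def)
      from insert.IH[OF v this] have "P v" .
      moreover have "P (lmod_single I M k (w k))" by (rule single[OF True wk])
      moreover have "w = lmod_single I M k (w k) \<oplus>\<^bsub>?S\<^esub> v"
        using insert.prems(1) wk
        by (auto simp: lmod_direct_sum_simps fun_eq_iff lmod_single_def v_def extensional_def
          abelian_monoid.l_zero[OF ab] abelian_monoid.r_zero[OF ab])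
      moreover have "lmod_single I M k (w k) \<in> carrier ?S"
        using lmod_hom_closed[OF lmod_single_hom[of I R M, OF modules[rule_format] True] wk] .
      ultimately show ?thesis using add v by metis
    qed
  qed
  then show ?thesis using assms(1) by (auto simp: lmod_direct_sum_simps)
qed

lemma lmod_direct_sum_map_hom:
  assumes "\<And>i. i \<in> I \<Longrightarrow> left_module R (M i)" "\<And>i. i \<in> I \<Longrightarrow> left_module R (N i)"
    and "\<And>i. i \<in> I \<Longrightarrow> f i \<in> lmod_hom R (M i) (N i)"
  shows "(\<lambda>w. \<lambda>i\<in>I. f i (w i)) \<in> lmod_hom R (lmod_direct_sum I M) (lmod_direct_sum I N)"
proof -
  have ab: "abelian_group (M i)" if "i \<in> I" for i using assms(1)[OF that] by (simp add: left_module_def)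
  have fin: "finite {i \<in> I. f i (w i) \<noteq> \<zero>\<^bsub>N i\<^esub>}" if "finite {i \<in> I. w i \<noteq> \<zero>\<^bsub>M i\<^esub>}" for w
    by (rule finite_subset[OF _ that]) (auto simp: lmod_hom_zero[OF assms])
  have "finite {i \<in> I. (\<lambda>i\<in>I. f i (w i)) i \<noteq> \<zero>\<^bsub>N i\<^esub>}" if "finite {i \<in> I. w i \<noteq> \<zero>\<^bsub>M i\<^esub>}" for w
    using fin[OF that] by (rule finite_subset[rotated]) auto
  then show ?thesis
    by (auto simp: lmod_hom_def lmod_direct_sum_simps lmod_hom_closed[OF assms(3)]
      lmod_hom_add[OF assms(3)] lmod_hom_smult[OF assms(3)] fun_eq_iff)
qed

lemma (in left_module) finsum_smult_ldistr:
  assumes "finite A" "a \<in> carrier R" "f \<in> A \<rightarrow> carrier M"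
  shows "finsum M (\<lambda>i. a \<odot>\<^bsub>M\<^esub> f i) A = a \<odot>\<^bsub>M\<^esub> finsum M f A"
  using assms by (induction set: finite) (simp_all add: Pi_def smult_r_distr)

lemma lmod_sum_hom:
  assumes "left_module R Y"
  shows "(\<lambda>w. finsum Y w {i \<in> I. w i \<noteq> \<zero>\<^bsub>Y\<^esub>}) \<in> lmod_hom R (lmod_direct_sum I (\<lambda>_. Y)) Y"
proof -
  interpret Y: left_module R Y by fact
  let ?S = "lmod_direct_sum I (\<lambda>_. Y)"
  interpret S: left_module R ?S by (rule left_module_direct_sum) (use Y.ring_axioms assms in auto)
  have eq: "finsum Y w {i \<in> I. w i \<noteq> \<zero>\<^bsub>Y\<^esub>} = finsum Y w F"
    if "w \<in> carrier ?S" "finite F" "{i \<in> I. w i \<noteq> \<zero>\<^bsub>Y\<^esub>} \<subseteq> F" "F \<subseteq> I" for w F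
    using that by (intro Y.M.add.finprod_mono_neutral_cong_left) (auto simp: lmod_direct_sum_simps)
  have supp: "finite {i \<in> I. w i \<noteq> \<zero>\<^bsub>Y\<^esub>}" if "w \<in> carrier ?S" for w
    using that by (simp add: lmod_direct_sum_simps)
  have cl: "w \<in> F \<rightarrow> carrier Y" if "w \<in> carrier ?S" "F \<subseteq> I" for w F
    using that by (auto simp: lmod_direct_sum_simps)
  show ?thesis unfolding lmod_hom_iff[OF S.left_module_axioms assms]
  proof (intro conjI ballI)
    show "(\<lambda>w. finsum Y w {i \<in> I. w i \<noteq> \<zero>\<^bsub>Y\<^esub>}) \<in> carrier ?S \<rightarrow> carrier Y"
      using cl by (auto intro!: Y.M.finsum_closed)
    fix r v w assume h: "r \<in> carrier R" "v \<in> carrier ?S" "w \<in> carrier ?S"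
    let ?u = "r \<odot>\<^bsub>?S\<^esub> v \<oplus>\<^bsub>?S\<^esub> w"
    define F where "F = {i \<in> I. v i \<noteq> \<zero>\<^bsub>Y\<^esub>} \<union> {i \<in> I. w i \<noteq> \<zero>\<^bsub>Y\<^esub>}"
    have F: "finite F" "F \<subseteq> I" using supp h by (auto simp: F_def)
    have u: "?u \<in> carrier ?S" using h by simp
    have "{i \<in> I. ?u i \<noteq> \<zero>\<^bsub>Y\<^esub>} \<subseteq> F" using h by (auto simp: F_def lmod_direct_sum_simps)
    then have "finsum Y ?u {i \<in> I. ?u i \<noteq> \<zero>\<^bsub>Y\<^esub>} = finsum Y ?u F" by (rule eq[OF u F(1) _ F(2)])
    also have "\<dots> = finsum Y (\<lambda>i. r \<odot>\<^bsub>Y\<^esub> v i \<oplus>\<^bsub>Y\<^esub> w i) F"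
      using F(2) h cl[OF h(2) F(2)] cl[OF h(3) F(2)]
      by (intro Y.M.finsum_cong') (auto simp: lmod_direct_sum_simps)
    also have "\<dots> = finsum Y (\<lambda>i. r \<odot>\<^bsub>Y\<^esub> v i) F \<oplus>\<^bsub>Y\<^esub> finsum Y w F"
      using h cl[OF h(2) F(2)] cl[OF h(3) F(2)] by (intro Y.M.finsum_addf) auto
    also have "finsum Y (\<lambda>i. r \<odot>\<^bsub>Y\<^esub> v i) F = r \<odot>\<^bsub>Y\<^esub> finsum Y v F"
      by (rule Y.finsum_smult_ldistr[OF F(1) h(1) cl[OF h(2) F(2)]])
    also have "finsum Y v F = finsum Y v {i \<in> I. v i \<noteq> \<zero>\<^bsub>Y\<^esub>}"
      by (rule eq[OF h(2) F(1) _ F(2), symmetric]) (auto simp: F_def)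
    also have "finsum Y w F = finsum Y w {i \<in> I. w i \<noteq> \<zero>\<^bsub>Y\<^esub>}"
      by (rule eq[OF h(3) F(1) _ F(2), symmetric]) (auto simp: F_def)
    finally show "finsum Y ?u {i \<in> I. ?u i \<noteq> \<zero>\<^bsub>Y\<^esub>} = r \<odot>\<^bsub>Y\<^esub> finsum Y v {i \<in> I. v i \<noteq> \<zero>\<^bsub>Y\<^esub>}
        \<oplus>\<^bsub>Y\<^esub> finsum Y w {i \<in> I. w i \<noteq> \<zero>\<^bsub>Y\<^esub>}" .
  qed
qed

lemma lmod_sum_single:
  assumes "left_module R Y" "k \<in> I" "y \<in> carrier Y"
  shows "finsum Y (lmod_single I (\<lambda>_. Y) k y) {i \<in> I. lmod_single I (\<lambda>_. Y) k y i \<noteq> \<zero>\<^bsub>Y\<^esub>} = y"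
proof -
  interpret Y: left_module R Y by fact
  have "{i \<in> I. lmod_single I (\<lambda>_. Y) k y i \<noteq> \<zero>\<^bsub>Y\<^esub>} = (if y = \<zero>\<^bsub>Y\<^esub> then {} else {k})"
    using assms(2) by (auto simp: lmod_single_def)
  moreover have "finsum Y (lmod_single I (\<lambda>_. Y) k y) {k} = y"
    using assms by (subst Y.M.finsum_insert) (auto simp: lmod_single_def)
  ultimately show ?thesis by simp
qed

section \<open>Universal sequences\<close>

lemma lmod_iso_inverse:
  assumes "left_module R M" "left_module R N" "\<phi> \<in> lmod_iso R M N"
  obtains \<chi> where "\<chi> \<in> lmod_hom R N M" "\<And>x. x \<in> carrier M \<Longrightarrow> \<chi> (\<phi> x) = x"
    "\<And>y. y \<in> carrier N \<Longrightarrow> \<phi> (\<chi> y) = y"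
proof -
  interpret M: left_module R M by fact
  interpret N: left_module R N by fact
  have \<phi>: "\<phi> \<in> lmod_hom R M N" "bij_betw \<phi> (carrier M) (carrier N)"
    using assms(3) by (auto simp: lmod_iso_def)
  define \<chi> where "\<chi> = inv_into (carrier M) \<phi>"
  have \<chi>: "\<chi> (\<phi> x) = x" if "x \<in> carrier M" for x
    unfolding \<chi>_def using bij_betw_inv_into_left[OF \<phi>(2) that] .
  have \<chi>': "\<chi> u \<in> carrier M" "\<phi> (\<chi> u) = u" if "u \<in> carrier N" for u
    unfolding \<chi>_def using bij_betw_inv_into_right[OF \<phi>(2) that] bij_betw_apply[OF bij_betw_inv_into[OF \<phi>(2)] that]
    by auto
  have "\<chi> \<in> lmod_hom R N M"
    unfolding lmod_hom_iff[OF assms(2,1)]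
  proof (intro conjI ballI)
    fix r u v assume h: "r \<in> carrier R" "u \<in> carrier N" "v \<in> carrier N"
    have "r \<odot>\<^bsub>N\<^esub> u \<oplus>\<^bsub>N\<^esub> v = \<phi> (r \<odot>\<^bsub>M\<^esub> \<chi> u \<oplus>\<^bsub>M\<^esub> \<chi> v)"
      using h \<chi>' by (simp add: lmod_hom_add[OF \<phi>(1)] lmod_hom_smult[OF \<phi>(1)])
    then show "\<chi> (r \<odot>\<^bsub>N\<^esub> u \<oplus>\<^bsub>N\<^esub> v) = r \<odot>\<^bsub>M\<^esub> \<chi> u \<oplus>\<^bsub>M\<^esub> \<chi> v"
      using h \<chi>' by (simp add: \<chi>)
  qed (use \<chi>' in auto)
  then show thesis by (rule that[OF _ \<chi> \<chi>'(2)])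
qed

lemma in_lmod_End_iff: "c \<in> carrier (lmod_End R X) \<longleftrightarrow> c \<in> lmod_hom R X X \<and> c \<in> extensional (carrier X)"
  by (simp add: lmod_End_def)

locale universal_extension =
  fixes R :: "('r, 'q) ring_scheme"
    and \<X> :: "('r, 'x) module set"
    and Y :: "('r, 'y) module"
    and B :: "('r, 'x) module \<Rightarrow> ('r, 'y, 'y \<times> 'x, 'x) short_seq set set"
    and e :: "('r, 'x) module \<Rightarrow> ('r, 'y, 'y \<times> 'x, 'x) short_seq set \<Rightarrow> ('r, 'y, 'y \<times> 'x, 'x) short_seq"
    and s :: "('r, 'y, 'm, ('r, 'x) module \<times> ('r, 'y, 'y \<times> 'x, 'x) short_seq set \<Rightarrow> 'x) short_seq"
  assumes semibrick: "semibrick R \<X>"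
    and basis: "X \<in> \<X> \<Longrightarrow> lmod_basis (lmod_End R X) (Ext1 R X Y) (B X)"
    and repr: "X \<in> \<X> \<Longrightarrow> b \<in> B X \<Longrightarrow> e X b \<in> b"
    and exact: "short_exact R Y (lmod_direct_sum (Sigma \<X> B) fst) s"
    and equiv: "ext_equiv R Y s (universal_pushout \<X> Y B e)"
begin

abbreviation "I \<equiv> Sigma \<X> B"
abbreviation "M \<equiv> ext_mid s"
abbreviation "S \<equiv> lmod_direct_sum I fst"

lemmas seq = short_exactD[OF exact]

lemma brick: "X \<in> \<X> \<Longrightarrow> brick R X" using semibrick by (simp add: semibrick_def)

lemma X_module: "X \<in> \<X> \<Longrightarrow> left_module R X" using brick by (simp add: brick_def)

lemma I_module: "i \<in> I \<Longrightarrow> left_module R (fst i)" using X_module by auto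

lemma I_modules: "\<forall>i\<in>I. left_module R (fst i)" using I_module by blast

lemma ring: "ring R" using seq(1) by (simp add: left_module_def)

lemma basis_cocycle:
  assumes "X \<in> \<X>" "b \<in> B X"
  obtains \<kappa> where "b = cocycle_class R Y X \<kappa>" "cocycle_class R Y X \<kappa> \<noteq> {}"
    "short_exact R Y X (e X b)" "ext_cocycle R Y X (e X b) \<kappa>"
proof -
  have "b \<in> carrier (Ext1 R X Y)" using basis[OF assms(1)] assms(2) by (auto simp: lmod_basis_def)
  then obtain \<kappa> where k: "b = cocycle_class R Y X \<kappa>" "cocycle_class R Y X \<kappa> \<noteq> {}" by (rule Ext1_carrierE)
  from repr[OF assms] k(1) have "e X b \<in> cocycle_class R Y X \<kappa>" by simp
  then show thesis by (intro that[OF k]) (simp_all add: cocycle_class_def)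
qed

lemma basis_exact: "X \<in> \<X> \<Longrightarrow> b \<in> B X \<Longrightarrow> short_exact R Y X (e X b)"
  by (rule basis_cocycle)

lemma basis_spans:
  assumes "X \<in> \<X>" "v \<in> carrier (Ext1 R X Y)"
  obtains F c where "finite F" "F \<subseteq> B X" "c \<in> F \<rightarrow> carrier (lmod_End R X)"
    "v = finsum (Ext1 R X Y) (\<lambda>b. c b \<odot>\<^bsub>Ext1 R X Y\<^esub> b) F"
  using basis[OF assms(1), unfolded lmod_basis_def, THEN conjunct2, THEN conjunct1, rule_format, OF assms(2)]
  by (elim exE conjE) (rule that)

lemma basis_independent:
  assumes "X \<in> \<X>" "finite F" "F \<subseteq> B X" "c \<in> F \<rightarrow> carrier (lmod_End R X)"
    "finsum (Ext1 R X Y) (\<lambda>b. c b \<odot>\<^bsub>Ext1 R X Y\<^esub> b) F = \<zero>\<^bsub>Ext1 R X Y\<^esub>" "b \<in> F"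
  shows "c b = \<zero>\<^bsub>lmod_End R X\<^esub>"
  using basis[OF assms(1), unfolded lmod_basis_def, THEN conjunct2, THEN conjunct2, rule_format,
      OF conjI[OF assms(2) conjI[OF assms(3) conjI[OF assms(4,5)]]] assms(6)] .

lemma component:
  assumes X: "X \<in> \<X>" and b: "b \<in> B X"
  obtains \<theta> where "\<theta> \<in> lmod_hom R (ext_mid (e X b)) M"
    "\<And>y. y \<in> carrier Y \<Longrightarrow> \<theta> (ext_inj (e X b) y) = ext_inj s y"
    "\<And>a. a \<in> carrier (ext_mid (e X b)) \<Longrightarrow> ext_proj s (\<theta> a) = lmod_single I fst (X, b) (ext_proj (e X b) a)"
proof -
  let ?e = "\<lambda>(X, b). e X b"
  define d where "d = direct_sum_seq I ?e"
  define g where "g = (\<lambda>w. finsum Y w {i \<in> I. w i \<noteq> \<zero>\<^bsub>Y\<^esub>})"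
  let ?D = "lmod_direct_sum I (\<lambda>_. Y)"
  let ?t = "pushout_seq ?D Y g d"
  have t: "universal_pushout \<X> Y B e = ?t" by (simp add: universal_pushout_def d_def g_def)
  have ex: "short_exact R Y (fst i) (?e i)" if "i \<in> I" for i using basis_exact that by auto
  note ed = short_exactD[OF ex]
  have d_mid: "ext_mid d = lmod_direct_sum I (\<lambda>i. ext_mid (?e i))"
    and d_inj: "ext_inj d = (\<lambda>w. \<lambda>i\<in>I. ext_inj (?e i) (w i))"
    and d_proj: "ext_proj d = (\<lambda>w. \<lambda>i\<in>I. ext_proj (?e i) (w i))"
    by (simp_all add: d_def direct_sum_seq_def)
  have D: "left_module R ?D" by (rule left_module_direct_sum[OF ring seq(1)])
  have E: "left_module R (ext_mid d)" unfolding d_mid by (rule left_module_direct_sum[OF ring ed(2)])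
  have g: "g \<in> lmod_hom R ?D Y" unfolding g_def by (rule lmod_sum_hom[OF seq(1)])
  have i: "ext_inj d \<in> lmod_hom R ?D (ext_mid d)"
    unfolding d_inj d_mid by (rule lmod_direct_sum_map_hom[OF seq(1) ed(2,4)])
  have p: "ext_proj d \<in> lmod_hom R (ext_mid d) S"
    unfolding d_proj d_mid by (rule lmod_direct_sum_map_hom[OF ed(2) I_module ed(5)])
  have pi: "ext_proj d (ext_inj d w) = \<zero>\<^bsub>S\<^esub>" if "w \<in> carrier ?D" for w
    using that ed(8) by (auto simp: d_inj d_proj lmod_direct_sum_simps fun_eq_iff)
  obtain q where q:
    "left_module R (ext_mid ?t)"
    "q \<in> lmod_hom R (lmod_prod Y (ext_mid d)) (ext_mid ?t)"
    "\<And>z a z' a'. z \<in> carrier Y \<Longrightarrow> z' \<in> carrier Y \<Longrightarrow> a \<in> carrier (ext_mid d) \<Longrightarrow>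
      a' \<in> carrier (ext_mid d) \<Longrightarrow> q (z, a) = q (z', a') \<longleftrightarrow>
      (\<exists>y\<in>carrier ?D. z = g y \<oplus>\<^bsub>Y\<^esub> z' \<and> a' = ext_inj d y \<oplus>\<^bsub>ext_mid d\<^esub> a)"
    "\<And>z. ext_inj ?t z = q (z, \<zero>\<^bsub>ext_mid d\<^esub>)"
    "\<And>z a. z \<in> carrier Y \<Longrightarrow> a \<in> carrier (ext_mid d) \<Longrightarrow> ext_proj ?t (q (z, a)) = ext_proj d a"
    by (rule pushout_seq_projection[OF D seq(1) E g i p seq(3)]) (erule pi, rule that)
  from equiv obtain \<phi> where \<phi>: "\<phi> \<in> lmod_iso R M (ext_mid ?t)"
    "\<And>y. y \<in> carrier Y \<Longrightarrow> \<phi> (ext_inj s y) = ext_inj ?t y"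
    "\<And>a. a \<in> carrier M \<Longrightarrow> ext_proj ?t (\<phi> a) = ext_proj s a"
    unfolding t by (auto simp: ext_equiv_def)
  obtain \<chi> where \<chi>: "\<chi> \<in> lmod_hom R (ext_mid ?t) M" "\<And>a. a \<in> carrier M \<Longrightarrow> \<chi> (\<phi> a) = a"
    "\<And>u. u \<in> carrier (ext_mid ?t) \<Longrightarrow> \<phi> (\<chi> u) = u"
    by (rule lmod_iso_inverse[OF seq(2) q(1) \<phi>(1)]) (rule that)
  interpret Y: left_module R Y by (rule seq)
  let ?k = "(X, b)"
  have k: "?k \<in> I" using X b by auto
  let ?j = "lmod_single I (\<lambda>i. ext_mid (?e i)) ?k"
  have j: "?j \<in> lmod_hom R (ext_mid (e X b)) (ext_mid d)"
    unfolding d_mid using lmod_single_hom[of I R "\<lambda>i. ext_mid (?e i)", OF ed(2) k] by simp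
  have j': "(\<lambda>a. (\<zero>\<^bsub>Y\<^esub>, ?j a)) \<in> lmod_hom R (ext_mid (e X b)) (lmod_prod Y (ext_mid d))"
    using j by (auto simp: lmod_hom_def)
  note jt = lmod_hom_comp[OF j' q(2)]
  note jcl = lmod_hom_closed[OF j] lmod_hom_closed[OF jt]
  define \<theta> where "\<theta> a = \<chi> (q (\<zero>\<^bsub>Y\<^esub>, ?j a))" for a
  show thesis
  proof (rule that)
    show "\<theta> \<in> lmod_hom R (ext_mid (e X b)) M"
      using lmod_hom_comp[OF jt \<chi>(1)] by (simp add: \<theta>_def[abs_def])
  next
    fix y assume y: "y \<in> carrier Y"
    let ?w = "lmod_single I (\<lambda>_. Y) ?k y"
    have w: "?w \<in> carrier ?D" by (rule lmod_hom_closed[OF lmod_single_hom[of I R "\<lambda>_. Y", OF seq(1) k] y])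
    have gw: "g ?w = y" unfolding g_def by (rule lmod_sum_single[OF seq(1) k y])
    have iw: "ext_inj d ?w = ?j (ext_inj (e X b) y)"
      using lmod_hom_zero[OF ed(1,2,4)] by (auto simp: d_inj lmod_single_def fun_eq_iff)
    have iy: "ext_inj (e X b) y \<in> carrier (ext_mid (e X b))"
      using lmod_hom_closed[OF ed(4)[OF k] y] by simp
    interpret E: left_module R "ext_mid d" by (rule E)
    have "q (y, \<zero>\<^bsub>ext_mid d\<^esub>) = q (\<zero>\<^bsub>Y\<^esub>, ?j (ext_inj (e X b) y))"
      using y w jcl(1)[OF iy] gw iw by (subst q(3)) (auto intro!: bexI[of _ ?w])
    then have "\<phi> (ext_inj s y) = q (\<zero>\<^bsub>Y\<^esub>, ?j (ext_inj (e X b) y))"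
      using \<phi>(2)[OF y] q(4) by simp
    then show "\<theta> (ext_inj (e X b) y) = ext_inj s y"
      using \<chi>(2)[OF lmod_hom_closed[OF seq(4) y]] by (simp add: \<theta>_def)
  next
    fix a assume a: "a \<in> carrier (ext_mid (e X b))"
    have "ext_proj s (\<theta> a) = ext_proj ?t (q (\<zero>\<^bsub>Y\<^esub>, ?j a))"
      using \<phi>(3)[OF lmod_hom_closed[OF \<chi>(1) jcl(2)[OF a]]] \<chi>(3)[OF jcl(2)[OF a]] by (simp add: \<theta>_def)
    also have "\<dots> = ext_proj d (?j a)" using jcl(1)[OF a] by (simp add: q(5))
    also have "\<dots> = lmod_single I fst (X, b) (ext_proj (e X b) a)"
      using lmod_hom_zero[OF ed(2) I_module ed(5)] by (auto simp: d_proj lmod_single_def fun_eq_iff)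
    finally show "ext_proj s (\<theta> a) = \<dots>" .
  qed
qed

lemma combination:
  assumes X: "X \<in> \<X>" and "finite F" "F \<subseteq> B X" "c \<in> F \<rightarrow> carrier (lmod_End R X)"
  obtains \<kappa> m where
    "finsum (Ext1 R X Y) (\<lambda>b. c b \<odot>\<^bsub>Ext1 R X Y\<^esub> b) F = cocycle_class R Y X \<kappa>"
    "cocycle_class R Y X \<kappa> \<noteq> {}"
    "lin_defect R X M m (\<lambda>r x y. ext_inj s (\<kappa> r x y))"
    "\<And>x i. x \<in> carrier X \<Longrightarrow> i \<in> I \<Longrightarrow>
      ext_proj s (m x) i = (if fst i = X \<and> snd i \<in> F then c (snd i) x else \<zero>\<^bsub>fst i\<^esub>)"
  using assms(2-4)
proof (induction F arbitrary: thesis rule: finite_induct)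
  let ?V = "Ext1 R X Y"
  note Xm = X_module[OF X]
  interpret X: left_module R X by (rule Xm)
  interpret Y: left_module R Y by (rule seq)
  interpret M: left_module R M by (rule seq)
  interpret V: abelian_monoid ?V by (rule abelian_monoid_Ext1[OF seq(1) Xm])
  {
    case empty
    let ?z = "\<lambda>r x y. \<zero>\<^bsub>Y\<^esub>"
    have d: "lin_defect R X Y (\<lambda>x. \<zero>\<^bsub>Y\<^esub>) ?z" by (rule lin_defectI) simp_all
    note z = Ext1_zero_cocycle_class[OF seq(1) Xm d]
    have "lin_defect R X M (\<lambda>x. \<zero>\<^bsub>M\<^esub>) (\<lambda>r x y. ext_inj s \<zero>\<^bsub>Y\<^esub>)"
      using lin_defect_comp[OF Xm seq(1) d seq(4)] lmod_hom_zero[OF seq(1,2,4)] by simp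
    then show ?case using z lmod_hom_zero[OF seq(2,3,5)]
      by (intro empty.prems(1)[of ?z "\<lambda>x. \<zero>\<^bsub>M\<^esub>"]) (simp_all add: lmod_direct_sum_simps)
  next
    case (insert b F)
    have "F \<subseteq> B X" "c \<in> F \<rightarrow> carrier (lmod_End R X)" using insert.prems(2,3) by auto
    note IHprems = this
    obtain \<kappa> m where IH: "finsum ?V (\<lambda>b. c b \<odot>\<^bsub>?V\<^esub> b) F = cocycle_class R Y X \<kappa>"
      "cocycle_class R Y X \<kappa> \<noteq> {}" "lin_defect R X M m (\<lambda>r x y. ext_inj s (\<kappa> r x y))"
      and pm: "\<And>x i. x \<in> carrier X \<Longrightarrow> i \<in> I \<Longrightarrow>
        ext_proj s (m x) i = (if fst i = X \<and> snd i \<in> F then c (snd i) x else \<zero>\<^bsub>fst i\<^esub>)"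
      by (rule insert.IH[OF _ IHprems]) (rule that)
    have b: "b \<in> B X" using insert.prems(2) by auto
    have hom: "c a \<in> lmod_hom R X X" if "a \<in> insert b F" for a
      using insert.prems(3) that by (auto simp: in_lmod_End_iff Pi_def)
    have h: "c b \<in> lmod_hom R X X" by (rule hom) simp
    note hcl = lmod_hom_closed[OF h]
    obtain \<rho> where \<rho>: "b = cocycle_class R Y X \<rho>" "cocycle_class R Y X \<rho> \<noteq> {}"
      "short_exact R Y X (e X b)" "ext_cocycle R Y X (e X b) \<rho>" by (rule basis_cocycle[OF X b])
    obtain \<theta> where \<theta>: "\<theta> \<in> lmod_hom R (ext_mid (e X b)) M"
      "\<And>y. y \<in> carrier Y \<Longrightarrow> \<theta> (ext_inj (e X b) y) = ext_inj s y"
      "\<And>a. a \<in> carrier (ext_mid (e X b)) \<Longrightarrow> ext_proj s (\<theta> a) = lmod_single I fst (X, b) (ext_proj (e X b) a)"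
      by (rule component[OF X b]) (rule that)
    obtain \<sigma> where \<sigma>: "\<And>x. x \<in> carrier X \<Longrightarrow> ext_proj (e X b) (\<sigma> x) = x"
      "lin_defect R X (ext_mid (e X b)) \<sigma> (\<lambda>r x y. ext_inj (e X b) (\<rho> r x y))"
      using \<rho>(4) by (rule ext_cocycleE) blast
    note \<sigma>cl = lin_defectD(1)[OF \<sigma>(2)]
    note dh = lin_defect_comp[OF Xm short_exactD(2)[OF \<rho>(3)] lin_defect_precomp[OF Xm h \<sigma>(2)] \<theta>(1)]
    note sm = Ext1_smult_cocycle_class[OF \<rho>(2) Xm h]
    have smcl: "c a \<odot>\<^bsub>?V\<^esub> a \<in> carrier ?V" if a: "a \<in> insert b F" for a
    proof -
      from a insert.prems(2) have "a \<in> B X" by auto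
      then obtain \<mu> where \<mu>: "a = cocycle_class R Y X \<mu>" "cocycle_class R Y X \<mu> \<noteq> {}"
        by (rule basis_cocycle[OF X])
      note m = Ext1_smult_cocycle_class[OF \<mu>(2) Xm hom[OF a]]
      have "c a \<odot>\<^bsub>?V\<^esub> cocycle_class R Y X \<mu> \<in> carrier ?V"
        unfolding m(1) by (rule Ext1_carrierI[OF m(2)])
      then show ?thesis using \<mu>(1) by simp
    qed
    have cb: "c b \<odot>\<^bsub>?V\<^esub> b = cocycle_class R Y X (\<lambda>r x y. \<rho> r (c b x) (c b y))"
      using sm(1) \<rho>(1) by simp
    have "finsum ?V (\<lambda>b. c b \<odot>\<^bsub>?V\<^esub> b) (insert b F) = c b \<odot>\<^bsub>?V\<^esub> b \<oplus>\<^bsub>?V\<^esub> finsum ?V (\<lambda>b. c b \<odot>\<^bsub>?V\<^esub> b) F"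
      using insert.hyps smcl by (intro V.finsum_insert) auto
    also have "\<dots> = cocycle_class R Y X (\<lambda>r x y. \<rho> r (c b x) (c b y) \<oplus>\<^bsub>Y\<^esub> \<kappa> r x y)"
      unfolding cb IH(1) by (rule Ext1_add_cocycle_class[OF sm(2) IH(2)])
    finally have fin: "finsum ?V (\<lambda>b. c b \<odot>\<^bsub>?V\<^esub> b) (insert b F) = \<dots>" .
    have ne: "cocycle_class R Y X (\<lambda>r x y. \<rho> r (c b x) (c b y) \<oplus>\<^bsub>Y\<^esub> \<kappa> r x y) \<noteq> {}"
      by (rule Ext1_add_cocycle_class[OF sm(2) IH(2)])
    have \<kappa>cl: "\<kappa> r x y \<in> carrier Y" "\<rho> r x y \<in> carrier Y"
      if "r \<in> carrier R" "x \<in> carrier X" "y \<in> carrier X" for r x y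
      using ext_cocycle_closed[OF some_in_cocycle_class(2)[OF IH(2)] that]
        ext_cocycle_closed[OF \<rho>(4) that] by auto
    let ?m = "\<lambda>x. \<theta> (\<sigma> (c b x)) \<oplus>\<^bsub>M\<^esub> m x"
    have d: "lin_defect R X M ?m (\<lambda>r x y. ext_inj s (\<rho> r (c b x) (c b y) \<oplus>\<^bsub>Y\<^esub> \<kappa> r x y))"
      by (rule lin_defect_cong[OF Xm lin_defect_add[OF Xm seq(2) dh IH(3)]])
        (simp_all add: \<kappa>cl hcl \<theta>(2) lmod_hom_add[OF seq(4)])
    have "ext_proj s (?m x) i = (if fst i = X \<and> snd i \<in> insert b F then c (snd i) x else \<zero>\<^bsub>fst i\<^esub>)"
      if x: "x \<in> carrier X" and i: "i \<in> I" for x i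
    proof -
      interpret I: left_module R "fst i" by (rule I_module[OF i])
      have "\<theta> (\<sigma> (c b x)) \<in> carrier M" "m x \<in> carrier M"
        using lmod_hom_closed[OF \<theta>(1)] \<sigma>cl hcl x lin_defectD(1)[OF IH(3)] by auto
      then have "ext_proj s (?m x) i = lmod_single I fst (X, b) (c b x) i \<oplus>\<^bsub>fst i\<^esub> ext_proj s (m x) i"
        using i by (simp add: lmod_hom_add[OF seq(5)] \<theta>(3) \<sigma>cl \<sigma>(1) hcl x lmod_direct_sum_simps)
      also have "\<dots> = (if fst i = X \<and> snd i \<in> insert b F then c (snd i) x else \<zero>\<^bsub>fst i\<^esub>)"
        using insert.hyps(2) i x hcl lmod_hom_closed[OF hom] I.M.l_zero[OF I.M.zero_closed]
        by (cases i) (auto simp: pm lmod_single_def)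
      finally show ?thesis .
    qed
    then show ?case by (rule insert.prems(1)[OF fin ne d])
  }
qed

text \<open>The map \<open>Ext\<^sup>1(X, Y) \<rightarrow> Ext\<^sup>1(X, M)\<close> is zero, because it kills a basis by construction of \<open>M\<close>.\<close>

lemma pushed_cocycle_trivial:
  assumes X: "X \<in> \<X>" and t: "short_exact R A X t" "ext_cocycle R A X t \<kappa>" and g: "g \<in> lmod_hom R A Y"
  shows "\<exists>m. lin_defect R X M m (\<lambda>r x y. ext_inj s (g (\<kappa> r x y)))"
proof -
  let ?V = "Ext1 R X Y" and ?k = "\<lambda>r x y. g (\<kappa> r x y)"
  note Xm = X_module[OF X]
  interpret Y: left_module R Y by (rule seq)
  interpret M: left_module R M by (rule seq)
  note ne = ext_class_eq_cocycle_class(2)[OF short_exact_pushout[OF t(1) seq(1) g] ext_cocycle_pushout[OF t(1) seq(1) g t(2)]]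
  obtain F c where F: "finite F" "F \<subseteq> B X" "c \<in> F \<rightarrow> carrier (lmod_End R X)"
    "cocycle_class R Y X ?k = finsum ?V (\<lambda>b. c b \<odot>\<^bsub>?V\<^esub> b) F"
    by (rule basis_spans[OF X Ext1_carrierI[OF ne]])
  obtain \<rho> m where \<rho>: "finsum ?V (\<lambda>b. c b \<odot>\<^bsub>?V\<^esub> b) F = cocycle_class R Y X \<rho>"
    "lin_defect R X M m (\<lambda>r x y. ext_inj s (\<rho> r x y))" by (rule combination[OF X F(1-3)]) (rule that)
  obtain u where "u \<in> cocycle_class R Y X ?k" using ne by auto
  moreover from this have "u \<in> cocycle_class R Y X \<rho>" using F(4) \<rho>(1) by simp
  ultimately have u: "short_exact R Y X u" "ext_cocycle R Y X u ?k" and u': "ext_cocycle R Y X u \<rho>"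
    by (simp_all add: cocycle_class_def)
  obtain n where n: "lin_defect R X Y n (\<lambda>r x y. ?k r x y \<ominus>\<^bsub>Y\<^esub> \<rho> r x y)"
    using cocycle_difference[OF u u'] by (rule exE)
  note d = lin_defect_add[OF Xm seq(2) lin_defect_comp[OF Xm seq(1) n seq(4)] \<rho>(2)]
  have "lin_defect R X M (\<lambda>x. ext_inj s (n x) \<oplus>\<^bsub>M\<^esub> m x) (\<lambda>r x y. ext_inj s (?k r x y))"
  proof (rule lin_defect_cong[OF Xm d])
    fix r x y assume h: "r \<in> carrier R" "x \<in> carrier X" "y \<in> carrier X"
    note cl = ext_cocycle_closed[OF u(2) h] ext_cocycle_closed[OF u' h]
    have "ext_inj s (?k r x y) = ext_inj s ((?k r x y \<ominus>\<^bsub>Y\<^esub> \<rho> r x y) \<oplus>\<^bsub>Y\<^esub> \<rho> r x y)"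
      using cl by (simp add: a_minus_def Y.M.a_assoc Y.M.l_neg)
    also have "\<dots> = ext_inj s (?k r x y \<ominus>\<^bsub>Y\<^esub> \<rho> r x y) \<oplus>\<^bsub>M\<^esub> ext_inj s (\<rho> r x y)"
      using cl by (intro lmod_hom_add[OF seq(4)]) auto
    finally show "ext_inj s (?k r x y) = \<dots>" .
  qed simp
  then show ?thesis by (rule exI[of _ "\<lambda>x. ext_inj s (n x) \<oplus>\<^bsub>M\<^esub> m x"])
qed

text \<open>
  A homomorphism \<open>X \<rightarrow> M\<close> lifts its image \<open>\<Sum> h\<^sub>b\<close> in the direct sum, so the class \<open>\<Sum> h\<^sub>b b\<close> is zero;
  linear independence gives \<open>h\<^sub>b = 0\<close>.
\<close>

lemma hom_into_base:
  assumes X: "X \<in> \<X>" and u: "u \<in> lmod_hom R X M" and x0: "x0 \<in> carrier X"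
  shows "\<exists>y\<in>carrier Y. u x0 = ext_inj s y"
proof (rule seq(9)[OF lmod_hom_closed[OF u x0]], rule ccontr)
  assume nonzero: "ext_proj s (u x0) \<noteq> \<zero>\<^bsub>S\<^esub>"
  let ?V = "Ext1 R X Y" and ?D = "lmod_End R X"
  note Xm = X_module[OF X]
  interpret X: left_module R X by (rule Xm)
  interpret Y: left_module R Y by (rule seq)
  interpret M: left_module R M by (rule seq)
  interpret S: left_module R S by (rule seq)
  note ucl = lmod_hom_closed[OF u]
  have h: "(\<lambda>x. ext_proj s (u x) i) \<in> lmod_hom R X (fst i)" if "i \<in> I" for i
    using lmod_hom_comp[OF lmod_hom_comp[OF u seq(5)] lmod_component_hom[OF that]] .
  have other: "ext_proj s (u x) i = \<zero>\<^bsub>fst i\<^esub>" if "i \<in> I" "fst i \<noteq> X" "x \<in> carrier X" for i x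
    using h[OF that(1)] semibrick X that unfolding semibrick_def by force
  define c where "c b = (\<lambda>x\<in>carrier X. ext_proj s (u x) (X, b))" for b
  have c: "c b \<in> carrier ?D" if "b \<in> B X" for b
    using h[of "(X, b)"] that X by (auto simp: c_def in_lmod_End_iff lmod_hom_def)
  define F where "F = {b \<in> B X. c b x0 \<noteq> \<zero>\<^bsub>X\<^esub>}"
  have pu: "ext_proj s (u x) \<in> carrier S" if "x \<in> carrier X" for x
    using lmod_hom_closed[OF seq(5) ucl[OF that]] .
  have "Pair X ` F \<subseteq> {i \<in> I. ext_proj s (u x0) i \<noteq> \<zero>\<^bsub>fst i\<^esub>}"
    using X x0 by (auto simp: F_def c_def)
  moreover have "finite {i \<in> I. ext_proj s (u x0) i \<noteq> \<zero>\<^bsub>fst i\<^esub>}"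
    using pu[OF x0] by (simp add: lmod_direct_sum_simps)
  ultimately have "finite (Pair X ` F)" by (rule finite_subset)
  then have fin: "finite F" by (rule finite_imageD) (simp add: inj_on_def)
  have off: "c b x = \<zero>\<^bsub>X\<^esub>" if b: "b \<in> B X" "b \<notin> F" and x: "x \<in> carrier X" for b x
  proof (rule ccontr)
    assume nz: "c b x \<noteq> \<zero>\<^bsub>X\<^esub>"
    have "division_ring ?D" using brick[OF X] by (simp add: brick_def)
    moreover have "c b \<noteq> \<zero>\<^bsub>?D\<^esub>" using nz x by (auto simp: lmod_End_def)
    ultimately have "c b \<in> Units ?D" using c[OF b(1)] by (simp add: division_ring_def)
    then obtain v where v: "v \<in> carrier ?D" "c b \<otimes>\<^bsub>?D\<^esub> v = \<one>\<^bsub>?D\<^esub>" by (auto simp: Units_def)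
    then have "v (c b y) = y" if "y \<in> carrier X" for y
      using that by (simp add: lmod_End_def compose_def fun_eq_iff) metis
    moreover have "v \<zero>\<^bsub>X\<^esub> = \<zero>\<^bsub>X\<^esub>"
      using v(1) lmod_hom_zero[OF Xm Xm] by (simp add: in_lmod_End_iff)
    moreover have "c b x0 = \<zero>\<^bsub>X\<^esub>" using b by (simp add: F_def)
    ultimately have "x0 = \<zero>\<^bsub>X\<^esub>" using x0 by metis
    then have "ext_proj s (u x0) = \<zero>\<^bsub>S\<^esub>"
      using lmod_hom_zero[OF Xm seq(2) u] lmod_hom_zero[OF seq(2,3,5)] by simp
    with nonzero show False by simp
  qed
  have FB: "F \<subseteq> B X" by (auto simp: F_def)
  have cF: "c \<in> F \<rightarrow> carrier ?D" using c FB by auto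
  obtain \<kappa> m where
    k: "finsum ?V (\<lambda>b. c b \<odot>\<^bsub>?V\<^esub> b) F = cocycle_class R Y X \<kappa>" "cocycle_class R Y X \<kappa> \<noteq> {}"
    and d: "lin_defect R X M m (\<lambda>r x y. ext_inj s (\<kappa> r x y))"
    and pm: "\<And>x i. x \<in> carrier X \<Longrightarrow> i \<in> I \<Longrightarrow>
      ext_proj s (m x) i = (if fst i = X \<and> snd i \<in> F then c (snd i) x else \<zero>\<^bsub>fst i\<^esub>)"
    by (rule combination[OF X fin FB cF]) (rule that)
  note mcl = lin_defectD(1)[OF d]
  have "ext_proj s (m x) = ext_proj s (u x)" if x: "x \<in> carrier X" for x
  proof (rule extensionalityI[of _ I])
    show "ext_proj s (m x) \<in> extensional I" "ext_proj s (u x) \<in> extensional I"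
      using lmod_hom_closed[OF seq(5) mcl[OF x]] pu[OF x] by (simp_all add: lmod_direct_sum_simps)
    fix i assume i: "i \<in> I"
    show "ext_proj s (m x) i = ext_proj s (u x) i"
    proof (cases "fst i = X \<and> snd i \<in> F")
      case True
      then show ?thesis using pm[OF x i] x by (cases i) (simp add: c_def)
    next
      case False
      have "ext_proj s (u x) i = \<zero>\<^bsub>fst i\<^esub>"
      proof (cases "fst i = X")
        case True
        with False i have "snd i \<in> B X" "snd i \<notin> F" by auto
        from off[OF this x] True x show ?thesis by (cases i) (simp add: c_def)
      qed (rule other[OF i _ x])
      with pm[OF x i] show ?thesis unfolding if_not_P[OF False] by simp
    qed
  qed
  then have "\<exists>y\<in>carrier Y. m x \<ominus>\<^bsub>M\<^esub> u x = ext_inj s y" if "x \<in> carrier X" for x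
    using that mcl ucl pu[OF that] by (intro seq(9)) (simp_all add: a_minus_def lmod_hom_add[OF seq(5)]
        lmod_hom_minus[OF seq(2,3,5)] S.M.r_neg)
  then obtain n where n: "\<And>x. x \<in> carrier X \<Longrightarrow> n x \<in> carrier Y"
    "\<And>x. x \<in> carrier X \<Longrightarrow> m x \<ominus>\<^bsub>M\<^esub> u x = ext_inj s (n x)" by metis
  note \<kappa>cl = ext_cocycle_closed[OF some_in_cocycle_class(2)[OF k(2)]]
  have ud: "lin_defect R X M u (\<lambda>r x y. \<zero>\<^bsub>M\<^esub>)" using lin_defect_zero_iff[OF Xm seq(2)] u by simp
  have "lin_defect R X Y n \<kappa>"
  proof (rule lin_defect_reflect[OF Xm seq(1,4,6) n(1) \<kappa>cl])
    show "lin_defect R X M (\<lambda>x. ext_inj s (n x)) (\<lambda>r x y. ext_inj s (\<kappa> r x y))"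
    proof (rule lin_defect_cong[OF Xm lin_defect_minus[OF Xm seq(2) d ud]])
      show "ext_inj s (n x) = m x \<ominus>\<^bsub>M\<^esub> u x" if "x \<in> carrier X" for x using n(2)[OF that] by simp
    qed (simp add: a_minus_def \<kappa>cl lmod_hom_closed[OF seq(4)])
  qed
  from Ext1_zero_cocycle_class(1)[OF seq(1) Xm this] k(1)
  have "finsum ?V (\<lambda>b. c b \<odot>\<^bsub>?V\<^esub> b) F = \<zero>\<^bsub>?V\<^esub>" by simp
  then have "c b = \<zero>\<^bsub>?D\<^esub>" if "b \<in> F" for b using that by (rule basis_independent[OF X fin FB cF])
  then have "c b x0 = \<zero>\<^bsub>X\<^esub>" if "b \<in> F" for b using that x0 by (simp add: lmod_End_def)
  then have "F = {}" by (auto simp: F_def)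
  have "ext_proj s (u x0) = \<zero>\<^bsub>S\<^esub>"
  proof (rule extensionalityI[of _ I])
    fix i assume i: "i \<in> I"
    show "ext_proj s (u x0) i = \<zero>\<^bsub>S\<^esub> i"
    proof (cases "fst i = X")
      case True
      with i \<open>F = {}\<close> off[of "snd i" x0] x0 show ?thesis
        by (cases i) (auto simp: c_def lmod_direct_sum_simps)
    qed (use other[OF i _ x0] i in \<open>simp add: lmod_direct_sum_simps\<close>)
  qed (use pu[OF x0] in \<open>simp_all add: lmod_direct_sum_simps\<close>)
  with nonzero show False by simp
qed

end

section \<open>Universal towers\<close>

lemma left_module_regular:
  assumes "ring R"
  shows "left_module R (regular_lmod R)"
proof -
  interpret ring R by fact
  have "abelian_group (regular_lmod R)"
    by (rule abelian_groupI) (auto simp: regular_lmod_def a_assoc l_neg intro: a_comm intro!: bexI[of _ "\<ominus>\<^bsub>R\<^esub> _"])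
  then show ?thesis
    by (intro left_module.intro[OF assms] left_module_axioms.intro)
      (auto simp: regular_lmod_def l_distr r_distr m_assoc)
qed

lemma mono_from_one:
  fixes S :: "nat \<Rightarrow> 'a set"
  assumes "\<And>i. i \<ge> 1 \<Longrightarrow> S i \<subseteq> S (Suc i)" "1 \<le> i" "i \<le> j"
  shows "S i \<subseteq> S j"
  using assms(3)
proof (induction j rule: dec_induct)
  case (step n)
  then show ?case using assms(1)[of n] assms(2) by auto
qed simp

lemma hom_into_chain:
  fixes X :: "('r, 'x) module" and Z :: "('r, 'z) module"
  assumes X: "left_module R X" "finitely_presented R X"
    and Z: "left_module R Z" "\<And>i. i \<ge> (1::nat) \<Longrightarrow> submodule (S i) R Z" "\<And>i. i \<ge> 1 \<Longrightarrow> S i \<subseteq> S (Suc i)"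
      "carrier Z = (\<Union>i\<in>{1..}. S i)"
    and u: "u \<in> lmod_hom R X Z"
  shows "\<exists>k\<ge>1. u ` carrier X \<subseteq> S k"
proof -
  interpret X: left_module R X by (rule X)
  obtain n :: nat and h where h: "h \<in> lmod_hom R (free_lmod R {..<n}) X"
    "h ` carrier (free_lmod R {..<n}) = carrier X"
    using X(2) unfolding finitely_presented_def by blast
  let ?M = "\<lambda>_::nat. regular_lmod R"
  define F where "F = lmod_direct_sum {..<n} ?M"
  note h = h[unfolded free_lmod_def, folded F_def]
  have F: "left_module R F" unfolding F_def
    by (rule left_module_direct_sum[OF X.ring_axioms left_module_regular[OF X.ring_axioms]])
  define v where "v w = u (h w)" for w
  have v: "v \<in> lmod_hom R F Z" using lmod_hom_comp[OF h(1) u] by (simp add: v_def[abs_def])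
  let ?e = "\<lambda>j. lmod_single {..<n} ?M j \<one>\<^bsub>R\<^esub>"
  have single: "lmod_single {..<n} ?M j \<in> lmod_hom R (regular_lmod R) F" if "j < n" for j
    unfolding F_def using lmod_single_hom[of "{..<n}" R ?M, OF left_module_regular[OF X.ring_axioms]] that by simp
  have "\<exists>k\<ge>1. v (?e j) \<in> S k" if "j < n" for j
  proof -
    have "?e j \<in> carrier F" by (rule lmod_hom_closed[OF single[OF that]]) (simp add: regular_lmod_def)
    from lmod_hom_closed[OF v this] show ?thesis unfolding Z(4) by auto
  qed
  then obtain k where k: "\<And>j. j < n \<Longrightarrow> k j \<ge> 1" "\<And>j. j < n \<Longrightarrow> v (?e j) \<in> S (k j)" by metis
  define K where "K = Suc (\<Sum>j<n. k j)"
  have e: "v (?e j) \<in> S K" if "j < n" for j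
    using mono_from_one[of S, OF Z(3) k(1)[OF that], of K] k(2)[OF that] member_le_sum[of j "{..<n}" k] that
    by (auto simp: K_def)
  note SK = submoduleD[OF Z(2), of K]
  have "v w \<in> S K" if "w \<in> carrier F" for w
    using that[unfolded F_def] ballI[OF left_module_regular[OF X.ring_axioms]]
  proof (induction w rule: lmod_direct_sum_induct)
    case zero
    show ?case using SK lmod_hom_zero[OF F Z(1) v] by (simp add: F_def K_def)
  next
    case (single j x)
    then have j: "j < n" and x: "x \<in> carrier R" by (auto simp: regular_lmod_def)
    have "lmod_single {..<n} ?M j x = lmod_single {..<n} ?M j (x \<odot>\<^bsub>regular_lmod R\<^esub> \<one>\<^bsub>R\<^esub>)"
      using x by (simp add: regular_lmod_def)
    also have "\<dots> = x \<odot>\<^bsub>F\<^esub> ?e j"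
      by (rule lmod_hom_smult[OF \<open>j < n \<Longrightarrow> lmod_single {..<n} ?M j \<in> lmod_hom R (regular_lmod R) F\<close>[OF j] x])
        (simp add: regular_lmod_def)
    finally have eq: "lmod_single {..<n} ?M j x = x \<odot>\<^bsub>F\<^esub> ?e j" .
    have "?e j \<in> carrier F"
      by (rule lmod_hom_closed[OF \<open>j < n \<Longrightarrow> lmod_single {..<n} ?M j \<in> lmod_hom R (regular_lmod R) F\<close>[OF j]])
        (simp add: regular_lmod_def)
    then show ?case unfolding eq using SK(4)[OF _ x e[OF j]] lmod_hom_smult[OF v x] by (simp add: K_def)
  next
    case (add w w')
    then show ?case using SK(3) lmod_hom_add[OF v] by (simp add: F_def K_def)
  qed
  then have "u ` carrier X \<subseteq> S K" unfolding h(2)[symmetric] by (auto simp: v_def)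
  then show ?thesis by (intro exI[of _ K]) (simp add: K_def)
qed

locale semibrick_tower =
  fixes R :: "('r, 'q) ring_scheme"
    and \<X> :: "('r, 'x) module set"
    and Y :: "('r, 'y) module"
    and T :: "nat \<Rightarrow> 'y set"
    and Z :: "('r, 'y) module"
  assumes semibrick: "semibrick R \<X>" and tower: "universal_tower R \<X> Y T Z"
begin

lemma Z_module: "left_module R Z"
  and submodule: "i \<ge> 1 \<Longrightarrow> submodule (T i) R Z"
  and first: "carrier Y = T 1"
  and union: "carrier Z = (\<Union>i\<in>{1..}. T i)"
proof -
  note t = tower[unfolded universal_tower_def]
  show "left_module R Z" by (rule t[THEN conjunct1])
  show "i \<ge> 1 \<Longrightarrow> submodule (T i) R Z" by (rule t[THEN conjunct2, THEN conjunct1, rule_format])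
  have "Y = Z\<lparr>carrier := T 1\<rparr>" by (rule t[THEN conjunct2, THEN conjunct2, THEN conjunct1, symmetric])
  then show "carrier Y = T 1" by simp
  show "carrier Z = (\<Union>i\<in>{1..}. T i)"
    by (rule t[THEN conjunct2, THEN conjunct2, THEN conjunct2, THEN conjunct2])
qed

lemma X_module: "X \<in> \<X> \<Longrightarrow> left_module R X"
  and X_fp: "X \<in> \<X> \<Longrightarrow> finitely_presented R X"
  using semibrick by (auto simp: semibrick_def brick_def)

abbreviation "level i \<equiv> Z\<lparr>carrier := T i\<rparr>"

lemma step:
  assumes "i \<ge> 1"
  obtains B e p where "universal_extension R \<X> (level i) B e
    \<lparr>ext_inj = (\<lambda>y. y), ext_mid = level (Suc i), ext_proj = p\<rparr>"
proof -
  from tower assms obtain p where "universal_sequence R \<X> (level i)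
    \<lparr>ext_inj = (\<lambda>y. y), ext_mid = level (Suc i), ext_proj = p\<rparr>"
    unfolding universal_tower_def by blast
  then show thesis
    unfolding universal_sequence_def
  proof (elim exE conjE)
    fix B e
    assume "\<forall>X\<in>\<X>. lmod_basis (lmod_End R X) (Ext1 R X (level i)) (B X)"
      "\<forall>X\<in>\<X>. \<forall>b\<in>B X. e X b \<in> b"
      "short_exact R (level i) (lmod_direct_sum (Sigma \<X> B) fst)
        \<lparr>ext_inj = (\<lambda>y. y), ext_mid = level (Suc i), ext_proj = p\<rparr>"
      "ext_equiv R (level i) \<lparr>ext_inj = (\<lambda>y. y), ext_mid = level (Suc i), ext_proj = p\<rparr>
        (universal_pushout \<X> (level i) B e)"
    then have "universal_extension R \<X> (level i) B e
      \<lparr>ext_inj = (\<lambda>y. y), ext_mid = level (Suc i), ext_proj = p\<rparr>"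
      using semibrick by (simp add: universal_extension_def)
    then show thesis by (rule that)
  qed
qed

lemma mono_Suc:
  assumes "i \<ge> 1"
  shows "T i \<subseteq> T (Suc i)"
proof -
  obtain B e p where "universal_extension R \<X> (level i) B e
    \<lparr>ext_inj = (\<lambda>y. y), ext_mid = level (Suc i), ext_proj = p\<rparr>" by (rule step[OF assms])
  then interpret universal_extension R \<X> "level i" B e
    "\<lparr>ext_inj = (\<lambda>y. y), ext_mid = level (Suc i), ext_proj = p\<rparr>" .
  show ?thesis using lmod_hom_closed[OF seq(4)] by auto
qed

lemma mono: "1 \<le> i \<Longrightarrow> i \<le> j \<Longrightarrow> T i \<subseteq> T j"
  by (rule mono_from_one[of T, OF mono_Suc])

lemma hom_drop:
  assumes "i \<ge> 1" "X \<in> \<X>" "u \<in> lmod_hom R X Z" "u ` carrier X \<subseteq> T (Suc i)"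
  shows "u ` carrier X \<subseteq> T i"
proof -
  obtain B e p where "universal_extension R \<X> (level i) B e
    \<lparr>ext_inj = (\<lambda>y. y), ext_mid = level (Suc i), ext_proj = p\<rparr>" by (rule step[OF assms(1)])
  then interpret universal_extension R \<X> "level i" B e
    "\<lparr>ext_inj = (\<lambda>y. y), ext_mid = level (Suc i), ext_proj = p\<rparr>" .
  have "u \<in> lmod_hom R X (level (Suc i))" using assms(3,4) by (auto simp: lmod_hom_def)
  then show ?thesis using hom_into_base[OF assms(2)] by auto
qed

lemma hom_into_first:
  assumes "X \<in> \<X>" "u \<in> lmod_hom R X Z"
  shows "u ` carrier X \<subseteq> T 1"
proof -
  obtain k where k: "k \<ge> 1" "u ` carrier X \<subseteq> T k"
    using hom_into_chain[OF X_module[OF assms(1)] X_fp[OF assms(1)] Z_module submodule mono_Suc union assms(2)]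
    by blast
  show ?thesis using k
  proof (induction k rule: dec_induct)
    case (step n)
    then show ?case using hom_drop[OF _ assms, of n] by simp
  qed simp
qed

lemma pushed_cocycle_trivial:
  assumes "X \<in> \<X>" "short_exact R A X t" "ext_cocycle R A X t \<kappa>"
    and "g \<in> lmod_hom R A Z" "g ` carrier A \<subseteq> T j" "j \<ge> 1"
  obtains m where "lin_defect R X Z m (\<lambda>r x y. g (\<kappa> r x y))" "m ` carrier X \<subseteq> T (Suc j)"
proof -
  obtain B e p where "universal_extension R \<X> (level j) B e
    \<lparr>ext_inj = (\<lambda>y. y), ext_mid = level (Suc j), ext_proj = p\<rparr>" by (rule step[OF assms(6)])
  then interpret universal_extension R \<X> "level j" B e
    "\<lparr>ext_inj = (\<lambda>y. y), ext_mid = level (Suc j), ext_proj = p\<rparr>" .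
  have "g \<in> lmod_hom R A (level j)" using assms(4,5) by (auto simp: lmod_hom_def)
  from pushed_cocycle_trivial[OF assms(1-3) this] obtain m where
    m: "lin_defect R X (level (Suc j)) m (\<lambda>r x y. g (\<kappa> r x y))" by auto
  have "T (Suc j) \<subseteq> carrier Z" using union by auto
  show thesis
  proof (rule that)
    show "lin_defect R X Z m (\<lambda>r x y. g (\<kappa> r x y))"
      using lin_defectD[OF m] \<open>T (Suc j) \<subseteq> carrier Z\<close> by (intro lin_defectI) auto
    show "m ` carrier X \<subseteq> T (Suc j)" using lin_defectD(1)[OF m] by auto
  qed
qed

end

text \<open>
  On each summand \<open>X\<close> of \<open>U(i+1)/U(i)\<close>, with section \<open>\<sigma>\<close>, the failure of \<open>f \<circ> \<sigma>\<close> to be linear takes values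
  in \<open>V(j)\<close>, so it agrees with that of some \<open>m : X \<rightarrow> V(j+1)\<close>; then \<open>f \<circ> \<sigma> - m\<close> is a
  homomorphism \<open>X \<rightarrow> V(\<infinity>)\<close> and has values in \<open>V(1)\<close>.
\<close>

lemma tower_step:
  assumes "semibrick_tower R \<X> U US Uinf" "semibrick_tower R \<X> V VS Vinf"
    and f: "f \<in> lmod_hom R Uinf Vinf" and i: "i \<ge> 1" and j: "j \<ge> 1" and fij: "f ` US i \<subseteq> VS j"
  shows "f ` US (Suc i) \<subseteq> VS (Suc j)"
proof -
  interpret U: semibrick_tower R \<X> U US Uinf by fact
  interpret V: semibrick_tower R \<X> V VS Vinf by fact
  define M where "M = U.level (Suc i)"
  obtain B e p where "universal_extension R \<X> (U.level i) B e
    \<lparr>ext_inj = (\<lambda>y. y), ext_mid = M, ext_proj = p\<rparr>" unfolding M_def by (rule U.step[OF i])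
  then interpret E: universal_extension R \<X> "U.level i" B e
    "\<lparr>ext_inj = (\<lambda>y. y), ext_mid = M, ext_proj = p\<rparr>" .
  let ?s = "\<lparr>ext_inj = (\<lambda>y. y), ext_mid = M, ext_proj = p\<rparr>"
  note s = E.seq[simplified]
  interpret M: left_module R M by (rule s)
  interpret Vi: left_module R Vinf by (rule V.Z_module)
  obtain \<kappa> where \<kappa>: "ext_cocycle R (U.level i) E.S ?s \<kappa>" using ext_cocycle_exists[OF E.exact] by (rule exE)
  then obtain \<sigma> where \<sigma>: "\<And>w. w \<in> carrier E.S \<Longrightarrow> p (\<sigma> w) = w" "lin_defect R E.S M \<sigma> \<kappa>"
    by (rule ext_cocycleE) (rule that, simp_all)
  note \<sigma>cl = lin_defectD(1)[OF \<sigma>(2)]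
  have le: "US i \<subseteq> carrier Uinf" "US (Suc i) \<subseteq> carrier Uinf" using i U.union by auto
  have fM: "f \<in> lmod_hom R M Vinf" and fY: "f \<in> lmod_hom R (U.level i) Vinf"
    using f le by (auto simp: M_def lmod_hom_def Pi_def subset_iff)
  note VSj = submoduleD[OF V.submodule[of "Suc j"], simplified]
  have base: "f y \<in> VS (Suc j)" if "y \<in> US i" for y using fij V.mono_Suc[OF j] that by auto
  have split: "f a \<in> VS (Suc j)"
    if a: "a \<in> carrier M" and b: "b \<in> carrier M" and pab: "p a = p b" and fb: "f b \<in> VS (Suc j)" for a b
  proof -
    have "p (a \<ominus>\<^bsub>M\<^esub> b) = \<zero>\<^bsub>E.S\<^esub>"
      using a b pab lmod_hom_closed[OF s(5)] abelian_group.r_neg[of E.S] s(3)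
      by (simp add: a_minus_def lmod_hom_add[OF s(5)] lmod_hom_minus[OF s(2,3,5)] left_module_def)
    then have "a \<ominus>\<^bsub>M\<^esub> b \<in> US i" using s(9)[of "a \<ominus>\<^bsub>M\<^esub> b"] a b M.minus_closed by simp
    then have "f (a \<ominus>\<^bsub>M\<^esub> b) \<in> VS (Suc j)" by (rule base)
    moreover have "f a = f (a \<ominus>\<^bsub>M\<^esub> b) \<oplus>\<^bsub>Vinf\<^esub> f b"
    proof -
      have "a = (a \<ominus>\<^bsub>M\<^esub> b) \<oplus>\<^bsub>M\<^esub> b"
        using a b unfolding a_minus_def by (metis M.M.a_assoc M.M.a_inv_closed M.M.l_neg M.M.r_zero)
      then show ?thesis using lmod_hom_add[OF fM, of "a \<ominus>\<^bsub>M\<^esub> b" b] a b M.M.minus_closed by metis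
    qed
    ultimately show ?thesis using VSj(3) fb by simp
  qed
  have section_image: "f (\<sigma> (lmod_single E.I fst k x)) \<in> VS (Suc j)"
    if k: "k \<in> E.I" and x: "x \<in> carrier (fst k)" for k x
  proof -
    let ?X = "fst k" and ?\<iota> = "lmod_single E.I fst k"
    have X: "?X \<in> \<X>" using k by auto
    note Xm = U.X_module[OF X]
    have \<iota>: "?\<iota> \<in> lmod_hom R ?X E.S"
      using lmod_single_hom[of E.I R fst, OF E.I_module k] by simp
    obtain m where m: "lin_defect R ?X Vinf m (\<lambda>r x y. f (\<kappa> r (?\<iota> x) (?\<iota> y)))"
      "m ` carrier ?X \<subseteq> VS (Suc j)"
      by (rule V.pushed_cocycle_trivial[OF X short_exact_pullback[OF E.exact Xm \<iota>]
        ext_cocycle_pullback[OF E.exact Xm \<iota> \<kappa>] fY _ j]) (use fij that in auto)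
    note d = lin_defect_comp[OF Xm s(2) lin_defect_precomp[OF Xm \<iota> \<sigma>(2)] fM]
    have "lin_defect R ?X Vinf (\<lambda>x. f (\<sigma> (?\<iota> x)) \<ominus>\<^bsub>Vinf\<^esub> m x) (\<lambda>r x y. \<zero>\<^bsub>Vinf\<^esub>)"
      by (rule lin_defect_cong[OF Xm lin_defect_minus[OF Xm V.Z_module d m(1)]])
        (use lin_defectD(2)[OF m(1)] in \<open>simp_all add: a_minus_def Vi.M.r_neg\<close>)
    then have "(\<lambda>x. f (\<sigma> (?\<iota> x)) \<ominus>\<^bsub>Vinf\<^esub> m x) \<in> lmod_hom R ?X Vinf"
      by (simp add: lin_defect_zero_iff[OF Xm V.Z_module])
    from V.hom_into_first[OF X this] have "f (\<sigma> (?\<iota> x)) \<ominus>\<^bsub>Vinf\<^esub> m x \<in> VS 1" using x by auto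
    then have "f (\<sigma> (?\<iota> x)) \<ominus>\<^bsub>Vinf\<^esub> m x \<in> VS (Suc j)" using V.mono[of 1 "Suc j"] by auto
    moreover have "m x \<in> VS (Suc j)" using m(2) x by auto
    ultimately have "(f (\<sigma> (?\<iota> x)) \<ominus>\<^bsub>Vinf\<^esub> m x) \<oplus>\<^bsub>Vinf\<^esub> m x \<in> VS (Suc j)" by (rule VSj(3))
    moreover have "m x \<in> carrier Vinf" "f (\<sigma> (?\<iota> x)) \<in> carrier Vinf"
      using lin_defectD(1)[OF m(1) x] lin_defectD(1)[OF d x] by auto
    ultimately show ?thesis by (simp add: a_minus_def Vi.M.a_assoc Vi.M.l_neg)
  qed
  have "\<forall>a\<in>carrier M. p a = w \<longrightarrow> f a \<in> VS (Suc j)" if "w \<in> carrier E.S" for w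
    using that E.I_modules
  proof (induction w rule: lmod_direct_sum_induct)
    case zero
    show ?case using s(9) base by auto
  next
    case (single k x)
    have w: "lmod_single E.I fst k x \<in> carrier E.S"
      using lmod_hom_closed[OF lmod_single_hom[of E.I R fst, OF E.I_module single(1)] single(2)] by simp
    show ?case using split[OF _ \<sigma>cl[OF w] _ section_image[OF single]] \<sigma>(1)[OF w] by simp
  next
    case (add v w)
    show ?case
    proof (intro ballI impI)
      fix a assume a: "a \<in> carrier M" "p a = v \<oplus>\<^bsub>E.S\<^esub> w"
      have vw: "f (\<sigma> v) \<in> VS (Suc j)" "f (\<sigma> w) \<in> VS (Suc j)"
        using add \<sigma>(1) \<sigma>cl by auto
      let ?b = "\<sigma> v \<oplus>\<^bsub>M\<^esub> \<sigma> w"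
      have b: "?b \<in> carrier M" using \<sigma>cl[OF add(1)] \<sigma>cl[OF add(2)] by (rule M.M.a_closed)
      have "f ?b \<in> VS (Suc j)"
        using VSj(3)[OF vw] lmod_hom_add[OF fM \<sigma>cl[OF add(1)] \<sigma>cl[OF add(2)]] by simp
      moreover have "p a = p ?b"
        using a(2) lmod_hom_add[OF s(5) \<sigma>cl[OF add(1)] \<sigma>cl[OF add(2)]] \<sigma>(1) add(1,2) by simp
      ultimately show "f a \<in> VS (Suc j)" using split[OF a(1) b] by blast
    qed
  qed
  then have "f a \<in> VS (Suc j)" if "a \<in> carrier M" for a using lmod_hom_closed[OF s(5) that] that by blast
  then show ?thesis by (auto simp: M_def)
qed

lemma semisimple_into_first:
  fixes U :: "('r, 'u) module"
  assumes "semibrick_tower R \<X> V VS Vinf" "semisimple_over R \<X> U" "f \<in> lmod_hom R U Vinf"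
  shows "f ` carrier U \<subseteq> VS 1"
proof -
  interpret V: semibrick_tower R \<X> V VS Vinf by fact
  from assms(2) obtain I :: "'u set" and g \<phi> where U: "left_module R U" and g: "g \<in> I \<rightarrow> \<X>"
    and \<phi>: "\<phi> \<in> lmod_iso R U (lmod_direct_sum I g)"
    unfolding semisimple_over_def lmod_isomorphic_def by blast
  let ?S = "lmod_direct_sum I g"
  have gm: "left_module R (g i)" if "i \<in> I" for i using g that by (auto intro: V.X_module)
  then have gms: "\<forall>i\<in>I. left_module R (g i)" by blast
  have ring: "ring R" using U by (simp add: left_module_def)
  have S: "left_module R ?S" by (rule left_module_direct_sum[OF ring gm])
  obtain \<chi> where \<chi>: "\<chi> \<in> lmod_hom R ?S U" "\<And>x. x \<in> carrier U \<Longrightarrow> \<chi> (\<phi> x) = x"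
    by (rule lmod_iso_inverse[OF U S \<phi>]) (rule that)
  note h = lmod_hom_comp[OF \<chi>(1) assms(3)]
  note VS1 = submoduleD[OF V.submodule[of 1], simplified]
  have "f (\<chi> w) \<in> VS 1" if "w \<in> carrier ?S" for w
    using that gms
  proof (induction w rule: lmod_direct_sum_induct)
    case zero
    show ?case using lmod_hom_zero[OF S V.Z_module h] VS1 by simp
  next
    case (single k x)
    have "g k \<in> \<X>" using g single(1) by auto
    from V.hom_into_first[OF this lmod_hom_comp[OF lmod_single_hom[of I R g, OF gm single(1)] h]] single(2)
    show ?case by auto
  next
    case (add v w)
    then show ?case using VS1 lmod_hom_add[OF h] by simp
  qed
  moreover have "\<phi> x \<in> carrier ?S" if "x \<in> carrier U" for x
    using \<phi> that lmod_hom_closed[of \<phi>] by (auto simp: lmod_iso_def)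
  ultimately show ?thesis using \<chi>(2) by force
qed

theorem corollary4p8:
  fixes R :: "('r, 'q) ring_scheme"
    and \<X> :: "('r, 'x) module set"
    and U Uinf :: "('r, 'u) module"
    and V Vinf :: "('r, 'v) module"
    and US :: "nat \<Rightarrow> 'u set"
    and VS :: "nat \<Rightarrow> 'v set"
    and f :: "'u \<Rightarrow> 'v"
  assumes "ring R"
    and "semibrick R \<X>"
    and "\<forall>X\<in>\<X>. proj_dim_le_one R X"
    and "left_module R U"
    and "left_module R V"
    and "universal_tower R \<X> U US Uinf"
    and "universal_tower R \<X> V VS Vinf"
    and "f \<in> lmod_hom R Uinf Vinf"
  shows "(\<forall>r\<ge>1. f ` carrier U \<subseteq> VS r \<longrightarrow> (\<forall>i\<ge>1. f ` US i \<subseteq> VS (i + r - 1))) \<and>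
         (Filt R \<X> U \<and> Filt R \<X> V \<and> semisimple_over R \<X> U \<longrightarrow> (\<forall>i\<ge>1. f ` US i \<subseteq> VS i))"
proof -
  have towers: "semibrick_tower R \<X> U US Uinf" "semibrick_tower R \<X> V VS Vinf"
    using assms by (simp_all add: semibrick_tower_def)
  interpret U: semibrick_tower R \<X> U US Uinf by (rule towers)
  have shift: "f ` US i \<subseteq> VS (i + r - 1)" if r: "r \<ge> 1" "f ` carrier U \<subseteq> VS r" and i: "i \<ge> 1" for r i
    using i
  proof (induction i rule: dec_induct)
    case base
    show ?case using r U.first by simp
  next
    case (step i)
    have "f ` US (Suc i) \<subseteq> VS (Suc (i + r - 1))"
      by (rule tower_step[OF towers assms(8)]) (use step r in auto)
    then show ?case using r(1) by (simp add: Suc_diff_le)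
  qed
  have "f ` US i \<subseteq> VS i" if "semisimple_over R \<X> U" "i \<ge> 1" for i
  proof -
    have eq: "U = U.level 1" using assms(6) by (simp add: universal_tower_def)
    have "US 1 \<subseteq> carrier Uinf" using U.union by auto
    then have "f \<in> lmod_hom R (U.level 1) Vinf"
      using assms(8) by (auto simp: lmod_hom_def Pi_def subset_iff)
    then have "f \<in> lmod_hom R U Vinf" by (subst eq)
    from semisimple_into_first[OF towers(2) that(1) this] shift[of 1 i] that(2) show ?thesis by simp
  qed
  with shift show ?thesis by blast
qed

end
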